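(* Let $n\ge2$ and let $E\subset\mathbb R^{n+1}$ be uniformly rectifiable in the parabolic sense. Let $\mathbb D(E)=\mathcal G\cup\mathcal B$, $\mathcal G=\bigcup_{\mathbf S^*\in\mathcal S}\mathbf S^*$, $\{\Gamma_{\mathbf S^*}\}_{\mathbf S^*\in\mathcal S}$ be the bilateral corona decomposition of $E$ with constants $\eta\ll1$, $K=\eta^{-1}$ and $b_2=b_2(n,ADR,\text{P-UR})$, and let $M_0=M_0(n,2,1+b_2)>1$ be the local square function constant with $\tilde b_1=2$, $\tilde b_2=1+b_2$ (see context). If $\eta$ is sufficiently small, depending only on the dimension $n$ and the ADR constant of $E$, then the following holds. Let $\mathbf S^*\in\mathcal S$. For every coherent subregime $\mathbf S$ of $\mathbf S^*$, with maximal cube $Q_{\mathbf S}$, there is a $t$-independent plane $P_{\mathbf S}$ and two regular Lip(1/2,1) graphs $\Gamma^\pm_{\mathbf S}$ over $P_{\mathbf S}$, given by functions $\psi^\pm=\psi^\pm_{\eta,\mathbf S}$, with Lip(1/2,1) constants at most $C_n\eta^{15/16}$ ($C_n$ depending only on $n$) and $\|D_t^{1/2}\psi^\pm\|_{P\text{-}BMO}\le 1+b_2$, with the following properties in the coordinates $(t,x',x_n)$ given by $P_{\mathbf S}\oplus P_{\mathbf S}^\perp$, where $\{\pm x_n>\pm\psi^\pm(t,x')\}$ denotes $\{(t,X)=(t,x',x_n):\pm x_n>\pm\psi^\pm(t,x')\}$: (1) If $Q\in\mathbf S$ then $\mathcal W_Q$ has a disjoint decomposition $\mathcal W_Q=\mathcal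 W_Q^+\cup\mathcal W_Q^-$ and, with $U_Q^\pm:=\bigcup_{I\in\mathcal W_Q^\pm}I$, $$U_Q^\pm\subseteq B\big((t_{Q_{\mathbf S}},X_{Q_{\mathbf S}}),K^{3/4}\operatorname{diam}(Q_{\mathbf S})\big)\cap\{\pm x_n>\pm\psi^\pm(t,x')\};$$ in particular $\bigcup_{Q\in\mathbf S}U_Q^\pm$ is contained in the set on the right. (2) If $(t,X)\in\bigcup_{Q\in\mathbf S}U_Q^\pm$ then $\operatorname{dist}((t,X),E)\approx_\eta\operatorname{dist}((t,X),\Gamma^\pm_{\mathbf S})$. (3) If $(t,X)\in B\big((t_{Q_{\mathbf S}},X_{Q_{\mathbf S}}),(K/32)\operatorname{diam}(Q_{\mathbf S})\big)\cap\{\pm x_n>\pm\psi^\pm(t,x')\}$, then $\operatorname{dist}((t,X),E)\ge\operatorname{dist}((t,X),\Gamma^\pm_{\mathbf S})$. (4) $B\big((t_{Q_{\mathbf S}},X_{Q_{\mathbf S}}),(K/32)\operatorname{diam}(Q_{\mathbf S})\big)\cap\{\pm x_n>\pm\psi^\pm(t,x')\}\subseteq\bigcup_{Q\in\mathbf S}U_Q^*$. (5) There exist $(t^\pm_{\mathbf S},X^\pm_{\mathbf S})\in\Gamma^\pm_{\mathbf S}$ such that $$B\big((t_{Q_{\mathbf S}},X_{Q_{\mathbf S}}),M_0K^{3/4}\operatorname{diam}(Q_{\mathbf S})\big)\subset B\big((t^\pm_{\mathbf S},X^\pm_{\mathbf S}),K^{7/8}\operatorname{diam}(Q_{\mathbf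 S})\big)$$ and $$B\big((t^\pm_{\mathbf S},X^\pm_{\mathbf S}),K^{7/8}\operatorname{diam}(Q_{\mathbf S})\big)\subset B\big((t_{Q_{\mathbf S}},X_{Q_{\mathbf S}}),(K/32)\operatorname{diam}(Q_{\mathbf S})\big).$$ All statements with $\pm$ hold for each of the two choices of sign; $\approx_\eta$ means comparability up to constants depending on $\eta$ (and on $n$ and the ADR constant).
   Context: Metric. Points of $\mathbb R^{n+1}=\mathbb R\times\mathbb R^n$ are written $(t,X)$. The parabolic distance is $\operatorname{dist}((t,X),(s,Y))=|X-Y|+|t-s|^{1/2}$, $\operatorname{dist}(A,B)$ is the infimum over pairs; balls $B(\cdot,r)$ (open) and $\operatorname{diam}$ refer to it. $\mathcal H^{n+1}_p$ is the $(n+1)$-dimensional Hausdorff measure of this metric. ADR and P-UR. $E$ is ADR if it is closed and for some $C_0$ (the ADR constant): $C_0^{-1}r^{n+1}\le\mathcal H^{n+1}_p(B((t,X),r)\cap E)\le C_0r^{n+1}$ for all $(t,X)\in E$, $0<r<\operatorname{diam}(E)$; $\sigma:=\mathcal H^{n+1}_p|_E$. An $n$-plane is $t$-independent if it contains a line in the $t$-direction. With $\beta(t,X,r):=\inf_P\big(r^{-n-1}\int_{B((t,X),r)\cap E}(\operatorname{dist}((s,Y),P)/r)^2d\sigma\big)^{1/2}$ (infimum over $t$-independent $n$-planes), $E$ is uniformly rectifiable in the parabolic sense (P-UR) if it is ADR and for some $M$, $\int_0^\rho\int_{B((t,X),\rho)\cap E}\beta(s,Y,r)^2d\sigma\frac{dr}r\le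 M\rho^{n+1}$ for all $(t,X)\in E$, $0<\rho<\operatorname{diam}(E)$. "Depending on ADR / P-UR" means on $C_0$ / on $C_0,M$. Dyadic cubes. $\mathbb D(E)=\bigcup_{k\in\mathbb Z}\mathbb D_k$ is a fixed dyadic decomposition of $E$: for constants $a_0,\gamma>0$, $c_*<\infty$ (depending on $n$, ADR), $\mathbb D_k=\{Q^k_j\}_j$ is a countable family of Borel subsets of $E$ with (i) $E=\bigcup_jQ^k_j$ for each $k$; (ii) if $m\ge k$, either $Q^m_i\subset Q^k_j$ or $Q^m_i\cap Q^k_j=\emptyset$; (iii) for each $(j,k)$ and $m<k$ there is a unique $i$ with $Q^k_j\subset Q^m_i$; (iv) $\operatorname{diam}(Q^k_j)\le c_*2^{-k}$; (v) each $Q^k_j$ contains $E\cap B(z^k_j,a_02^{-k})$ for some $z^k_j\in E$; (vi) $\sigma(\{z\in Q^k_j:\operatorname{dist}(z,E\setminus Q^k_j)\le\varrho2^{-k}\})\le c_*\varrho^\gamma\sigma(Q^k_j)$ for $\varrho\in(0,a_0)$. $(t_Q,X_Q)\in E$ denotes the center of $Q$, i.e. a point with $E\cap B((t_Q,X_Q),r)\subset Q\subset E\cap B((t_Q,X_Q),Cr)$, $r\approx\operatorname{diam}(Q)$. For $K>1$, $KQ:=\{z\in E:\operatorname{dist}(z,Q)<(K-1)\operatorname{diam}(Q)\}$. Regular Lip(1/2,1) graphs. Let $P$ be a $t$-independent plane, identified with $\mathbb R^n=\{(t,x'):t\in\mathbb R,x'\in\mathbb R^{n-1}\}$. The graph $\{(p,\psi(p)):p\in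 P\}$ of $\psi:P\to P^\perp$ is a regular Lip(1/2,1) graph if for some $b_1,b_2$: $|\psi(t,x')-\psi(s,y')|\le b_1(|x'-y'|+|t-s|^{1/2})$ (the Lip(1/2,1) constant is at most $b_1$), and $\|D_t^{1/2}\psi\|_{P\text{-}BMO(\mathbb R^n)}\le b_2$, where $P$-$BMO$ is BMO with respect to parabolic balls and $D_t^{1/2}\psi(t,x')=\hat c\,\mathrm{p.v.}\int_{\mathbb R}\frac{\psi(s,x')-\psi(t,x')}{|s-t|^{3/2}}ds$ ($\hat c$ the normalizing constant) is the half-order time derivative. Coherency. $\mathbf S\subset\mathbb D(E)$ is coherent if (a) it has a unique maximal element $Q(\mathbf S)$ containing all other elements; (b) $Q\in\mathbf S$ and $Q\subset\widetilde Q\subset Q(\mathbf S)$ imply $\widetilde Q\in\mathbf S$; (c) for $Q\in\mathbf S$, either all children of $Q$ belong to $\mathbf S$ or none do. A coherent subregime of $\mathbf S^*$ is a coherent $\mathbf S\subseteq\mathbf S^*$; $Q_{\mathbf S}:=Q(\mathbf S)$. Bilateral corona decomposition with constants $\eta$, $K=\eta^{-1}$, $b_2$ (known to exist for P-UR sets for every $0<\eta\ll1$, with $b_2$ depending only on $n$, ADR, P-UR and not on $\eta$, and $C_\eta$ also on $\eta$): a disjoint decomposition $\mathbb D(E)=\mathcal G\cup\mathcal B$ with (1) $\mathcal G=\bigcup_{\mathbf S^*\in\mathcal S}\mathbf S^*$ a disjoint union of coherent families; (2) $\sum_{Q'\subset Q,Q'\in\mathcal B}\sigma(Q')+\sum_{\mathbf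 S^*:Q(\mathbf S^* )\subset Q}\sigma(Q(\mathbf S^* ))\le C_\eta\sigma(Q)$ for all $Q\in\mathbb D(E)$; (3) for each $\mathbf S^*$ a regular Lip(1/2,1) graph $\Gamma_{\mathbf S^*}$ whose defining function has Lip(1/2,1) constant at most $\eta$ and half-order time derivative with $P$-$BMO$ norm at most $b_2$, such that for every $Q\in\mathbf S^*$, $\sup_{z\in KQ}\operatorname{dist}(z,\Gamma_{\mathbf S^*})+\sup_{z\in B((t_Q,X_Q),K\operatorname{diam}(Q))\cap\Gamma_{\mathbf S^*}}\operatorname{dist}(z,E)<\eta\operatorname{diam}(Q)$. Whitney regions. $\mathcal W(E^c)$ is a Whitney decomposition of $E^c=\mathbb R^{n+1}\setminus E$ into closed parabolic dyadic cubes with disjoint interiors, with $4\operatorname{diam}(I)\le\operatorname{dist}(4I,E)\le\operatorname{dist}(I,E)\le100\operatorname{diam}(I)$. For $Q\in\mathbb D(E)$, $\mathcal W_Q=\{I\in\mathcal W(E^c):\eta^{1/4}\operatorname{diam}(Q)\le\operatorname{dist}(I,E)\le\operatorname{dist}(I,Q)\le K^{1/4}\operatorname{diam}(Q)\}$, $\mathcal W^*_Q=\{I\in\mathcal W(E^c):\eta^4\operatorname{diam}(Q)\le\operatorname{dist}(I,E)\le\operatorname{dist}(I,Q)\le K\operatorname{diam}(Q)\}$, and $U^*_Q=\bigcup_{I\in\mathcal W^*_Q}I$. The constant $M_0$. It is known that for $\tilde b_1,\tilde b_2\ge0$ there are $M_0=M_0(n,\tilde b_1,\tilde b_2)>1$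 and $c_5=c_5(n,\tilde b_1,\tilde b_2)$ such that, whenever $\varphi$ is Lip(1/2,1) with constant $\tilde b_1$, $\|D_t^{1/2}\varphi\|_{P\text{-}BMO}\le\tilde b_2$, $\Omega^+=\{x_n>\varphi(t,x')\}$, $z_0\in\partial\Omega^+$, $r>0$, and $u$ is a bounded solution of $(\partial_t-\Delta_X)u=0$ in $B(z_0,M_0r)\cap\Omega^+$, one has $\iint_{B(z_0,r)\cap\Omega^+}|\nabla_X u|^2\operatorname{dist}(\cdot,\partial\Omega^+)\,dY\,ds\le c_5r^{n+1}\|u\|^2_{L^\infty(B(z_0,M_0r)\cap\Omega^+)}$ (and similarly for $\Omega^-=\{x_n<\varphi\}$). $M_0$ here denotes this constant for $\tilde b_1=2$, $\tilde b_2=1+b_2$.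
   Formalization: The first inclusion in (5) is proved for η below a threshold that may also depend on M_0 (hence on b_2), since it forces M_0 ≤ K^{1/8} and so cannot hold for η small depending only on n and ADR; all other claims hold with the stated dependence. *)

theory Defs
  imports "HOL-Analysis.Analysis"
begin

text \<open>
  Points \<open>(t, X)\<close> of space-time are pairs; the spatial part lives in \<open>real ^ 'n\<close>, so that
  \<open>n\<close> is \<open>CARD('n)\<close>. The parameter space \<open>\<real> \<times> \<real>^(n-1)\<close> of a \<open>t\<close>-independent plane is
  \<open>real \<times> real ^ 'm\<close> with \<open>CARD('n) = CARD('m) + 1\<close>.
\<close>

type_synonym 'n stpt = "real \<times> (real, 'n) vec"
type_synonym 'n cube = "'n stpt set"


section \<open>Parabolic metric and Hausdorff measure\<close>

definition pdist :: "real \<times> 'a::real_normed_vector \<Rightarrow> real \<times> 'a \<Rightarrow> real" where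
  "pdist z w = norm (snd z - snd w) + sqrt \<bar>fst z - fst w\<bar>"

definition pball :: "real \<times> 'a::real_normed_vector \<Rightarrow> real \<Rightarrow> (real \<times> 'a) set" where
  "pball z r = {w. pdist z w < r}"

text \<open>Diameters and distances are extended reals, so that unbounded sets have diameter \<open>\<infinity>\<close> and the
  distance to the empty set is \<open>\<infinity>\<close>; \<open>rdiam\<close> is only used for bounded sets.\<close>

definition pdiam :: "(real \<times> 'a::real_normed_vector) set \<Rightarrow> ennreal" where
  "pdiam A = (SUP z\<in>A. SUP w\<in>A. ennreal (pdist z w))"

definition rdiam :: "(real \<times> 'a::real_normed_vector) set \<Rightarrow> real" where
  "rdiam A = enn2real (pdiam A)"

definition pdist_set :: "(real \<times> 'a::real_normed_vector) set \<Rightarrow> (real \<times> 'a) set \<Rightarrow> ennreal" where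
  "pdist_set A B = (INF z\<in>A. INF w\<in>B. ennreal (pdist z w))"

definition pdist_pt :: "real \<times> 'a::real_normed_vector \<Rightarrow> (real \<times> 'a) set \<Rightarrow> ennreal" where
  "pdist_pt z B = pdist_set {z} B"

definition hausdorff_pre ::
    "nat \<Rightarrow> ennreal \<Rightarrow> (real \<times> 'a::real_normed_vector) set \<Rightarrow> ennreal" where
  "hausdorff_pre d \<delta> A =
     (INF U \<in> {U :: nat \<Rightarrow> (real \<times> 'a) set. A \<subseteq> (\<Union>i. U i) \<and> (\<forall>i. pdiam (U i) \<le> \<delta>)}.
        \<Sum>i. pdiam (U i) ^ d)"

definition hausdorff_outer :: "nat \<Rightarrow> (real \<times> 'a::real_normed_vector) set \<Rightarrow> ennreal" where
  "hausdorff_outer d A = (SUP \<delta>\<in>{0<..}. hausdorff_pre d \<delta> A)"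

text \<open>The parabolic and the Euclidean metric have the same Borel sets. The surface measure of a
  closed set \<open>E\<close> is the restriction of \<open>pH\<close> to \<open>E\<close>.\<close>

definition pH :: "'n::finite stpt measure" where
  "pH = measure_of UNIV (sets borel) (hausdorff_outer (CARD('n) + 1))"


section \<open>ADR and P-UR sets\<close>

definition ADR :: "real \<Rightarrow> 'n::finite stpt set \<Rightarrow> bool" where
  "ADR C0 E \<longleftrightarrow> closed E \<and> C0 > 0 \<and>
     (\<forall>z\<in>E. \<forall>r>0. ennreal r < pdiam E \<longrightarrow>
        ennreal (r ^ (CARD('n) + 1) / C0) \<le> emeasure pH (pball z r \<inter> E) \<and>
        emeasure pH (pball z r \<inter> E) \<le> ennreal (C0 * r ^ (CARD('n) + 1)))"

definition t_indep_plane :: "'n::finite stpt set \<Rightarrow> bool" where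
  "t_indep_plane P \<longleftrightarrow> affine P \<and> aff_dim P = int CARD('n) \<and> (\<exists>X. \<forall>s. (s, X) \<in> P)"

definition beta :: "'n::finite stpt set \<Rightarrow> 'n stpt \<Rightarrow> real \<Rightarrow> real" where
  "beta E z r =
     (INF P \<in> {P. t_indep_plane P}.
        sqrt (enn2real (\<integral>\<^sup>+ w \<in> pball z r \<inter> E. (pdist_pt w P / ennreal r)\<^sup>2 \<partial>pH)
              / r ^ (CARD('n) + 1)))"

definition PUR :: "real \<Rightarrow> real \<Rightarrow> 'n::finite stpt set \<Rightarrow> bool" where
  "PUR C0 M E \<longleftrightarrow> ADR C0 E \<and>
     (\<forall>z\<in>E. \<forall>\<rho>>0. ennreal \<rho> < pdiam E \<longrightarrow>
        (\<integral>\<^sup>+ r \<in> {0<..<\<rho>}.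
            (\<integral>\<^sup>+ w \<in> pball z \<rho> \<inter> E. ennreal ((beta E w r)\<^sup>2) \<partial>pH) * ennreal (1 / r) \<partial>lborel)
        \<le> ennreal (M * \<rho> ^ (CARD('n) + 1)))"


section \<open>Dyadic cubes and coherency\<close>

definition dyadic_system ::
    "'n::finite stpt set \<Rightarrow> real \<Rightarrow> real \<Rightarrow> real \<Rightarrow> (int \<Rightarrow> 'n cube set) \<Rightarrow> bool" where
  "dyadic_system E a0 \<gamma> cs D \<longleftrightarrow>
     (\<forall>k. countable (D k) \<and> (\<forall>Q\<in>D k. Q \<in> sets borel \<and> Q \<subseteq> E)) \<and>
     (\<forall>k. E = \<Union>(D k)) \<and>
     (\<forall>k m. k \<le> m \<longrightarrow> (\<forall>Q\<in>D m. \<forall>Q'\<in>D k. Q \<subseteq> Q' \<or> Q \<inter> Q' = {})) \<and>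
     (\<forall>k m. m < k \<longrightarrow> (\<forall>Q\<in>D k. \<exists>!Q'. Q' \<in> D m \<and> Q \<subseteq> Q')) \<and>
     (\<forall>k. \<forall>Q\<in>D k. pdiam Q \<le> ennreal (cs * 2 powr (- real_of_int k))) \<and>
     (\<forall>k. \<forall>Q\<in>D k. \<exists>z\<in>E. E \<inter> pball z (a0 * 2 powr (- real_of_int k)) \<subseteq> Q) \<and>
     (\<forall>k. \<forall>Q\<in>D k. \<forall>\<rho>\<in>{0<..<a0}.
        emeasure pH {z \<in> Q. pdist_pt z (E - Q) \<le> ennreal (\<rho> * 2 powr (- real_of_int k))}
        \<le> ennreal (cs * \<rho> powr \<gamma>) * emeasure pH Q)"

definition cubes :: "(int \<Rightarrow> 'n cube set) \<Rightarrow> 'n cube set" where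
  "cubes D = (\<Union>k. D k)"

text \<open>The constant \<open>Cc\<close> makes the two comparabilities in the definition of the center explicit.\<close>

definition is_center :: "'n::finite stpt set \<Rightarrow> real \<Rightarrow> 'n cube \<Rightarrow> 'n stpt \<Rightarrow> bool" where
  "is_center E Cc Q z \<longleftrightarrow> z \<in> E \<and>
     (\<exists>r. rdiam Q / Cc \<le> r \<and> r \<le> Cc * rdiam Q \<and>
          E \<inter> pball z r \<subseteq> Q \<and> Q \<subseteq> E \<inter> pball z (Cc * r))"

definition dilate_cube :: "'n::finite stpt set \<Rightarrow> real \<Rightarrow> 'n cube \<Rightarrow> 'n cube" where
  "dilate_cube E K Q = {z \<in> E. pdist_pt z Q < ennreal ((K - 1) * rdiam Q)}"

text \<open>A cube is a set and may belong to several generations. Requiring proper inclusion makes the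
  children of \<open>Q\<close> those taken from the finest generation containing \<open>Q\<close>; in particular \<open>Q\<close> is
  not a child of itself.\<close>

definition is_child :: "(int \<Rightarrow> 'n cube set) \<Rightarrow> 'n cube \<Rightarrow> 'n cube \<Rightarrow> bool" where
  "is_child D Q' Q \<longleftrightarrow> (\<exists>k. Q \<in> D k \<and> Q' \<in> D (k + 1) \<and> Q' \<subset> Q)"

definition is_top :: "'n cube set \<Rightarrow> 'n cube \<Rightarrow> bool" where
  "is_top S Q \<longleftrightarrow> Q \<in> S \<and> (\<forall>Q'\<in>S. Q' \<subseteq> Q)"

definition top_cube :: "'n cube set \<Rightarrow> 'n cube" where
  "top_cube S = (THE Q. is_top S Q)"

definition coherent :: "(int \<Rightarrow> 'n cube set) \<Rightarrow> 'n cube set \<Rightarrow> bool" where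
  "coherent D S \<longleftrightarrow> S \<subseteq> cubes D \<and>
     (\<exists>!Q. is_top S Q) \<and>
     (\<forall>Q\<in>S. \<forall>Q'\<in>cubes D. Q \<subseteq> Q' \<and> Q' \<subseteq> top_cube S \<longrightarrow> Q' \<in> S) \<and>
     (\<forall>Q\<in>S. (\<forall>Q'. is_child D Q' Q \<longrightarrow> Q' \<in> S) \<or> (\<forall>Q'. is_child D Q' Q \<longrightarrow> Q' \<notin> S))"


section \<open>Regular Lip(1/2,1) graphs\<close>

definition lip_half_one :: "real \<Rightarrow> (real \<times> 'a::real_normed_vector \<Rightarrow> real) \<Rightarrow> bool" where
  "lip_half_one b \<psi> \<longleftrightarrow> (\<forall>z w. \<bar>\<psi> z - \<psi> w\<bar> \<le> b * pdist z w)"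

definition half_trunc ::
    "(real \<times> 'a::real_normed_vector \<Rightarrow> real) \<Rightarrow> real \<times> 'a \<Rightarrow> real \<times> real \<Rightarrow> real" where
  "half_trunc \<psi> z = (\<lambda>(\<epsilon>, R).
     LINT s:{s. \<epsilon> < \<bar>s - fst z\<bar> \<and> \<bar>s - fst z\<bar> < R}|lborel.
       (\<psi> (s, snd z) - \<psi> z) / \<bar>s - fst z\<bar> powr (3/2))"

text \<open>For a Lip(1/2,1) function the integrand is in general not absolutely integrable at \<open>s = t\<close>
  nor at infinity; the principal value is the limit of the truncations at both ends.\<close>

definition pv_filter :: "(real \<times> real) filter" where
  "pv_filter = at_right 0 \<times>\<^sub>F at_top"

definition half_deriv_exists ::
    "(real \<times> 'a::real_normed_vector \<Rightarrow> real) \<Rightarrow> real \<times> 'a \<Rightarrow> bool" where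
  "half_deriv_exists \<psi> z \<longleftrightarrow> (\<exists>l. (half_trunc \<psi> z \<longlongrightarrow> l) pv_filter)"

text \<open>The factor normalizes the multiplier of the operator to be the square root of \<open>\<bar>\<tau>\<bar>\<close>, where
  that of the time derivative is \<open>\<i> \<tau>\<close>: the integral of \<open>(exp (\<i> \<tau> h) - 1) / \<bar>h\<bar> powr (3/2)\<close>
  over \<open>h\<close> is \<open>- 2 * sqrt (2 * pi) * sqrt \<bar>\<tau>\<bar>\<close>.\<close>

definition half_deriv :: "(real \<times> 'a::real_normed_vector \<Rightarrow> real) \<Rightarrow> real \<times> 'a \<Rightarrow> real" where
  "half_deriv \<psi> z = - 1 / (2 * sqrt (2 * pi)) * Lim pv_filter (half_trunc \<psi> z)"

definition pavg :: "(real \<times> 'a::euclidean_space) set \<Rightarrow> (real \<times> 'a \<Rightarrow> real) \<Rightarrow> real" where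
  "pavg B f = (LINT w:B|lborel. f w) / measure lborel B"

definition pbmo_norm :: "(real \<times> 'a::euclidean_space \<Rightarrow> real) \<Rightarrow> ennreal" where
  "pbmo_norm f =
     (if \<forall>z r. set_integrable lborel (pball z r) f
      then SUP z. SUP r\<in>{0<..}.
             ennreal (pavg (pball z r) (\<lambda>w. \<bar>f w - pavg (pball z r) f\<bar>))
      else \<infinity>)"

definition regular_fun :: "real \<Rightarrow> real \<Rightarrow> (real \<times> 'a::euclidean_space \<Rightarrow> real) \<Rightarrow> bool" where
  "regular_fun b1 b2 \<psi> \<longleftrightarrow> lip_half_one b1 \<psi> \<and>
     (AE z in lborel. half_deriv_exists \<psi> z) \<and> pbmo_norm (half_deriv \<psi>) \<le> ennreal b2"

text \<open>Orthonormal coordinates \<open>(t, x', x\<^sub>n)\<close> adapted to a \<open>t\<close>-independent plane \<open>P\<close>: an origin \<open>q\<close>,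
  an isometric identification \<open>L\<close> of the spatial directions of \<open>P\<close> with \<open>\<real>^(n-1)\<close>, and a unit
  normal \<open>\<nu>\<close>.\<close>

definition plane_coords ::
    "'n::finite stpt set \<Rightarrow> real^'n \<Rightarrow> (real^'m \<Rightarrow> real^'n) \<Rightarrow> real^'n \<Rightarrow> bool" where
  "plane_coords P q L \<nu> \<longleftrightarrow> linear L \<and> (\<forall>x. norm (L x) = norm x) \<and>
     norm \<nu> = 1 \<and> (\<forall>x. L x \<bullet> \<nu> = 0) \<and> P = {(t, q + L x) | t x. True}"

definition chart ::
    "real^'n \<Rightarrow> (real^'m \<Rightarrow> real^'n) \<Rightarrow> real^'n \<Rightarrow> real \<Rightarrow> real^'m \<Rightarrow> real \<Rightarrow> 'n stpt" where
  "chart q L \<nu> t x y = (t, q + L x + y *\<^sub>R \<nu>)"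

definition graph_over ::
    "real^'n \<Rightarrow> (real^'m \<Rightarrow> real^'n) \<Rightarrow> real^'n \<Rightarrow> ('m stpt \<Rightarrow> real) \<Rightarrow> 'n stpt set" where
  "graph_over q L \<nu> \<psi> = {chart q L \<nu> t x (\<psi> (t, x)) | t x. True}"

text \<open>The sign \<open>s\<close> is \<open>1\<close> or \<open>-1\<close>; this is the set where \<open>s x\<^sub>n > s \<psi>(t, x')\<close>.\<close>

definition graph_side ::
    "real^'n \<Rightarrow> (real^'m \<Rightarrow> real^'n) \<Rightarrow> real^'n \<Rightarrow> real \<Rightarrow> ('m stpt \<Rightarrow> real)
       \<Rightarrow> 'n stpt set" where
  "graph_side q L \<nu> s \<psi> = {chart q L \<nu> t x y | t x y. s * y > s * \<psi> (t, x)}"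

definition regular_graph :: "'m::finite itself \<Rightarrow> real \<Rightarrow> real \<Rightarrow> 'n::finite stpt set \<Rightarrow> bool" where
  "regular_graph _ b1 b2 \<Gamma> \<longleftrightarrow>
     (\<exists>P q (L :: real^'m \<Rightarrow> real^'n) \<nu> \<psi>.
        t_indep_plane P \<and> plane_coords P q L \<nu> \<and> regular_fun b1 b2 \<psi> \<and>
        \<Gamma> = graph_over q L \<nu> \<psi>)"


section \<open>Bilateral corona decomposition\<close>

definition bilateral_corona ::
    "'m::finite itself \<Rightarrow> 'n::finite stpt set \<Rightarrow> (int \<Rightarrow> 'n cube set) \<Rightarrow> ('n cube \<Rightarrow> 'n stpt)
       \<Rightarrow> real \<Rightarrow> real \<Rightarrow> real \<Rightarrow> 'n cube set \<Rightarrow> 'n cube set \<Rightarrow> 'n cube set set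
       \<Rightarrow> ('n cube set \<Rightarrow> 'n stpt set) \<Rightarrow> bool" where
  "bilateral_corona T E D ctr \<eta> b2 C\<eta> \<G> \<B> \<S> \<Gamma> \<longleftrightarrow>
     cubes D = \<G> \<union> \<B> \<and> \<G> \<inter> \<B> = {} \<and>
     \<G> = \<Union>\<S> \<and> pairwise disjnt \<S> \<and> (\<forall>S\<in>\<S>. coherent D S) \<and>
     (\<forall>Q\<in>cubes D.
        (\<Sum>\<^sub>\<infinity>Q'\<in>{Q'\<in>\<B>. Q' \<subseteq> Q}. emeasure pH Q') +
        (\<Sum>\<^sub>\<infinity>S\<in>{S\<in>\<S>. top_cube S \<subseteq> Q}. emeasure pH (top_cube S))
        \<le> ennreal C\<eta> * emeasure pH Q) \<and>
     (\<forall>S\<in>\<S>. regular_graph T \<eta> b2 (\<Gamma> S) \<and>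
        (\<forall>Q\<in>S.
           (SUP z \<in> dilate_cube E (1 / \<eta>) Q. pdist_pt z (\<Gamma> S)) +
           (SUP z \<in> pball (ctr Q) (1 / \<eta> * rdiam Q) \<inter> \<Gamma> S. pdist_pt z E)
           < ennreal (\<eta> * rdiam Q)))"


section \<open>Whitney regions\<close>

text \<open>The closed parabolic cube with center \<open>z\<close>, spatial side length \<open>l\<close> and time length \<open>l\<^sup>2\<close>.\<close>

definition pcube :: "'n::finite stpt \<Rightarrow> real \<Rightarrow> 'n stpt set" where
  "pcube z l = {w. \<bar>fst w - fst z\<bar> \<le> l\<^sup>2 / 2 \<and> (\<forall>i. \<bar>snd w $ i - snd z $ i\<bar> \<le> l / 2)}"

definition dyadic_params :: "'n::finite stpt \<Rightarrow> real \<Rightarrow> bool" where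
  "dyadic_params z l \<longleftrightarrow>
     (\<exists>k::int. l = 2 powr (real_of_int k)) \<and>
     (\<exists>j::int. fst z = (real_of_int j + 1/2) * l\<^sup>2) \<and>
     (\<forall>i. \<exists>j::int. snd z $ i = (real_of_int j + 1/2) * l)"

definition whitney :: "'n::finite stpt set \<Rightarrow> 'n stpt set set \<Rightarrow> bool" where
  "whitney E W \<longleftrightarrow>
     \<Union>W = - E \<and>
     (\<forall>I\<in>W. \<forall>J\<in>W. I \<noteq> J \<longrightarrow> interior I \<inter> interior J = {}) \<and>
     (\<forall>I\<in>W. \<exists>z l. dyadic_params z l \<and> I = pcube z l \<and>
        4 * pdiam I \<le> pdist_set (pcube z (4 * l)) E \<and>
        pdist_set (pcube z (4 * l)) E \<le> pdist_set I E \<and>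
        pdist_set I E \<le> 100 * pdiam I)"

text \<open>\<open>whitney_near E W a b Q\<close> with \<open>(a, b)\<close> equal to \<open>(\<eta>^(1/4), K^(1/4))\<close> and \<open>(\<eta>^4, K)\<close> gives
  the two families of Whitney cubes associated with \<open>Q\<close>.\<close>

definition whitney_near ::
    "'n::finite stpt set \<Rightarrow> 'n stpt set set \<Rightarrow> real \<Rightarrow> real \<Rightarrow> 'n cube \<Rightarrow> 'n stpt set set" where
  "whitney_near E W a b Q =
     {I\<in>W. ennreal (a * rdiam Q) \<le> pdist_set I E \<and> pdist_set I E \<le> pdist_set I Q \<and>
           pdist_set I Q \<le> ennreal (b * rdiam Q)}"

definition W_Q ::
    "'n::finite stpt set \<Rightarrow> 'n stpt set set \<Rightarrow> real \<Rightarrow> 'n cube \<Rightarrow> 'n stpt set set" where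
  "W_Q E W \<eta> Q = whitney_near E W (\<eta> powr (1/4)) ((1 / \<eta>) powr (1/4)) Q"

definition Wstar_Q ::
    "'n::finite stpt set \<Rightarrow> 'n stpt set set \<Rightarrow> real \<Rightarrow> 'n cube \<Rightarrow> 'n stpt set set" where
  "Wstar_Q E W \<eta> Q = whitney_near E W (\<eta> ^ 4) (1 / \<eta>) Q"

definition Ustar_Q ::
    "'n::finite stpt set \<Rightarrow> 'n stpt set set \<Rightarrow> real \<Rightarrow> 'n cube \<Rightarrow> 'n stpt set" where
  "Ustar_Q E W \<eta> Q = \<Union>(Wstar_Q E W \<eta> Q)"


section \<open>The local square function constant\<close>

definition dt :: "(real \<times> 'a \<Rightarrow> real) \<Rightarrow> real \<times> 'a \<Rightarrow> real" where
  "dt u z = deriv (\<lambda>s. u (s, snd z)) (fst z)"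

definition dx :: "'a::real_normed_vector \<Rightarrow> (real \<times> 'a \<Rightarrow> real) \<Rightarrow> real \<times> 'a \<Rightarrow> real" where
  "dx e u z = deriv (\<lambda>h. u (fst z, snd z + h *\<^sub>R e)) 0"

text \<open>Classical solutions; by interior regularity every weak solution is one.\<close>

definition heat_solution :: "(real \<times> 'a::euclidean_space) set \<Rightarrow> (real \<times> 'a \<Rightarrow> real) \<Rightarrow> bool" where
  "heat_solution D u \<longleftrightarrow>
     continuous_on D u \<and> continuous_on D (dt u) \<and>
     (\<forall>e\<in>Basis. continuous_on D (dx e u)) \<and>
     (\<forall>e\<in>Basis. \<forall>f\<in>Basis. continuous_on D (dx f (dx e u))) \<and>
     (\<forall>z\<in>D. (\<lambda>s. u (s, snd z)) differentiable (at (fst z)) \<and>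
        (\<forall>e\<in>Basis. (\<lambda>h. u (fst z, snd z + h *\<^sub>R e)) differentiable (at 0) \<and>
           (\<forall>f\<in>Basis. (\<lambda>h. dx e u (fst z, snd z + h *\<^sub>R f)) differentiable (at 0))) \<and>
        dt u z - (\<Sum>e\<in>Basis. dx e (dx e u) z) = 0)"

text \<open>Here the spatial variable is \<open>(x', x\<^sub>n)\<close> in \<open>real ^ 'm \<times> real\<close>, and \<open>n + 1 = CARD('m) + 2\<close>.\<close>

definition side_domain ::
    "real \<Rightarrow> ('m stpt \<Rightarrow> real) \<Rightarrow> (real \<times> (real^'m) \<times> real) set" where
  "side_domain s \<phi> = {(t, x, y). s * y > s * \<phi> (t, x)}"

definition square_function_const :: "'m::finite itself \<Rightarrow> real \<Rightarrow> real \<Rightarrow> real \<Rightarrow> bool" where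
  "square_function_const _ b1 b2 M0 \<longleftrightarrow> M0 > 1 \<and>
     (\<exists>c5. \<forall>\<phi> :: 'm stpt \<Rightarrow> real. regular_fun b1 b2 \<phi> \<longrightarrow>
        (\<forall>s\<in>{1, -1}. \<forall>z0\<in>frontier (side_domain s \<phi>). \<forall>r>0. \<forall>u.
           heat_solution (pball z0 (M0 * r) \<inter> side_domain s \<phi>) u \<and>
           bounded (u ` (pball z0 (M0 * r) \<inter> side_domain s \<phi>)) \<longrightarrow>
           (\<integral>\<^sup>+ z \<in> pball z0 r \<inter> side_domain s \<phi>.
              ennreal (\<Sum>e\<in>Basis. (dx e u z)\<^sup>2) * pdist_pt z (frontier (side_domain s \<phi>)) \<partial>lborel)
           \<le> ennreal (c5 * r ^ (CARD('m) + 2) *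
                (SUP z \<in> pball z0 (M0 * r) \<inter> side_domain s \<phi>. \<bar>u z\<bar>)\<^sup>2)))"

end

theory Submission
  imports Defs
begin

text \<open>
  Over the plane of the corona graph, with defining function \<open>\<psi>\<close>, put
  \<open>\<psi>\<^sup>\<plusminus> = \<psi> \<plusminus> \<eta>^(15/16) g\<close>, where \<open>g(p)\<^sup>2\<close> is the infimum of
  \<open>diam(Q)\<^sup>2 + \<bar>x - y\<bar>\<^sup>2 + \<bar>t - s\<bar>\<close> over \<open>Q \<in> S\<close> and projections \<open>(s, y)\<close> of points of \<open>Q\<close>,
  capped at \<open>diam(Q\<^sub>S)\<^sup>2\<close>. As an infimum, \<open>g\<^sup>2\<close> is 1-Lipschitz in time, hence
  \<open>\<bar>g(s) - g(t)\<bar> \<le> min (\<bar>s - t\<bar> / m) m\<close> with \<open>m = max (g(s)) (g(t))\<close>. Since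
  \<open>min (\<bar>u\<bar> / m) m / \<bar>u\<bar>^(3/2)\<close> has integral 8 for every \<open>m > 0\<close>, Tonelli's theorem
  bounds the mean over a parabolic ball of the part of \<open>D\<^sub>t\<^sup>1\<^sup>/\<^sup>2 g\<close> coming from increments
  inside the ball; the part coming from longer increments has bounded oscillation. So
  \<open>D\<^sub>t\<^sup>1\<^sup>/\<^sup>2 g\<close> is in BMO, without any smoothing.

  On the scale \<open>g\<close> the set \<open>E\<close> is within \<open>O(\<eta> g)\<close> of the graph of \<open>\<psi>\<close>, which is much less
  than \<open>\<eta>^(15/16) g\<close>: thus \<open>E\<close> lies between the two shifted graphs. Conversely Whitney cubes in
  \<open>W_Q\<close> are at distance at least \<open>\<eta>^(1/4) diam(Q)\<close> from \<open>E\<close>, and \<open>\<eta>^(15/16) g\<close> is much smaller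
  than that there, so they lie outside.
\<close>

section \<open>Real-analysis preliminaries\<close>

lemma sqrt_abs_triangle: "sqrt \<bar>a - c\<bar> \<le> sqrt \<bar>a - b\<bar> + sqrt \<bar>b - (c::real)\<bar>"
proof -
  have "sqrt \<bar>a - c\<bar> \<le> sqrt (\<bar>a - b\<bar> + \<bar>b - c\<bar>)"
    by (intro real_sqrt_le_mono) auto
  also have "\<dots> \<le> sqrt \<bar>a - b\<bar> + sqrt \<bar>b - c\<bar>"
    by (rule sqrt_add_le_add_sqrt) auto
  finally show ?thesis .
qed

lemma le_mult_of_forall_greater:
  fixes a b x :: real
  assumes "0 < a" "\<And>\<epsilon>. b < \<epsilon> \<Longrightarrow> x \<le> a * \<epsilon>"
  shows "x \<le> a * b"
proof -
  have "x / a \<le> b"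
    by (rule dense_ge) (use assms in \<open>simp add: field_simps\<close>)
  then show ?thesis
    using assms(1) by (simp add: field_simps)
qed

lemma ennreal_le_multI:
  assumes "x \<le> ennreal b" "ennreal c \<le> y" "b \<le> k * c" "0 \<le> k" "0 \<le> c"
  shows "x \<le> ennreal k * y"
proof -
  have "x \<le> ennreal (k * c)"
    using assms(1) ennreal_leI[OF assms(3)] by (rule order_trans)
  also have "\<dots> = ennreal k * ennreal c"
    using assms(4,5) by (rule ennreal_mult)
  also have "\<dots> \<le> ennreal k * y"
    using assms(2) by (intro mult_left_mono) auto
  finally show ?thesis .
qed

lemma root_16_less:
  fixes x c :: real
  assumes "0 < x" "0 < c" "x < c ^ 16"
  shows "x powr (1/16) < c"
proof -
  have "x powr (1/16) < (c ^ 16) powr (1/16)"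
    using assms by (intro powr_less_mono2) auto
  also have "\<dots> = c"
    using assms(2) powr_powr[of c 16 "1/16"] by simp
  finally show ?thesis .
qed

lemma connected_nonzero_sign:
  fixes f :: "'a::topological_space \<Rightarrow> real"
  assumes "connected I" "continuous_on I f" "\<And>x. x \<in> I \<Longrightarrow> f x \<noteq> 0"
  shows "(\<forall>x\<in>I. 0 < f x) \<or> (\<forall>x\<in>I. f x < 0)"
proof (rule ccontr)
  assume "\<not> ?thesis"
  then obtain x y where "x \<in> I" "y \<in> I" "f x \<le> 0" "0 \<le> f y"
    by (meson not_less)
  moreover have "connected (f ` I)"
    by (rule connected_continuous_image[OF assms(2,1)])
  ultimately have "0 \<in> f ` I"
    by (meson connectedD_interval imageI)
  then show False
    using assms(3) by auto
qed

section \<open>The parabolic metric\<close>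

lemma pdist_nonneg [simp]: "0 \<le> pdist z w"
  by (simp add: pdist_def)

lemma pdist_self [simp]: "pdist z z = 0"
  by (simp add: pdist_def)

lemma pdist_commute: "pdist z w = pdist w z"
  by (simp add: pdist_def norm_minus_commute abs_minus_commute)

lemma pdist_triangle: "pdist x z \<le> pdist x y + pdist y z"
  using norm_triangle_ineq[of "snd x - snd y" "snd y - snd z"]
    sqrt_abs_triangle[of "fst x" "fst z" "fst y"]
  by (simp add: pdist_def)

lemma pdist_segment_le:
  assumes "0 \<le> t" "t \<le> 1"
  shows "pdist z (z + t *\<^sub>R (w - z)) \<le> pdist z w"
proof -
  have "norm (snd z - snd (z + t *\<^sub>R (w - z))) = t * norm (snd z - snd w)"
    using assms norm_minus_commute[of "snd z" "snd w"] by simp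
  then have "norm (snd z - snd (z + t *\<^sub>R (w - z))) \<le> norm (snd z - snd w)"
    using assms by (simp only: mult_left_le_one_le norm_ge_zero)
  moreover have "\<bar>fst z - fst (z + t *\<^sub>R (w - z))\<bar> = t * \<bar>fst z - fst w\<bar>"
    using assms by (simp add: abs_mult abs_minus_commute)
  then have "\<bar>fst z - fst (z + t *\<^sub>R (w - z))\<bar> \<le> \<bar>fst z - fst w\<bar>"
    using assms by (simp only: mult_left_le_one_le abs_ge_zero)
  ultimately show ?thesis
    unfolding pdist_def by (intro add_mono real_sqrt_le_mono)
qed

lemma continuous_on_pdist:
  "continuous_on UNIV (\<lambda>w. pdist z (w :: real \<times> 'a::real_normed_vector))"
  unfolding pdist_def by (intro continuous_intros)

lemma zero_on_segmentE:
  fixes F :: "real \<times> 'a::real_normed_vector \<Rightarrow> real"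
  assumes "continuous_on UNIV F" "0 \<le> F z" "F e \<le> 0"
  obtains p where "F p = 0" "pdist z p \<le> pdist z e"
proof -
  have "\<exists>t. 0 \<le> t \<and> t \<le> 1 \<and> F (z + t *\<^sub>R (e - z)) = 0"
    by (rule IVT2')
      (use assms(2,3) in \<open>auto intro!: continuous_on_compose2[OF assms(1)] continuous_intros\<close>)
  then show ?thesis
    using that pdist_segment_le[of _ z e] by blast
qed

lemma lip_half_oneD: "lip_half_one b f \<Longrightarrow> \<bar>f z - f w\<bar> \<le> b * pdist z w"
  unfolding lip_half_one_def by blast

lemma lip_half_one_continuous:
  assumes "lip_half_one b f"
  shows "continuous_on UNIV f"
proof -
  have "(f \<longlongrightarrow> f z) (at z)" for z
  proof (rule LIM_zero_cancel, rule Lim_null_comparison)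
    show "\<forall>\<^sub>F w in at z. norm (f w - f z) \<le> b * pdist z w"
      using lip_half_oneD[OF assms, of z] by (simp add: abs_minus_commute)
    have "((\<lambda>w. b * pdist z w) \<longlongrightarrow> b * pdist z z) (at z)"
      using continuous_on_pdist[of z] by (intro tendsto_intros) (metis UNIV_I continuous_on_def)
    then show "((\<lambda>w. b * pdist z w) \<longlongrightarrow> 0) (at z)"
      by simp
  qed
  then show ?thesis
    by (simp add: continuous_on_def)
qed

lemma lip_half_one_add_scaled:
  assumes "lip_half_one b f" "lip_half_one b' g"
  shows "lip_half_one (b + \<bar>c\<bar> * b') (\<lambda>z. f z + c * g z)"
  unfolding lip_half_one_def
proof (intro allI)
  fix z w
  have "\<bar>c * g z - c * g w\<bar> = \<bar>c\<bar> * \<bar>g z - g w\<bar>"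
    by (simp add: abs_mult flip: right_diff_distrib)
  also have "\<dots> \<le> \<bar>c\<bar> * (b' * pdist z w)"
    by (intro mult_left_mono lip_half_oneD assms(2)) simp
  finally have "\<bar>f z + c * g z - (f w + c * g w)\<bar> \<le> b * pdist z w + \<bar>c\<bar> * (b' * pdist z w)"
    using lip_half_oneD[OF assms(1), of z w] by linarith
  then show "\<bar>f z + c * g z - (f w + c * g w)\<bar> \<le> (b + \<bar>c\<bar> * b') * pdist z w"
    by (simp add: algebra_simps)
qed

lemma pball_subset_pball:
  assumes "pdist z w + r \<le> r'"
  shows "pball w r \<subseteq> pball z r'"
proof
  fix v assume "v \<in> pball w r"
  then show "v \<in> pball z r'"
    using assms pdist_triangle[of z v w] by (simp add: pball_def)
qed

lemma pball_empty:
  assumes "r \<le> 0"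
  shows "pball z r = {}"
proof -
  have "\<not> pdist z w < r" for w
    using assms pdist_nonneg[of z w] by linarith
  then show ?thesis
    by (simp add: pball_def)
qed

lemma open_pball: "open (pball z r)"
  unfolding pball_def by (intro open_Collect_less continuous_on_pdist continuous_on_const)

lemma pball_borel [measurable]: "pball z r \<in> sets borel"
  by (simp add: open_pball)

lemma pball_subset_box: "pball z r \<subseteq> {fst z - r\<^sup>2..fst z + r\<^sup>2} \<times> ball (snd z) r"
proof safe
  fix t x assume "(t, x) \<in> pball z r"
  then have norm_sqrt: "norm (snd z - x) + sqrt \<bar>fst z - t\<bar> < r"
    by (simp add: pball_def pdist_def)
  then have "sqrt \<bar>fst z - t\<bar> \<le> r"
    by (smt (verit) norm_ge_zero)
  then have "\<bar>fst z - t\<bar> \<le> r\<^sup>2"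
    by (simp add: sqrt_le_D)
  then show "t \<in> {fst z - r\<^sup>2..fst z + r\<^sup>2}"
    by auto
  show "x \<in> ball (snd z) r"
    using norm_sqrt by (auto simp: dist_norm) (smt (verit) real_sqrt_ge_zero)
qed

lemma box_subset_pball:
  assumes "0 < r"
  shows "{fst z - r\<^sup>2 / 4<..<fst z + r\<^sup>2 / 4} \<times> ball (snd z) (r / 2) \<subseteq> pball z r"
proof safe
  fix t x assume t: "t \<in> {fst z - r\<^sup>2 / 4<..<fst z + r\<^sup>2 / 4}" and x: "x \<in> ball (snd z) (r / 2)"
  have "\<bar>fst z - t\<bar> < (r / 2)\<^sup>2"
    using t unfolding power_divide by (auto simp: abs_if)
  then have "sqrt \<bar>fst z - t\<bar> < r / 2"
    using assms real_sqrt_less_mono by fastforce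
  then show "(t, x) \<in> pball z r"
    using x by (simp add: pball_def pdist_def dist_norm)
qed

lemma emeasure_pball_finite:
  "emeasure lborel (pball z r :: (real \<times> 'a::euclidean_space) set) < \<infinity>"
  by (intro emeasure_bounded_finite bounded_subset[OF _ pball_subset_box] bounded_Times) auto

lemma measure_pball_ge:
  fixes z :: "real \<times> 'a::euclidean_space"
  assumes "0 < r"
  shows "r\<^sup>2 * measure lborel (ball (snd z) r) \<le> 2 * 2 ^ DIM('a) * measure lborel (pball z r)"
proof -
  let ?I = "{fst z - r\<^sup>2 / 4<..<fst z + r\<^sup>2 / 4}" and ?B = "ball (snd z) (r / 2)"
  have "emeasure lborel (?I \<times> ?B) = emeasure lborel ?I * emeasure lborel ?B"
    by (subst lborel_prod[symmetric], rule lborel.emeasure_pair_measure_Times) auto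
  then have "r\<^sup>2 / 2 * measure lborel ?B = measure lborel (?I \<times> ?B)"
    by (simp add: measure_def enn2real_mult)
  also have "\<dots> \<le> measure lborel (pball z r)"
    using emeasure_pball_finite[of z r]
    by (intro measure_mono_fmeasurable box_subset_pball[OF assms])
      (auto simp: fmeasurable_def intro!: borel_Times)
  finally have "r\<^sup>2 / 2 * measure lborel ?B \<le> measure lborel (pball z r)" .
  moreover have "measure lborel ?B = measure lborel (ball (snd z) r) / 2 ^ DIM('a)"
    using content_ball_conv_unit_ball[of r "snd z"]
      content_ball_conv_unit_ball[of "r / 2" "snd z"] assms
    by (simp add: power_divide)
  ultimately show ?thesis
    by (simp add: field_simps)
qed

lemma measure_pball_pos:
  fixes z :: "real \<times> 'a::euclidean_space"
  assumes "0 < r"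
  shows "0 < measure lborel (pball z r)"
proof -
  have "0 < r\<^sup>2 * measure lborel (ball (snd z) r)"
    using assms by (intro mult_pos_pos) auto
  also have "\<dots> \<le> 2 * 2 ^ DIM('a) * measure lborel (pball z r)"
    by (rule measure_pball_ge[OF assms])
  finally show ?thesis
    by (simp add: zero_less_mult_iff)
qed

lemma pdist_set_le: "z \<in> A \<Longrightarrow> w \<in> B \<Longrightarrow> pdist_set A B \<le> ennreal (pdist z w)"
  unfolding pdist_set_def by (rule INF_lower2[of z]) (auto intro: INF_lower)

lemma pdist_set_lessE:
  assumes "pdist_set A B < ennreal c"
  obtains z w where "z \<in> A" "w \<in> B" "pdist z w < c"
  using assms unfolding pdist_set_def by (auto simp: INF_less_iff ennreal_less_iff)

lemma pdist_set_finite: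
  assumes "A \<noteq> {}" "B \<noteq> {}"
  shows "pdist_set A B < \<infinity>"
proof -
  obtain z w where "z \<in> A" "w \<in> B"
    using assms by blast
  then have "pdist_set A B \<le> ennreal (pdist z w)"
    by (rule pdist_set_le)
  then show ?thesis
    by (simp add: le_less_trans)
qed

lemma pdist_set_antimono_right: "B \<subseteq> B' \<Longrightarrow> pdist_set A B' \<le> pdist_set A B"
  unfolding pdist_set_def by (intro INF_mono INF_superset_mono) auto

lemma pdist_pt_le: "w \<in> B \<Longrightarrow> pdist z w \<le> c \<Longrightarrow> pdist_pt z B \<le> ennreal c"
  unfolding pdist_pt_def by (meson ennreal_leI order_trans pdist_set_le singletonI)

lemma pdist_pt_greatest: "(\<And>w. w \<in> B \<Longrightarrow> x \<le> ennreal (pdist z w)) \<Longrightarrow> x \<le> pdist_pt z B"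
  unfolding pdist_pt_def pdist_set_def by (auto intro!: INF_greatest)

lemma pdist_pt_geI: "(\<And>w. w \<in> B \<Longrightarrow> c \<le> pdist z w) \<Longrightarrow> ennreal c \<le> pdist_pt z B"
  by (intro pdist_pt_greatest ennreal_leI)

lemma pdist_pt_lessE:
  assumes "pdist_pt z B < ennreal c"
  obtains w where "w \<in> B" "pdist z w < c"
  using pdist_set_lessE[OF assms[unfolded pdist_pt_def]] by blast

lemma pdist_le_pdiam: "z \<in> A \<Longrightarrow> w \<in> A \<Longrightarrow> ennreal (pdist z w) \<le> pdiam A"
  unfolding pdiam_def by (intro SUP_upper2[of z] SUP_upper2[of w]) auto

lemma pdist_le_rdiam:
  assumes "pdiam A < \<infinity>" "z \<in> A" "w \<in> A"
  shows "pdist z w \<le> rdiam A"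
  using enn2real_mono[OF pdist_le_pdiam[OF assms(2,3)]] assms(1) by (simp add: rdiam_def)

lemma subset_pball_rdiam:
  assumes "pdiam A < \<infinity>" "0 < rdiam A" "z \<in> A"
  shows "A \<subseteq> pball z (2 * rdiam A)"
proof
  fix w assume "w \<in> A"
  then have "pdist z w \<le> rdiam A"
    by (rule pdist_le_rdiam[OF assms(1,3)])
  then show "w \<in> pball z (2 * rdiam A)"
    using assms(2) by (simp add: pball_def)
qed

lemma pdiam_mono: "A \<subseteq> B \<Longrightarrow> pdiam A \<le> pdiam B"
  unfolding pdiam_def by (intro SUP_subset_mono) auto

lemma rdiam_mono: "A \<subseteq> B \<Longrightarrow> pdiam B < \<infinity> \<Longrightarrow> rdiam A \<le> rdiam B"
  unfolding rdiam_def by (intro enn2real_mono pdiam_mono) auto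

section \<open>Limits along countably generated filters\<close>

definition filter_base :: "'p filter \<Rightarrow> (nat \<Rightarrow> 'p set) \<Rightarrow> bool" where
  "filter_base F U \<longleftrightarrow> decseq U \<and> (\<forall>P. eventually P F \<longleftrightarrow> (\<exists>n. \<forall>p\<in>U n. P p))"

lemma filter_base_eventually: "filter_base F U \<Longrightarrow> eventually P F \<longleftrightarrow> (\<exists>n. \<forall>p\<in>U n. P p)"
  by (simp add: filter_base_def)

lemma filter_base_neq_bot: "filter_base F U \<Longrightarrow> (\<And>n. U n \<noteq> {}) \<Longrightarrow> F \<noteq> bot"
  unfolding trivial_limit_def by (auto simp: filter_base_eventually)

lemma filter_base_filterlim:
  assumes F: "filter_base F U" and p: "\<And>n. p n \<in> U n"
  shows "filterlim p F sequentially"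
  unfolding filterlim_iff
proof (intro allI impI)
  fix P assume "eventually P F"
  then obtain N where N: "\<forall>p\<in>U N. P p"
    using filter_base_eventually[OF F] by blast
  have "p n \<in> U N" if "N \<le> n" for n
    using F p[of n] that by (auto simp: filter_base_def decseq_def)
  then show "\<forall>\<^sub>F n in sequentially. P (p n)"
    using N by (auto simp: eventually_sequentially)
qed

lemma filter_base_tendstoI:
  assumes F: "filter_base F U" and seq: "\<And>p. (\<And>n. p n \<in> U n) \<Longrightarrow> (\<lambda>n. f (p n)) \<longlonglongrightarrow> l"
  shows "(f \<longlongrightarrow> l) F"
proof (rule topological_tendstoI, rule ccontr)
  fix V assume V: "open V" "l \<in> V" and "\<not> (\<forall>\<^sub>F x in F. f x \<in> V)"
  then have "\<forall>n. \<exists>p\<in>U n. f p \<notin> V"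
    by (auto simp: filter_base_eventually[OF F])
  then obtain p where p: "\<And>n. p n \<in> U n" "\<And>n. f (p n) \<notin> V"
    by metis
  from topological_tendstoD[OF seq[OF p(1)] V] show False
    by (simp add: p(2))
qed

lemma filter_base_convergent_iff_Cauchy:
  fixes f :: "'p \<Rightarrow> 'b::complete_space"
  assumes F: "filter_base F U" and U: "\<And>n. U n \<noteq> {}"
  shows "(\<exists>l. (f \<longlongrightarrow> l) F) \<longleftrightarrow>
    (\<forall>k::nat. \<exists>n. \<forall>p\<in>U n. \<forall>q\<in>U n. dist (f p) (f q) \<le> 1 / real (Suc k))"
    (is "?conv \<longleftrightarrow> ?Cauchy")
proof -
  have "?conv \<longleftrightarrow> cauchy_filter (filtermap f F)"
  proof
    show "cauchy_filter (filtermap f F)" if ?conv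
      using that nhds_imp_cauchy_filter unfolding filterlim_def by blast
    have "filtermap f F \<noteq> bot"
      using filter_base_neq_bot[OF F U] by (simp add: filtermap_bot_iff)
    then show ?conv if "cauchy_filter (filtermap f F)"
      using cauchy_filter_complete_converges[OF that complete_UNIV] by (simp add: filterlim_def)
  qed
  also have "\<dots> \<longleftrightarrow> ?Cauchy"
    unfolding cauchy_filter_metric_filtermap
  proof (intro iffI allI impI)
    fix k :: nat
    assume Cauchy: "\<forall>e>0. \<exists>P. eventually P F \<and> (\<forall>x y. P x \<and> P y \<longrightarrow> dist (f x) (f y) < e)"
    have "0 < 1 / real (Suc k)"
      by simp
    then obtain P where P: "eventually P F" "\<forall>x y. P x \<and> P y \<longrightarrow> dist (f x) (f y) < 1 / real (Suc k)"
      using Cauchy by blast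
    obtain n where "\<forall>p\<in>U n. P p"
      using P(1) filter_base_eventually[OF F] by blast
    then show "\<exists>n. \<forall>p\<in>U n. \<forall>q\<in>U n. dist (f p) (f q) \<le> 1 / real (Suc k)"
      using P(2) by (intro exI[of _ n] ballI less_imp_le) simp
  next
    fix e :: real assume C: ?Cauchy and "0 < e"
    obtain k where k: "1 / real (Suc k) < e"
      using \<open>0 < e\<close> by (rule nat_approx_posE)
    obtain n where "\<forall>p\<in>U n. \<forall>q\<in>U n. dist (f p) (f q) \<le> 1 / real (Suc k)"
      using C by blast
    moreover have "\<forall>\<^sub>F p in F. p \<in> U n"
      using filter_base_eventually[OF F] by blast
    ultimately show "\<exists>P. eventually P F \<and> (\<forall>x y. P x \<and> P y \<longrightarrow> dist (f x) (f y) < e)"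
      using k by (meson le_less_trans)
  qed
  finally show ?thesis .
qed

lemma continuous_le_on_dense:
  fixes g :: "'p::topological_space \<Rightarrow> real"
  assumes "continuous_on U g" "open U" and dense: "\<And>V. open V \<Longrightarrow> V \<noteq> {} \<Longrightarrow> \<exists>d\<in>D. d \<in> V"
    and le: "\<And>p. p \<in> U \<inter> D \<Longrightarrow> g p \<le> c" and "p \<in> U"
  shows "g p \<le> c"
proof (rule ccontr)
  assume "\<not> g p \<le> c"
  then have "p \<in> U \<inter> g -` {c<..}"
    using \<open>p \<in> U\<close> by simp
  moreover have "open (U \<inter> g -` {c<..})"
    using assms(1,2) by (intro continuous_open_preimage) auto
  ultimately obtain d where "d \<in> D" "d \<in> U \<inter> g -` {c<..}"
    using dense by blast
  then show False
    using le[of d] by auto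
qed

text \<open>By continuity the Cauchy criterion need only be tested on a countable dense set.\<close>

lemma pred_convergent_filter_base:
  fixes f :: "'a \<Rightarrow> 'p::second_countable_topology \<Rightarrow> 'b::{complete_space, second_countable_topology}"
  assumes F: "filter_base F U" and U: "\<And>n. open (U n)" "\<And>n. U n \<noteq> {}"
    and meas: "\<And>p. p \<in> U 0 \<Longrightarrow> (\<lambda>z. f z p) \<in> borel_measurable M"
    and cont: "\<And>z. continuous_on (U 0) (f z)"
  shows "Measurable.pred M (\<lambda>z. \<exists>l. (f z \<longlongrightarrow> l) F)"
proof -
  obtain D :: "'p set" where D: "countable D" "\<And>V. open V \<Longrightarrow> V \<noteq> {} \<Longrightarrow> \<exists>d\<in>D. d \<in> V"
    using countable_dense_setE by blast
  have U0: "U n \<subseteq> U 0" for n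
    using F by (auto simp: filter_base_def decseq_def)
  have cont_U: "continuous_on (U n) (f z)" for n z
    by (rule continuous_on_subset[OF cont U0])
  have dense_iff: "(\<forall>p\<in>U n. \<forall>q\<in>U n. dist (f z p) (f z q) \<le> c) \<longleftrightarrow>
      (\<forall>p\<in>U n \<inter> D. \<forall>q\<in>U n \<inter> D. dist (f z p) (f z q) \<le> c)" (is "?all \<longleftrightarrow> ?dense") for n z c
  proof
    assume dense: ?dense
    show ?all
    proof (intro ballI)
      fix p q assume p: "p \<in> U n" and q: "q \<in> U n"
      have cont_q: "continuous_on (U n) (\<lambda>q. dist (f z p) (f z q))" for p
        by (intro continuous_intros cont_U)
      have cont_p: "continuous_on (U n) (\<lambda>p. dist (f z p) (f z q))"
        by (intro continuous_intros cont_U)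
      have "dist (f z p') (f z q) \<le> c" if "p' \<in> U n \<inter> D" for p'
        by (rule continuous_le_on_dense[OF cont_q U(1) D(2) _ q]) (use dense that in auto)
      then show "dist (f z p) (f z q) \<le> c"
        using continuous_le_on_dense[OF cont_p U(1) D(2) _ p] by blast
    qed
  qed blast
  have "{z \<in> space M. dist (f z p) (f z q) \<le> 1 / real (Suc k)} \<in> sets M"
    if "p \<in> U n \<inter> D" "q \<in> U n \<inter> D" for p q n k
  proof -
    have [measurable]: "(\<lambda>z. f z p) \<in> borel_measurable M" "(\<lambda>z. f z q) \<in> borel_measurable M"
      using that U0 by (auto intro!: meas)
    show ?thesis by measurable
  qed
  then have "{z \<in> space M. \<forall>k. \<exists>n. \<forall>p\<in>U n \<inter> D. \<forall>q\<in>U n \<inter> D.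
      dist (f z p) (f z q) \<le> 1 / real (Suc k)} \<in> sets M"
    using D(1)
    by (intro sets.sets_Collect_countable_All sets.sets_Collect_countable_Ex
        sets.sets_Collect_countable_All') auto
  then show ?thesis
    unfolding filter_base_convergent_iff_Cauchy[OF F U(2)] dense_iff by (simp add: pred_def)
qed

lemma borel_measurable_Lim_filter_base:
  fixes f :: "'a \<Rightarrow> 'p::second_countable_topology \<Rightarrow> 'b::{banach, second_countable_topology}"
  assumes F: "filter_base F U" and U: "\<And>n. open (U n)" "\<And>n. U n \<noteq> {}"
    and meas: "\<And>p. p \<in> U 0 \<Longrightarrow> (\<lambda>z. f z p) \<in> borel_measurable M"
    and cont: "\<And>z. continuous_on (U 0) (f z)"
  shows "(\<lambda>z. Lim F (f z)) \<in> borel_measurable M"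
proof -
  note [measurable] = pred_convergent_filter_base[OF F U meas cont]
  have "\<forall>n. \<exists>p. p \<in> U n"
    using U(2) by blast
  then obtain p where p: "\<And>n. p n \<in> U n"
    by metis
  then have "p n \<in> U 0" for n
    using F by (auto simp: filter_base_def decseq_def)
  then have [measurable]: "(\<lambda>z. f z (p n)) \<in> borel_measurable M" for n
    by (rule meas)
  have "Lim F (f z) = (if \<exists>l. (f z \<longlongrightarrow> l) F then lim (\<lambda>n. f z (p n)) else (THE l. False))" for z
  proof (cases "\<exists>l. (f z \<longlongrightarrow> l) F")
    case True
    then obtain l where l: "(f z \<longlongrightarrow> l) F" ..
    then have "(\<lambda>n. f z (p n)) \<longlonglongrightarrow> l"
      by (rule filterlim_compose[OF _ filter_base_filterlim[OF F p]])
    with l True show ?thesis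
      using filter_base_neq_bot[OF F U(2)] by (simp add: tendsto_Lim limI)
  qed (simp add: t2_space_class.Lim_def)
  then show ?thesis
    by simp
qed

section \<open>The half-order time derivative\<close>

definition annulus :: "real \<Rightarrow> real \<Rightarrow> real set" where
  "annulus \<epsilon> R = {u. \<epsilon> < \<bar>u\<bar> \<and> \<bar>u\<bar> < R}"

definition half_kernel :: "(real \<times> 'a::real_normed_vector \<Rightarrow> real) \<Rightarrow> real \<times> 'a \<Rightarrow> real \<Rightarrow> real" where
  "half_kernel f z u = (f (fst z + u, snd z) - f z) / \<bar>u\<bar> powr (3/2)"

lemma annulus_borel [measurable]: "annulus \<epsilon> R \<in> sets borel"
  unfolding annulus_def by measurable

lemma annulus_mono: "\<epsilon>' \<le> \<epsilon> \<Longrightarrow> R \<le> R' \<Longrightarrow> annulus \<epsilon> R \<subseteq> annulus \<epsilon>' R'"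
  by (auto simp: annulus_def)

lemma half_trunc_eq:
  "half_trunc f z (\<epsilon>, R) = (LINT u:annulus \<epsilon> R|lborel. half_kernel f z u)"
  unfolding half_trunc_def split_conv set_lebesgue_integral_def
  by (subst lborel_integral_real_affine[where c = 1 and t = "fst z"])
    (auto intro!: Bochner_Integration.integral_cong simp: indicator_def annulus_def half_kernel_def)

lemma set_integrable_half_kernel_annulus:
  assumes "continuous_on UNIV f" and "0 < \<epsilon>"
  shows "set_integrable lborel (annulus \<epsilon> R) (half_kernel f z)"
proof -
  let ?S = "{-R..R} - {-\<epsilon><..<\<epsilon>}"
  have "compact ?S"
    by (intro compact_diff) auto
  moreover have "continuous_on ?S (half_kernel f z)"
    unfolding half_kernel_def using assms(2)
    by (intro continuous_intros continuous_on_compose2[OF assms(1)]) auto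
  ultimately have "set_integrable lborel ?S (half_kernel f z)"
    unfolding set_integrable_def by (rule borel_integrable_compact)
  then show ?thesis
    by (rule set_integrable_subset) (auto simp: annulus_def)
qed

lemma tendsto_indicator_annulus:
  assumes "(\<epsilon> \<longlongrightarrow> \<epsilon>') F" "(R \<longlongrightarrow> R') F" "\<bar>u\<bar> \<noteq> \<epsilon>'" "\<bar>u\<bar> \<noteq> R'"
  shows "((\<lambda>n. indicator (annulus (\<epsilon> n) (R n)) u :: real) \<longlongrightarrow> indicator (annulus \<epsilon>' R') u) F"
proof (rule tendsto_eventually)
  have "\<forall>\<^sub>F n in F. \<epsilon> n < \<bar>u\<bar> \<longleftrightarrow> \<epsilon>' < \<bar>u\<bar>"
  proof (cases "\<epsilon>' < \<bar>u\<bar>")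
    case True
    then show ?thesis
      using order_tendstoD(2)[OF assms(1)] by (auto elim: eventually_mono)
  next
    case False
    then have "\<forall>\<^sub>F n in F. \<bar>u\<bar> < \<epsilon> n"
      using order_tendstoD(1)[OF assms(1)] assms(3) by simp
    then show ?thesis
      by eventually_elim (use False in simp)
  qed
  moreover have "\<forall>\<^sub>F n in F. \<bar>u\<bar> < R n \<longleftrightarrow> \<bar>u\<bar> < R'"
  proof (cases "\<bar>u\<bar> < R'")
    case True
    then show ?thesis
      using order_tendstoD(1)[OF assms(2)] by (auto elim: eventually_mono)
  next
    case False
    then have "\<forall>\<^sub>F n in F. R n < \<bar>u\<bar>"
      using order_tendstoD(2)[OF assms(2)] assms(4) by simp
    then show ?thesis
      by eventually_elim (use False in simp)
  qed
  ultimately show "\<forall>\<^sub>F n in F. indicator (annulus (\<epsilon> n) (R n)) u =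
      (indicator (annulus \<epsilon>' R') u :: real)"
    by eventually_elim (simp add: annulus_def indicator_def)
qed

lemma continuous_on_set_integral_annulus_strip:
  fixes k :: "real \<Rightarrow> real"
  assumes int: "\<And>\<epsilon> R. 0 < \<epsilon> \<Longrightarrow> set_integrable lborel (annulus \<epsilon> R) k" and "0 < a"
  shows "continuous_on ({a<..} \<times> {..<b}) (\<lambda>p. LINT u:annulus (fst p) (snd p)|lborel. k u)"
proof (rule continuous_on_sequentiallyI)
  fix p q assume p: "\<forall>n. p n \<in> {a<..} \<times> {..<b}" and q: "q \<in> {a<..} \<times> {..<b}" and lim: "p \<longlonglongrightarrow> q"
  have sub: "annulus (fst (p n)) (snd (p n)) \<subseteq> annulus a b" for n
    using p by (intro annulus_mono) (auto simp: mem_Times_iff less_imp_le)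
  have meas: "(\<lambda>u. indicator (annulus (fst p) (snd p)) u *\<^sub>R k u) \<in> borel_measurable lborel"
    if "a < fst p" for p
    using int[of "fst p" "snd p"] \<open>0 < a\<close> that by (auto simp: set_integrable_def)
  show "(\<lambda>n. LINT u:annulus (fst (p n)) (snd (p n))|lborel. k u)
      \<longlonglongrightarrow> (LINT u:annulus (fst q) (snd q)|lborel. k u)"
    unfolding set_lebesgue_integral_def
  proof (rule integral_dominated_convergence)
    show "integrable lborel (\<lambda>u. norm (indicator (annulus a b) u *\<^sub>R k u))"
      using int[OF \<open>0 < a\<close>] unfolding set_integrable_def by (rule integrable_norm)
    have "finite {fst q, - fst q, snd q, - snd q}"
      by simp
    then have "AE u in lborel. u \<notin> {fst q, - fst q, snd q, - snd q}"
      by (intro AE_not_in finite_imp_null_set_lborel)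
    then show "AE u in lborel. (\<lambda>n. indicator (annulus (fst (p n)) (snd (p n))) u *\<^sub>R k u)
        \<longlonglongrightarrow> indicator (annulus (fst q) (snd q)) u *\<^sub>R k u"
      by eventually_elim
        (intro tendsto_intros tendsto_indicator_annulus tendsto_fst[OF lim]
          tendsto_snd[OF lim], auto)
    show "AE u in lborel. norm (indicator (annulus (fst (p n)) (snd (p n))) u *\<^sub>R k u)
        \<le> norm (indicator (annulus a b) u *\<^sub>R k u)" for n
      using sub[of n] by (intro AE_I2) (auto simp: indicator_def)
    show "(\<lambda>u. indicator (annulus (fst q) (snd q)) u *\<^sub>R k u) \<in> borel_measurable lborel"
      using q by (intro meas) auto
    show "(\<lambda>u. indicator (annulus (fst (p n)) (snd (p n))) u *\<^sub>R k u) \<in> borel_measurable lborel"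
        for n
      using p by (intro meas) (auto simp: mem_Times_iff)
  qed
qed

lemma continuous_on_set_integral_annulus:
  fixes k :: "real \<Rightarrow> real"
  assumes "\<And>\<epsilon> R. 0 < \<epsilon> \<Longrightarrow> set_integrable lborel (annulus \<epsilon> R) k"
  shows "continuous_on ({0<..} \<times> UNIV) (\<lambda>p. LINT u:annulus (fst p) (snd p)|lborel. k u)"
proof -
  let ?I = "\<lambda>p. LINT u:annulus (fst p) (snd p)|lborel. k u"
  have "continuous_on ({a<..} \<times> {..<b}) ?I" if "0 < a" for a b
    by (rule continuous_on_set_integral_annulus_strip[OF assms that])
  then have "continuous_on (\<Union>(a, b)\<in>{0<..} \<times> UNIV. {a<..} \<times> {..<b}) ?I"
    by (intro continuous_on_open_UN) (auto intro: open_Times)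
  moreover have "(\<Union>(a, b)\<in>{0<..} \<times> UNIV. {a<..} \<times> {..<b}) = ({0<..} \<times> UNIV :: (real \<times> real) set)"
  proof (intro equalityI subsetI)
    fix p :: "real \<times> real" assume "p \<in> {0<..} \<times> UNIV"
    then show "p \<in> (\<Union>(a, b)\<in>{0<..} \<times> UNIV. {a<..} \<times> {..<b})"
      by (intro UN_I[of "(fst p / 2, snd p + 1)"]) (auto simp: mem_Times_iff)
  qed auto
  ultimately show ?thesis
    by simp
qed

lemma continuous_on_half_trunc:
  assumes "continuous_on UNIV f"
  shows "continuous_on ({0<..} \<times> UNIV) (half_trunc f z)"
proof -
  have "half_trunc f z = (\<lambda>p. LINT u:annulus (fst p) (snd p)|lborel. half_kernel f z u)"
    by (simp add: fun_eq_iff half_trunc_eq)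
  then show ?thesis
    using continuous_on_set_integral_annulus[OF set_integrable_half_kernel_annulus[OF assms]]
    by simp
qed

lemma borel_measurable_half_kernel:
  fixes f :: "real \<times> 'a::euclidean_space \<Rightarrow> real"
  assumes "continuous_on UNIV f"
  shows "(\<lambda>p. half_kernel f (fst p) (snd p)) \<in> borel_measurable borel"
proof -
  have [measurable]: "(\<lambda>p::(real \<times> 'a) \<times> real. f (fst (fst p) + snd p, snd (fst p))) \<in>
      borel_measurable borel"
    by (intro borel_measurable_continuous_onI continuous_on_compose2[OF assms]
        continuous_intros) auto
  have [measurable]: "(\<lambda>p::(real \<times> 'a) \<times> real. f (fst p)) \<in> borel_measurable borel"
    by (intro borel_measurable_continuous_onI continuous_on_compose2[OF assms]
        continuous_intros) auto
  have [measurable]: "(\<lambda>p::(real \<times> 'a) \<times> real. snd p) \<in> borel_measurable borel"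
    by (intro borel_measurable_continuous_onI continuous_intros)
  show ?thesis
    unfolding half_kernel_def by measurable
qed

lemma borel_measurable_half_trunc:
  fixes f :: "real \<times> 'a::euclidean_space \<Rightarrow> real"
  assumes "continuous_on UNIV f"
  shows "(\<lambda>z. half_trunc f z p) \<in> borel_measurable borel"
proof -
  have [measurable]: "(\<lambda>p. half_kernel f (fst p) (snd p)) \<in> borel_measurable (lborel \<Otimes>\<^sub>M lborel)"
    using borel_measurable_half_kernel[OF assms] by (simp add: lborel_prod)
  have "(\<lambda>z. half_trunc f z (\<epsilon>, R)) \<in> borel_measurable lborel" for \<epsilon> R
    unfolding half_trunc_eq set_lebesgue_integral_def
    by (rule lborel.borel_measurable_lebesgue_integral) (simp add: case_prod_beta')
  then show ?thesis
    by (cases p) simp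
qed

definition pv_box :: "nat \<Rightarrow> (real \<times> real) set" where
  "pv_box N = {0<..<1 / real (Suc N)} \<times> {real (Suc N)<..}"

lemma filter_base_pv_filter: "filter_base pv_filter pv_box"
  unfolding filter_base_def
proof (intro conjI allI iffI)
  show "decseq pv_box"
    unfolding decseq_def
  proof (intro allI impI)
    fix m n :: nat assume "m \<le> n"
    then have "1 / real (Suc n) \<le> 1 / real (Suc m)"
      by (simp add: frac_le)
    with \<open>m \<le> n\<close> show "pv_box n \<subseteq> pv_box m"
      by (auto simp: pv_box_def)
  qed
next
  fix P assume "eventually P pv_filter"
  then obtain Pf Pg where P: "eventually Pf (at_right 0)" "eventually Pg at_top"
    "\<And>x y. Pf x \<Longrightarrow> Pg y \<Longrightarrow> P (x, y)"
    unfolding pv_filter_def eventually_prod_filter by auto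
  obtain b :: real where b: "b > 0" "\<And>y. 0 < y \<Longrightarrow> y < b \<Longrightarrow> Pf y"
    using P(1) unfolding eventually_at_right_field by auto
  obtain c :: real where c: "\<And>y. c \<le> y \<Longrightarrow> Pg y"
    using P(2) unfolding eventually_at_top_linorder by auto
  obtain N :: nat where N: "max c (1 / b) < real N"
    using reals_Archimedean2 by blast
  have "1 / real (Suc N) < b"
    using N b(1) by (auto simp: field_simps)
  then have "\<forall>p\<in>pv_box N. P p"
    using N by (auto simp: pv_box_def intro!: P(3) b(2) c)
  then show "\<exists>N. \<forall>p\<in>pv_box N. P p" ..
next
  fix P assume "\<exists>N. \<forall>p\<in>pv_box N. P p"
  then obtain N where N: "\<forall>p\<in>pv_box N. P p" ..
  have "\<forall>\<^sub>F \<epsilon> in at_right (0::real). \<epsilon> \<in> {0<..<1 / real (Suc N)}"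
    unfolding eventually_at_right_field by (intro exI[of _ "1 / real (Suc N)"]) auto
  moreover have "\<forall>\<^sub>F R in at_top. R \<in> {real (Suc N)<..}"
    using eventually_gt_at_top[of "real (Suc N)"] by simp
  moreover have "P (\<epsilon>, R)" if "\<epsilon> \<in> {0<..<1 / real (Suc N)}" "R \<in> {real (Suc N)<..}" for \<epsilon> R
    using N that by (auto simp: pv_box_def)
  ultimately show "eventually P pv_filter"
    unfolding pv_filter_def eventually_prod_filter by blast
qed

lemma pv_box_nonempty: "pv_box N \<noteq> {}"
  by (simp add: pv_box_def dense gt_ex)

lemma pv_box_subset: "pv_box N \<subseteq> {0<..} \<times> UNIV"
  by (auto simp: pv_box_def)

lemma pv_filter_neq_bot: "pv_filter \<noteq> bot"
  by (rule filter_base_neq_bot[OF filter_base_pv_filter pv_box_nonempty])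

lemma borel_measurable_half_deriv:
  fixes f :: "real \<times> 'a::euclidean_space \<Rightarrow> real"
  assumes "continuous_on UNIV f"
  shows "half_deriv f \<in> borel_measurable borel"
proof -
  have "(\<lambda>z. Lim pv_filter (half_trunc f z)) \<in> borel_measurable borel"
  proof (rule borel_measurable_Lim_filter_base[OF filter_base_pv_filter])
    show "open (pv_box N)" for N
      unfolding pv_box_def by (intro open_Times) auto
    show "continuous_on (pv_box 0) (half_trunc f z)" for z
      by (rule continuous_on_subset[OF continuous_on_half_trunc[OF assms] pv_box_subset])
  qed (rule pv_box_nonempty borel_measurable_half_trunc[OF assms])+
  then have "(\<lambda>z. - 1 / (2 * sqrt (2 * pi)) * Lim pv_filter (half_trunc f z)) \<in>
      borel_measurable borel"
    by measurable
  then show ?thesis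
    by (simp add: half_deriv_def[abs_def])
qed

lemma half_trunc_tendsto_integral:
  assumes int: "integrable lborel (half_kernel f z)"
  shows "(half_trunc f z \<longlongrightarrow> (\<integral>u. half_kernel f z u \<partial>lborel)) pv_filter"
proof (rule filter_base_tendstoI[OF filter_base_pv_filter])
  fix p :: "nat \<Rightarrow> real \<times> real" assume "\<And>n. p n \<in> pv_box n"
  then have p: "0 < fst (p n)" "fst (p n) < 1 / real (Suc n)" "real (Suc n) < snd (p n)" for n
    by (force simp: pv_box_def mem_Times_iff)+
  note [measurable] = borel_measurable_integrable[OF int]
  have "(\<lambda>n. LINT u:annulus (fst (p n)) (snd (p n))|lborel. half_kernel f z u)
      \<longlonglongrightarrow> (\<integral>u. half_kernel f z u \<partial>lborel)"
    unfolding set_lebesgue_integral_def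
  proof (rule integral_dominated_convergence[OF _ _ integrable_norm[OF int]])
    have "AE u in lborel. u \<noteq> (0::real)"
      by (rule AE_lborel_singleton)
    then show "AE u in lborel.
        (\<lambda>n. indicator (annulus (fst (p n)) (snd (p n))) u *\<^sub>R half_kernel f z u)
        \<longlonglongrightarrow> half_kernel f z u"
    proof eventually_elim
      case (elim u)
      have "\<forall>\<^sub>F n in sequentially. 1 / real (Suc n) < \<bar>u\<bar>"
        using order_tendstoD(2)[OF LIMSEQ_inverse_real_of_nat, of "\<bar>u\<bar>"] elim
        by (simp add: inverse_eq_divide)
      moreover have "\<forall>\<^sub>F n in sequentially. \<bar>u\<bar> < real n"
        by real_asymp
      ultimately have "\<forall>\<^sub>F n in sequentially. u \<in> annulus (fst (p n)) (snd (p n))"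
      proof eventually_elim
        case (elim n)
        then show ?case
          using p(2,3)[of n] by (simp add: annulus_def)
      qed
      then show ?case
        by (intro tendsto_eventually) (elim eventually_mono, simp)
    qed
  qed (auto simp: indicator_def)
  then show "(\<lambda>n. half_trunc f z (p n)) \<longlonglongrightarrow> (\<integral>u. half_kernel f z u \<partial>lborel)"
    by (simp flip: half_trunc_eq)
qed

definition half_deriv_factor :: real where
  "half_deriv_factor = - 1 / (2 * sqrt (2 * pi))"

lemma abs_half_deriv_factor_le: "\<bar>half_deriv_factor\<bar> \<le> 1"
proof -
  have "1 \<le> sqrt (2 * pi)"
    using pi_gt3 by simp
  then have "1 \<le> 2 * sqrt (2 * pi)"
    by linarith
  then show ?thesis
    by (simp add: half_deriv_factor_def)
qed

lemma half_deriv_eqI: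
  "(half_trunc f z \<longlongrightarrow> l) pv_filter \<Longrightarrow> half_deriv f z = half_deriv_factor * l"
  by (simp add: half_deriv_def half_deriv_factor_def tendsto_Lim pv_filter_neq_bot)

lemma half_trunc_add_scaled:
  assumes "continuous_on UNIV f" "continuous_on UNIV g" "0 < \<epsilon>"
  shows "half_trunc (\<lambda>z. f z + c * g z) z (\<epsilon>, R) =
      half_trunc f z (\<epsilon>, R) + c * half_trunc g z (\<epsilon>, R)"
proof -
  have "half_kernel (\<lambda>z. f z + c * g z) z = (\<lambda>u. half_kernel f z u + c * half_kernel g z u)"
    by (auto simp: half_kernel_def add_divide_distrib diff_divide_distrib algebra_simps)
  then show ?thesis
    using set_integrable_half_kernel_annulus[OF assms(1,3)]
        set_integrable_half_kernel_annulus[OF assms(2,3)]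
    by (simp add: half_trunc_eq set_integral_add)
qed

lemma half_deriv_add_scaled:
  assumes cont: "continuous_on UNIV f" "continuous_on UNIV g"
    and "half_deriv_exists f z" "half_deriv_exists g z"
  shows "half_deriv_exists (\<lambda>z. f z + c * g z) z"
    and "half_deriv (\<lambda>z. f z + c * g z) z = half_deriv f z + c * half_deriv g z"
proof -
  obtain l m where l: "(half_trunc f z \<longlongrightarrow> l) pv_filter" and m: "(half_trunc g z \<longlongrightarrow> m) pv_filter"
    using assms by (auto simp: half_deriv_exists_def)
  have "((\<lambda>p. half_trunc f z p + c * half_trunc g z p) \<longlongrightarrow> l + c * m) pv_filter"
    by (intro tendsto_intros l m)
  moreover have "\<forall>\<^sub>F p in pv_filter. half_trunc f z p + c * half_trunc g z p =
      half_trunc (\<lambda>z. f z + c * g z) z p"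
    unfolding filter_base_eventually[OF filter_base_pv_filter]
    by (auto simp: pv_box_def half_trunc_add_scaled[OF cont])
  ultimately have lim: "(half_trunc (\<lambda>z. f z + c * g z) z \<longlongrightarrow> l + c * m) pv_filter"
    by (rule Lim_transform_eventually)
  then show "half_deriv_exists (\<lambda>z. f z + c * g z) z"
    by (auto simp: half_deriv_exists_def)
  show "half_deriv (\<lambda>z. f z + c * g z) z = half_deriv f z + c * half_deriv g z"
    unfolding half_deriv_eqI[OF lim] half_deriv_eqI[OF l] half_deriv_eqI[OF m]
    by (simp add: algebra_simps)
qed

section \<open>Mean oscillation\<close>

definition mean_oscillation ::
    "(real \<times> 'a::euclidean_space) set \<Rightarrow> (real \<times> 'a \<Rightarrow> real) \<Rightarrow> real" where
  "mean_oscillation A f = pavg A (\<lambda>w. \<bar>f w - pavg A f\<bar>)"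

lemma pavg_const: "measure lborel A \<noteq> 0 \<Longrightarrow> pavg A (\<lambda>_. k) = k"
  by (simp add: pavg_def set_lebesgue_integral_def measure_def)

lemma pavg_add:
  "set_integrable lborel A f \<Longrightarrow> set_integrable lborel A g \<Longrightarrow>
    pavg A (\<lambda>w. f w + g w) = pavg A f + pavg A g"
  by (simp add: pavg_def set_integral_add add_divide_distrib)

lemma pavg_diff:
  "set_integrable lborel A f \<Longrightarrow> set_integrable lborel A g \<Longrightarrow>
    pavg A (\<lambda>w. f w - g w) = pavg A f - pavg A g"
  by (simp add: pavg_def set_integral_diff diff_divide_distrib)

lemma pavg_cmult: "pavg A (\<lambda>w. c * f w) = c * pavg A f"
  by (simp add: pavg_def)

lemma pavg_mono:
  assumes "set_integrable lborel A f" "set_integrable lborel A g" "\<And>w. f w \<le> g w"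
  shows "pavg A f \<le> pavg A g"
  unfolding pavg_def by (intro divide_right_mono set_integral_mono assms) auto

lemma abs_pavg_le: "set_integrable lborel A f \<Longrightarrow> \<bar>pavg A f\<bar> \<le> pavg A (\<lambda>w. \<bar>f w\<bar>)"
  using set_integral_norm_bound[of lborel A f]
  by (simp add: pavg_def abs_divide divide_right_mono)

lemma pavg_cong_AE:
  assumes "A \<in> sets borel" "f \<in> borel_measurable borel" "g \<in> borel_measurable borel"
    and "AE w in lborel. f w = g w"
  shows "pavg A f = pavg A g"
  unfolding pavg_def using assms
  by (subst set_lebesgue_integral_cong_AE[of A lborel f g]) auto

lemma mean_oscillation_cong_AE:
  assumes [measurable]: "A \<in> sets borel" "f \<in> borel_measurable borel" "g \<in> borel_measurable borel"
    and eq: "AE w in lborel. f w = g w"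
  shows "mean_oscillation A f = mean_oscillation A g"
proof -
  have "pavg A f = pavg A g"
    by (rule pavg_cong_AE[OF assms])
  then show ?thesis
    unfolding mean_oscillation_def using eq by (intro pavg_cong_AE) auto
qed

context
  fixes A :: "(real \<times> 'a::euclidean_space) set"
  assumes A_borel [measurable]: "A \<in> sets borel" and A_finite: "emeasure lborel A < \<infinity>"
begin

lemma set_integrable_const: "set_integrable lborel A (\<lambda>_. k :: real)"
  using A_finite by (simp add: set_integrable_def)

lemma set_integrable_deviation:
  "set_integrable lborel A f \<Longrightarrow> set_integrable lborel A (\<lambda>w. \<bar>f w - c :: real\<bar>)"
  by (intro set_integrable_abs set_integral_diff(1) set_integrable_const)

lemma mean_oscillation_le_deviation:
  assumes f: "set_integrable lborel A f" and pos: "0 < measure lborel A"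
  shows "mean_oscillation A f \<le> 2 * pavg A (\<lambda>w. \<bar>f w - c\<bar>)"
proof -
  let ?dev = "pavg A (\<lambda>w. \<bar>f w - c\<bar>)"
  have const: "pavg A (\<lambda>_. k) = k" for k
    using pos by (intro pavg_const) simp
  have "pavg A f - c = pavg A (\<lambda>w. f w - c)"
    by (simp add: pavg_diff[OF f set_integrable_const] const)
  also have "\<bar>\<dots>\<bar> \<le> ?dev"
    by (intro abs_pavg_le set_integral_diff(1) f set_integrable_const)
  finally have "\<bar>f w - pavg A f\<bar> \<le> \<bar>f w - c\<bar> + ?dev" for w
    by linarith
  then have "mean_oscillation A f \<le> pavg A (\<lambda>w. \<bar>f w - c\<bar> + ?dev)"
    unfolding mean_oscillation_def
    by (intro pavg_mono set_integral_add(1) set_integrable_deviation set_integrable_const f)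
  also have "\<dots> = 2 * ?dev"
    by (simp add: pavg_add[OF set_integrable_deviation[OF f] set_integrable_const] const)
  finally show ?thesis .
qed

lemma mean_oscillation_add_scaled_le:
  assumes f: "set_integrable lborel A f" and g: "set_integrable lborel A g"
  shows "mean_oscillation A (\<lambda>w. f w + c * g w) \<le> mean_oscillation A f + \<bar>c\<bar> * mean_oscillation A g"
proof -
  have cg: "set_integrable lborel A (\<lambda>w. c * g w)"
    using g by simp
  have avg: "pavg A (\<lambda>w. f w + c * g w) = pavg A f + c * pavg A g"
    by (simp add: pavg_add[OF f cg] pavg_cmult)
  have "\<bar>f w + c * g w - (pavg A f + c * pavg A g)\<bar> \<le> \<bar>f w - pavg A f\<bar> + \<bar>c\<bar> * \<bar>g w - pavg A g\<bar>"
      for w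
  proof -
    have "f w + c * g w - (pavg A f + c * pavg A g) = (f w - pavg A f) + c * (g w - pavg A g)"
      by (simp add: algebra_simps)
    then show ?thesis
      by (metis abs_mult abs_triangle_ineq)
  qed
  then have "mean_oscillation A (\<lambda>w. f w + c * g w)
      \<le> pavg A (\<lambda>w. \<bar>f w - pavg A f\<bar> + \<bar>c\<bar> * \<bar>g w - pavg A g\<bar>)"
    unfolding mean_oscillation_def avg
    by (intro pavg_mono set_integral_add(1) set_integrable_mult_right set_integrable_deviation
        f g cg)
  also have "\<dots> = mean_oscillation A f + \<bar>c\<bar> * mean_oscillation A g"
    unfolding mean_oscillation_def
    using set_integrable_deviation[OF f] set_integrable_deviation[OF g]
    by (simp add: pavg_add pavg_cmult)
  finally show ?thesis .
qed

lemma set_integrable_and_pavg_abs_le: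
  assumes [measurable]: "f \<in> borel_measurable borel" and pos: "0 < measure lborel A" and "0 \<le> C"
    and le: "(\<integral>\<^sup>+w\<in>A. ennreal \<bar>f w\<bar> \<partial>lborel) \<le> ennreal (C * measure lborel A)"
  shows "set_integrable lborel A f" and "pavg A (\<lambda>w. \<bar>f w\<bar>) \<le> C"
proof -
  have norm: "(\<integral>\<^sup>+w. ennreal (norm (indicator A w *\<^sub>R f w)) \<partial>lborel) =
      (\<integral>\<^sup>+w\<in>A. ennreal \<bar>f w\<bar> \<partial>lborel)"
    by (intro nn_integral_cong) (auto simp: indicator_def)
  show "set_integrable lborel A f"
    unfolding set_integrable_def
    by (rule integrableI_bounded) (use le in \<open>simp_all only: norm, auto intro: le_less_trans\<close>)
  have "(LINT w:A|lborel. \<bar>f w\<bar>) = (\<integral>w. norm (indicator A w *\<^sub>R f w) \<partial>lborel)"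
    unfolding set_lebesgue_integral_def
    by (intro Bochner_Integration.integral_cong) (auto simp: indicator_def)
  also have "\<dots> = enn2real (\<integral>\<^sup>+w\<in>A. ennreal \<bar>f w\<bar> \<partial>lborel)"
    unfolding norm[symmetric] by (rule integral_eq_nn_integral) auto
  also have "\<dots> \<le> C * measure lborel A"
    using le \<open>0 \<le> C\<close> by (intro enn2real_leI) auto
  finally show "pavg A (\<lambda>w. \<bar>f w\<bar>) \<le> C"
    using pos by (simp add: pavg_def pos_divide_le_eq)
qed

end

lemma pbmo_norm_le_iff:
  assumes "0 \<le> b"
  shows "pbmo_norm f \<le> ennreal b \<longleftrightarrow>
    (\<forall>z r. set_integrable lborel (pball z r) f) \<and>
    (\<forall>z r. 0 < r \<longrightarrow> mean_oscillation (pball z r) f \<le> b)"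
proof (cases "\<forall>z r. set_integrable lborel (pball z r) f")
  case True
  then show ?thesis
    using assms
    by (simp add: pbmo_norm_def mean_oscillation_def SUP_le_iff ennreal_le_iff
        del: split_paired_All)
      blast
next
  case False
  then show ?thesis
    by (auto simp: pbmo_norm_def top_unique)
qed

lemma pbmo_norm_add_scaled_le:
  assumes meas: "h \<in> borel_measurable borel" "f \<in> borel_measurable borel"
    "g \<in> borel_measurable borel"
    and eq: "AE w in lborel. h w = f w + c * g w"
    and f: "pbmo_norm f \<le> ennreal b" "0 \<le> b" and g: "pbmo_norm g \<le> ennreal b'" "0 \<le> b'"
  shows "pbmo_norm h \<le> ennreal (b + \<bar>c\<bar> * b')"
proof -
  note ball = pball_borel emeasure_pball_finite
  have fi: "set_integrable lborel (pball z r) f" and gi: "set_integrable lborel (pball z r) g"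
      for z r
    using f g pbmo_norm_le_iff by blast+
  have fo: "mean_oscillation (pball z r) f \<le> b" and go: "mean_oscillation (pball z r) g \<le> b'"
      if "0 < r" for z r
    using f g that pbmo_norm_le_iff by blast+
  have "set_integrable lborel (pball z r) (\<lambda>w. f w + c * g w)" for z r
    using fi gi by (intro set_integral_add(1)) auto
  then have "set_integrable lborel (pball z r) h" for z r
    using meas eq by (subst set_integrable_cong_AE[where g = "\<lambda>w. f w + c * g w"]) auto
  moreover have "mean_oscillation (pball z r) h \<le> b + \<bar>c\<bar> * b'" if "0 < r" for z r
  proof -
    have "mean_oscillation (pball z r) h = mean_oscillation (pball z r) (\<lambda>w. f w + c * g w)"
      using meas eq by (intro mean_oscillation_cong_AE) auto
    also have "\<dots> \<le> mean_oscillation (pball z r) f + \<bar>c\<bar> * mean_oscillation (pball z r) g"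
      by (rule mean_oscillation_add_scaled_le[OF ball fi gi])
    also have "\<dots> \<le> b + \<bar>c\<bar> * b'"
      using that by (intro add_mono mult_left_mono fo go) auto
    finally show ?thesis .
  qed
  ultimately show ?thesis
    using f(2) g(2) by (subst pbmo_norm_le_iff) auto
qed

lemma regular_fun_mono:
  assumes "regular_fun b1 b2 \<psi>" "b1 \<le> b1'" "b2 \<le> b2'"
  shows "regular_fun b1' b2' \<psi>"
proof -
  have "b1 * pdist z w \<le> b1' * pdist z w" for z w :: "real \<times> 'a"
    using assms(2) by (intro mult_right_mono) auto
  then show ?thesis
    using assms(1) ennreal_leI[OF assms(3)] unfolding regular_fun_def lip_half_one_def
    by (meson order_trans)
qed

lemma regular_fun_add_scaled:
  assumes f: "regular_fun b1 b2 f" "0 \<le> b2" and g: "regular_fun b1' b2' g" "0 \<le> b2'"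
  shows "regular_fun (b1 + \<bar>c\<bar> * b1') (b2 + \<bar>c\<bar> * b2') (\<lambda>z. f z + c * g z)"
proof -
  let ?h = "\<lambda>z. f z + c * g z"
  have lip: "lip_half_one (b1 + \<bar>c\<bar> * b1') ?h"
    using f(1) g(1) by (intro lip_half_one_add_scaled) (auto simp: regular_fun_def)
  have cont: "continuous_on UNIV f" "continuous_on UNIV g" "continuous_on UNIV ?h"
    using f(1) g(1) lip by (auto simp: regular_fun_def intro: lip_half_one_continuous)
  have "AE z in lborel. half_deriv_exists f z" "AE z in lborel. half_deriv_exists g z"
    using f(1) g(1) by (auto simp: regular_fun_def)
  then have deriv: "AE z in lborel. half_deriv_exists ?h z \<and>
      half_deriv ?h z = half_deriv f z + c * half_deriv g z"
    by eventually_elim (auto intro: half_deriv_add_scaled[OF cont(1,2)])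
  have "pbmo_norm (half_deriv ?h) \<le> ennreal (b2 + \<bar>c\<bar> * b2')"
    using f g deriv
    by (intro pbmo_norm_add_scaled_le[OF cont(3,1,2)[THEN borel_measurable_half_deriv]])
      (auto simp: regular_fun_def)
  then show ?thesis
    using lip deriv by (auto simp: regular_fun_def)
qed

section \<open>Integrals of the half-order kernel\<close>

lemma has_bochner_integral_nonneg_has_integral:
  fixes f :: "real \<Rightarrow> real"
  assumes [measurable]: "f \<in> borel_measurable borel" "A \<in> sets borel"
    and nonneg: "\<And>x. x \<in> A \<Longrightarrow> 0 \<le> f x" and I: "(f has_integral I) A"
  shows "has_bochner_integral lborel (\<lambda>x. indicator A x * f x) I"
proof (rule has_bochner_integral_nn_integral)
  show "0 \<le> I"
    by (rule has_integral_nonneg[OF I nonneg])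
  have "(\<integral>\<^sup>+x. ennreal (indicator A x * f x) \<partial>lborel) = (\<integral>\<^sup>+x\<in>A. ennreal (f x) \<partial>lborel)"
    by (intro nn_integral_cong) (auto simp: indicator_def)
  also have "\<dots> = ennreal I"
    by (rule nn_integral_has_integral_lebesgue'[OF nonneg I]) auto
  finally show "(\<integral>\<^sup>+x. ennreal (indicator A x * f x) \<partial>lborel) = ennreal I" .
qed (auto simp: indicator_def nonneg)

lemma has_bochner_integral_powr_tail:
  assumes "0 < \<rho>"
  shows "has_bochner_integral lborel (\<lambda>u. indicator {\<rho>..} u * u powr (-3/2)) (2 / sqrt \<rho>)"
proof -
  have "((\<lambda>u. u powr (-3/2)) has_integral (- (\<rho> powr (-3/2+1)) / (-3/2+1))) {\<rho>..}"
    using assms by (intro has_integral_powr_to_inf) auto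
  moreover have "- (\<rho> powr (-3/2+1)) / (-3/2+1) = 2 / sqrt \<rho>"
    using assms powr_minus[of \<rho> "1/2"] by (simp add: powr_half_sqrt field_simps)
  ultimately show ?thesis
    by (intro has_bochner_integral_nonneg_has_integral) auto
qed

lemma has_bochner_integral_powr_near:
  fixes m :: real
  assumes "0 < m"
  shows "has_bochner_integral lborel (\<lambda>u. indicator {0..m\<^sup>2} u * (u powr (-1/2) / m)) 2"
proof -
  have "((\<lambda>u. u powr (-1/2)) has_integral ((m\<^sup>2) powr (-1/2+1) / (-1/2+1))) {0..m\<^sup>2}"
    by (intro has_integral_powr_from_0) auto
  from has_integral_divide[OF this, of m]
  have "((\<lambda>u. u powr (-1/2) / m) has_integral 2) {0..m\<^sup>2}"
    using assms by (simp add: powr_half_sqrt)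
  then show ?thesis
    using assms by (intro has_bochner_integral_nonneg_has_integral) auto
qed

lemma has_bochner_integral_tail_kernel:
  assumes "0 < \<rho>"
  shows "has_bochner_integral lborel (\<lambda>u. indicator {u. \<rho> \<le> \<bar>u\<bar>} u / \<bar>u\<bar> powr (3/2)) (4 / sqrt \<rho>)"
proof -
  have "(\<lambda>u. indicator {0..} u *\<^sub>R (indicator {u. \<rho> \<le> \<bar>u\<bar>} u / \<bar>u\<bar> powr (3/2))) =
      (\<lambda>u. indicator {\<rho>..} u * u powr (-3/2))"
    using assms by (auto simp: fun_eq_iff indicator_def powr_minus field_simps)
  then have "has_bochner_integral lborel
      (\<lambda>u. indicator {0..} u *\<^sub>R (indicator {u. \<rho> \<le> \<bar>u\<bar>} u / \<bar>u\<bar> powr (3/2))) (2 / sqrt \<rho>)"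
    using has_bochner_integral_powr_tail[OF assms] by simp
  from has_bochner_integral_even_function[OF this] show ?thesis
    by (simp add: indicator_def)
qed

definition increment_kernel :: "real \<Rightarrow> real \<Rightarrow> real" where
  "increment_kernel m u = min (\<bar>u\<bar> / m) m / \<bar>u\<bar> powr (3/2)"

lemma increment_kernel_nonneg: "0 \<le> m \<Longrightarrow> 0 \<le> increment_kernel m u"
  by (simp add: increment_kernel_def)

lemma increment_kernel_eq_near:
  assumes "0 < m" "0 \<le> u" "u \<le> m\<^sup>2"
  shows "increment_kernel m u = u powr (-1/2) / m"
proof (cases "u = 0")
  case False
  have "u / m \<le> m"
    using assms by (simp add: field_simps power2_eq_square)
  then have "increment_kernel m u = u powr 1 / u powr (3/2) / m"
    using assms by (simp add: increment_kernel_def mult.commute)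
  also have "u powr 1 / u powr (3/2) = u powr (-1/2)"
    unfolding powr_diff[symmetric] by simp
  finally show ?thesis .
qed (simp add: increment_kernel_def)

lemma increment_kernel_eq_far:
  assumes "0 < m" "m\<^sup>2 \<le> u"
  shows "increment_kernel m u = m * u powr (-3/2)"
proof -
  have "0 < u"
    using assms zero_less_power[of m 2] by linarith
  moreover have "m \<le> u / m"
    using assms by (simp add: field_simps power2_eq_square)
  ultimately show ?thesis
    by (simp add: increment_kernel_def powr_minus field_simps)
qed

lemma has_bochner_integral_increment_kernel:
  assumes "0 < m"
  shows "has_bochner_integral lborel (increment_kernel m) 8"
proof -
  let ?near = "\<lambda>u. indicator {0..m\<^sup>2} u * (u powr (-1/2) / m)"
  let ?far = "\<lambda>u. indicator {m\<^sup>2..} u * (m * u powr (-3/2))"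
  have near: "has_bochner_integral lborel ?near 2"
    by (rule has_bochner_integral_powr_near[OF assms])
  have far: "has_bochner_integral lborel ?far 2"
    using has_bochner_integral_mult_right[OF has_bochner_integral_powr_tail[of "m\<^sup>2"], of m] assms
    by (simp add: mult_ac)
  have "AE u in lborel. u \<noteq> m\<^sup>2"
    by (rule AE_lborel_singleton)
  then have "AE u in lborel. ?near u + ?far u = indicator {0..} u *\<^sub>R increment_kernel m u"
  proof eventually_elim
    case (elim u)
    show ?case
    proof (cases "0 \<le> u")
      case True
      with elim show ?thesis
        using increment_kernel_eq_near[OF assms, of u] increment_kernel_eq_far[OF assms, of u]
        by (auto simp: indicator_def)
    next
      case False
      then have "\<not> m\<^sup>2 \<le> u"
        using zero_le_power2[of m] by linarith
      with False show ?thesis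
        by simp
    qed
  qed
  then have "has_bochner_integral lborel (\<lambda>u. indicator {0..} u *\<^sub>R increment_kernel m u) (2 + 2)"
    using has_bochner_integral_add[OF near far]
    by (subst (asm) has_bochner_integral_cong_AE) (auto simp: increment_kernel_def)
  moreover have "increment_kernel m (- u) = increment_kernel m u" for u
    by (simp add: increment_kernel_def)
  ultimately have "has_bochner_integral lborel (increment_kernel m) (2 *\<^sub>R (2 + 2))"
    by (rule has_bochner_integral_even_function)
  then show ?thesis
    by simp
qed

lemma nn_integral_increment_kernel_le:
  assumes "0 \<le> m"
  shows "(\<integral>\<^sup>+u. ennreal (increment_kernel m u) \<partial>lborel) \<le> 8"
proof (cases "m = 0")
  case False
  with assms have "has_bochner_integral lborel (increment_kernel m) 8"
    by (intro has_bochner_integral_increment_kernel) auto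
  then have "(\<integral>\<^sup>+u. ennreal (increment_kernel m u) \<partial>lborel) = ennreal 8"
    using assms increment_kernel_nonneg
    by (subst nn_integral_eq_integral) (auto simp: has_bochner_integral_iff)
  then show ?thesis
    by simp
qed (simp add: increment_kernel_def)

lemma borel_measurable_pair_sections:
  fixes \<phi> :: "real \<Rightarrow> real \<Rightarrow> ennreal"
  assumes \<phi>: "(\<lambda>p. \<phi> (fst p) (snd p)) \<in> borel_measurable (lborel \<Otimes>\<^sub>M lborel)"
  shows "(\<lambda>p. \<phi> (fst p + snd p) (snd p)) \<in> borel_measurable (lborel \<Otimes>\<^sub>M lborel)"
    and "\<phi> t \<in> borel_measurable borel"
    and "(\<lambda>t. \<phi> t u) \<in> borel_measurable borel"
    and "(\<lambda>u. \<phi> (t + u) u) \<in> borel_measurable borel"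
  using measurable_compose[OF _ \<phi>, of "\<lambda>p. (fst p + snd p, snd p)"]
    measurable_compose[OF _ \<phi>, of "\<lambda>u. (t, u)" lborel]
    measurable_compose[OF _ \<phi>, of "\<lambda>t. (t, u)" lborel]
    measurable_compose[OF _ \<phi>, of "\<lambda>u. (t + u, u)" lborel] by simp_all

lemma nn_integral_sheared_le:
  fixes \<phi> :: "real \<Rightarrow> real \<Rightarrow> ennreal"
  assumes \<phi>: "(\<lambda>p. \<phi> (fst p) (snd p)) \<in> borel_measurable (lborel \<Otimes>\<^sub>M lborel)"
    and le: "\<And>t. (\<integral>\<^sup>+u. \<phi> t u \<partial>lborel) \<le> C" and "0 \<le> \<rho>"
  shows "(\<integral>\<^sup>+t\<in>{a - \<rho>..a + \<rho>}. (\<integral>\<^sup>+u\<in>{u. \<bar>u\<bar> < \<rho>}. \<phi> (t + u) u \<partial>lborel) \<partial>lborel) \<le>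
      C * ennreal (4 * \<rho>)"
proof -
  let ?I = "{a - \<rho>..a + \<rho>}" and ?J = "{a - 2 * \<rho>..a + 2 * \<rho>}" and ?U = "{u. \<bar>u\<bar> < \<rho>}"
  note [measurable] = \<phi> borel_measurable_pair_sections[OF \<phi>]
  have "(\<integral>\<^sup>+t\<in>?I. (\<integral>\<^sup>+u\<in>?U. \<phi> (t + u) u \<partial>lborel) \<partial>lborel)
      = (\<integral>\<^sup>+t. \<integral>\<^sup>+u. \<phi> (t + u) u * indicator ?U u * indicator ?I t \<partial>lborel \<partial>lborel)"
    by (intro nn_integral_cong nn_integral_multc[symmetric]) measurable
  also have "\<dots> = (\<integral>\<^sup>+u. \<integral>\<^sup>+t. \<phi> (t + u) u * indicator ?U u * indicator ?I t \<partial>lborel \<partial>lborel)"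
    by (rule lborel_pair.Fubini'[symmetric]) measurable
  also have "\<dots> \<le> (\<integral>\<^sup>+u. \<integral>\<^sup>+t. \<phi> t u * indicator ?J t \<partial>lborel \<partial>lborel)"
  proof (rule nn_integral_mono)
    fix u
    have "(\<integral>\<^sup>+t. \<phi> (t + u) u * indicator ?U u * indicator ?I t \<partial>lborel)
        \<le> (\<integral>\<^sup>+t. \<phi> (u + 1 * t) u * indicator ?J (u + 1 * t) \<partial>lborel)"
      by (intro nn_integral_mono) (auto simp: indicator_def add.commute)
    also have "\<dots> = (\<integral>\<^sup>+t. \<phi> t u * indicator ?J t \<partial>lborel)"
      using nn_integral_real_affine[of "\<lambda>t. \<phi> t u * indicator ?J t" 1 u] by simp
    finally show "(\<integral>\<^sup>+t. \<phi> (t + u) u * indicator ?U u * indicator ?I t \<partial>lborel)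
        \<le> (\<integral>\<^sup>+t. \<phi> t u * indicator ?J t \<partial>lborel)" .
  qed
  also have "\<dots> = (\<integral>\<^sup>+t. \<integral>\<^sup>+u. \<phi> t u * indicator ?J t \<partial>lborel \<partial>lborel)"
    by (rule lborel_pair.Fubini') measurable
  also have "\<dots> = (\<integral>\<^sup>+t. (\<integral>\<^sup>+u. \<phi> t u \<partial>lborel) * indicator ?J t \<partial>lborel)"
    by (intro nn_integral_cong nn_integral_multc) measurable
  also have "\<dots> \<le> (\<integral>\<^sup>+t. C * indicator ?J t \<partial>lborel)"
    by (intro nn_integral_mono mult_right_mono le) auto
  also have "\<dots> = C * ennreal (4 * \<rho>)"
    using \<open>0 \<le> \<rho>\<close> by (subst nn_integral_cmult_indicator) auto
  finally show ?thesis .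
qed

section \<open>Functions whose square is Lipschitz in time\<close>

lemma diff_le_of_square_diff_le:
  fixes a b :: real
  assumes "0 \<le> a" "a \<le> b" "b\<^sup>2 - a\<^sup>2 \<le> d"
  shows "b - a \<le> min (d / b) b"
proof (cases "b = 0")
  case False
  have "(b - a) * b \<le> (b - a) * (b + a)"
    using assms by (intro mult_left_mono) auto
  also have "\<dots> \<le> d"
    using assms by (simp add: power2_eq_square algebra_simps)
  finally show ?thesis
    using False assms by (simp add: field_simps)
qed (use assms in auto)

lemma abs_diff_le_of_square_diff_le:
  fixes a b :: real
  assumes "0 \<le> a" "0 \<le> b" "\<bar>a\<^sup>2 - b\<^sup>2\<bar> \<le> d"
  shows "\<bar>a - b\<bar> \<le> min (d / a) a + min (d / b) b"
proof -
  have "0 \<le> min (d / c) c" if "0 \<le> c" for c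
    using that assms(3) by (simp add: order_trans[OF abs_ge_zero])
  then show ?thesis
    using assms diff_le_of_square_diff_le[of a b d] diff_le_of_square_diff_le[of b a d]
    by (smt (verit))
qed

definition half_deriv_bmo_const :: "nat \<Rightarrow> real" where
  "half_deriv_bmo_const d = 2 * (96 * 2 ^ d + 8)"

lemma half_deriv_bmo_const_pos: "0 < half_deriv_bmo_const d"
  by (simp add: half_deriv_bmo_const_def add_pos_pos)

locale time_regular =
  fixes g :: "real \<times> 'a::euclidean_space \<Rightarrow> real" and B :: real
  assumes nonneg: "0 \<le> g z" and bound: "g z \<le> B"
    and lip: "lip_half_one 1 g"
    and square_lip: "\<bar>(g (s, x))\<^sup>2 - (g (t, x))\<^sup>2\<bar> \<le> \<bar>s - t\<bar>"
begin

lemma continuous: "continuous_on UNIV g"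
  by (rule lip_half_one_continuous[OF lip])

lemma half_kernel_pair_borel [measurable]:
  "(\<lambda>p. half_kernel g (fst p) (snd p)) \<in> borel_measurable (lborel \<Otimes>\<^sub>M lborel)"
  using borel_measurable_half_kernel[OF continuous] by (simp add: lborel_prod)

lemma half_kernel_borel [measurable]: "half_kernel g z \<in> borel_measurable borel"
  using measurable_compose[OF _ half_kernel_pair_borel, of "\<lambda>u. (z, u)" lborel] by simp

lemma abs_half_kernel_le:
  "ennreal \<bar>half_kernel g (t, x) u\<bar> \<le>
     ennreal (increment_kernel (g (t, x)) u) + ennreal (increment_kernel (g (t + u, x)) u)"
proof -
  have "\<bar>g (t + u, x) - g (t, x)\<bar> \<le>
      min (\<bar>u\<bar> / g (t + u, x)) (g (t + u, x)) + min (\<bar>u\<bar> / g (t, x)) (g (t, x))"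
    using square_lip[of "t + u" x t] by (intro abs_diff_le_of_square_diff_le nonneg) simp
  then have "\<bar>half_kernel g (t, x) u\<bar> \<le>
      increment_kernel (g (t, x)) u + increment_kernel (g (t + u, x)) u"
    unfolding half_kernel_def increment_kernel_def
    by (simp add: divide_right_mono flip: add_divide_distrib)
  then show ?thesis
    by (simp add: ennreal_leI increment_kernel_nonneg nonneg flip: ennreal_plus)
qed

definition near :: "real \<Rightarrow> real \<times> 'a \<Rightarrow> ennreal" where
  "near \<rho> z = (\<integral>\<^sup>+u\<in>{u. \<bar>u\<bar> < \<rho>}. ennreal \<bar>half_kernel g z u\<bar> \<partial>lborel)"

definition far :: "real \<Rightarrow> real \<times> 'a \<Rightarrow> real" where
  "far \<rho> z = (LINT u:{u. \<rho> \<le> \<bar>u\<bar>}|lborel. half_kernel g z u)"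

lemma near_borel [measurable]: "near \<rho> \<in> borel_measurable borel"
proof -
  have "near \<rho> \<in> borel_measurable lborel"
    unfolding near_def[abs_def]
    by (rule lborel.borel_measurable_nn_integral) (simp add: case_prod_beta')
  then show ?thesis
    by simp
qed

lemma nn_integral_near_slice:
  assumes "0 < \<rho>"
  shows "(\<integral>\<^sup>+t\<in>{a - \<rho>..a + \<rho>}. near \<rho> (t, x) \<partial>lborel) \<le> ennreal (48 * \<rho>)"
proof -
  let ?I = "{a - \<rho>..a + \<rho>}" and ?U = "{u. \<bar>u\<bar> < \<rho>}"
  define \<phi> where "\<phi> t u = ennreal (increment_kernel (g (t, x)) u)" for t u
  have slice: "(\<lambda>t. g (t, x)) \<in> borel_measurable borel"
    by (intro borel_measurable_continuous_onI continuous_on_compose2[OF continuous]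
        continuous_intros) auto
  have \<phi>: "(\<lambda>p. \<phi> (fst p) (snd p)) \<in> borel_measurable (lborel \<Otimes>\<^sub>M lborel)"
    unfolding \<phi>_def increment_kernel_def using slice by measurable
  note [measurable] = \<phi> borel_measurable_pair_sections[OF \<phi>]
  have \<phi>_le: "(\<integral>\<^sup>+u. \<phi> t u \<partial>lborel) \<le> 8" for t
    unfolding \<phi>_def by (rule nn_integral_increment_kernel_le[OF nonneg])
  have near_le: "near \<rho> (t, x) \<le> 8 + (\<integral>\<^sup>+u\<in>?U. \<phi> (t + u) u \<partial>lborel)" for t
  proof -
    have "near \<rho> (t, x) \<le> (\<integral>\<^sup>+u. \<phi> t u + \<phi> (t + u) u * indicator ?U u \<partial>lborel)"
      unfolding near_def using abs_half_kernel_le[of t x]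
      by (intro nn_integral_mono) (auto simp: \<phi>_def indicator_def)
    also have "\<dots> = (\<integral>\<^sup>+u. \<phi> t u \<partial>lborel) + (\<integral>\<^sup>+u\<in>?U. \<phi> (t + u) u \<partial>lborel)"
      by (intro nn_integral_add) measurable
    finally show ?thesis
      using \<phi>_le[of t] by (meson add_right_mono order_trans)
  qed
  have [measurable]: "(\<lambda>t. \<integral>\<^sup>+u\<in>?U. \<phi> (t + u) u \<partial>lborel) \<in> borel_measurable lborel"
    by (rule lborel.borel_measurable_nn_integral) (simp add: case_prod_beta')
  have "(\<integral>\<^sup>+t\<in>?I. near \<rho> (t, x) \<partial>lborel)
      \<le> (\<integral>\<^sup>+t. 8 * indicator ?I t + (\<integral>\<^sup>+u\<in>?U. \<phi> (t + u) u \<partial>lborel) * indicator ?I t \<partial>lborel)"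
    using near_le by (intro nn_integral_mono) (auto simp: indicator_def)
  also have "\<dots> = (\<integral>\<^sup>+t\<in>?I. 8 \<partial>lborel) + (\<integral>\<^sup>+t\<in>?I. (\<integral>\<^sup>+u\<in>?U. \<phi> (t + u) u \<partial>lborel) \<partial>lborel)"
    by (intro nn_integral_add) measurable
  also have "\<dots> \<le> 8 * ennreal (2 * \<rho>) + 8 * ennreal (4 * \<rho>)"
    using assms nn_integral_sheared_le[OF \<phi> \<phi>_le, of \<rho> a]
    by (intro add_mono) (auto simp: nn_integral_cmult_indicator)
  also have "\<dots> = ennreal (48 * \<rho>)"
    using assms by (simp flip: ennreal_numeral ennreal_mult ennreal_plus)
  finally show ?thesis .
qed

lemma nn_integral_near_pball:
  assumes "0 < r"
  shows "(\<integral>\<^sup>+z\<in>pball z0 r. near (r\<^sup>2) z \<partial>lborel) \<le>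
      ennreal (48 * r\<^sup>2 * measure lborel (ball (snd z0) r))"
proof -
  let ?I = "{fst z0 - r\<^sup>2..fst z0 + r\<^sup>2}" and ?B = "ball (snd z0) r"
  have box: "?I \<times> ?B \<in> sets borel"
    by (intro borel_Times) auto
  have "(\<integral>\<^sup>+z\<in>pball z0 r. near (r\<^sup>2) z \<partial>lborel) \<le> (\<integral>\<^sup>+z\<in>?I \<times> ?B. near (r\<^sup>2) z \<partial>lborel)"
    using pball_subset_box[of z0 r] by (intro nn_integral_mono) (auto simp: indicator_def)
  also have "\<dots> = (\<integral>\<^sup>+z\<in>?I \<times> ?B. near (r\<^sup>2) z \<partial>(lborel \<Otimes>\<^sub>M lborel))"
    by (simp add: lborel_prod)
  also have "\<dots> = (\<integral>\<^sup>+x. \<integral>\<^sup>+t. near (r\<^sup>2) (t, x) * indicator (?I \<times> ?B) (t, x) \<partial>lborel \<partial>lborel)"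
    using box by (intro lborel_pair.nn_integral_snd[symmetric]) (simp add: lborel_prod)
  also have "\<dots> = (\<integral>\<^sup>+x\<in>?B. (\<integral>\<^sup>+t\<in>?I. near (r\<^sup>2) (t, x) \<partial>lborel) \<partial>lborel)"
    by (intro nn_integral_cong) (auto simp: indicator_def intro!: nn_integral_cong)
  also have "\<dots> \<le> (\<integral>\<^sup>+x\<in>?B. ennreal (48 * r\<^sup>2) \<partial>lborel)"
    using assms by (intro nn_integral_mono mult_right_mono nn_integral_near_slice) auto
  also have "\<dots> = ennreal (48 * r\<^sup>2) * emeasure lborel ?B"
    by (rule nn_integral_cmult_indicator) auto
  also have "\<dots> = ennreal (48 * r\<^sup>2 * measure lborel ?B)"
    using emeasure_bounded_finite[OF bounded_ball, of "snd z0" r]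
    by (simp add: emeasure_eq_ennreal_measure ennreal_mult)
  finally show ?thesis .
qed

lemma set_integrable_far:
  assumes "0 < \<rho>"
  shows "set_integrable lborel {u. \<rho> \<le> \<bar>u\<bar>} (half_kernel g z)"
  unfolding set_integrable_def
proof (rule Bochner_Integration.integrable_bound)
  show "integrable lborel (\<lambda>u. B * (indicator {u. \<rho> \<le> \<bar>u\<bar>} u / \<bar>u\<bar> powr (3/2)))"
    using has_bochner_integral_tail_kernel[OF assms]
    by (intro integrable_mult_right) (simp add: has_bochner_integral_iff)
  have "\<bar>g (fst z + u, snd z) - g z\<bar> \<le> \<bar>B\<bar>" for u
    using nonneg[of z] nonneg[of "(fst z + u, snd z)"] bound[of z] bound[of "(fst z + u, snd z)"]
    by linarith
  then show "AE u in lborel. norm (indicator {u. \<rho> \<le> \<bar>u\<bar>} u *\<^sub>R half_kernel g z u)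
      \<le> norm (B * (indicator {u. \<rho> \<le> \<bar>u\<bar>} u / \<bar>u\<bar> powr (3/2)))"
    by (intro AE_I2) (auto simp: half_kernel_def indicator_def abs_mult intro!: divide_right_mono)
qed measurable

lemma integrable_half_kernel:
  assumes "near \<rho> z < \<infinity>" "0 < \<rho>"
  shows "integrable lborel (half_kernel g z)"
    and "\<bar>(\<integral>u. half_kernel g z u \<partial>lborel) - far \<rho> z\<bar> \<le> enn2real (near \<rho> z)"
proof -
  let ?near = "\<lambda>u. indicator {u. \<bar>u\<bar> < \<rho>} u *\<^sub>R half_kernel g z u"
  let ?far = "\<lambda>u. indicator {u. \<rho> \<le> \<bar>u\<bar>} u *\<^sub>R half_kernel g z u"
  have near_eq: "near \<rho> z = (\<integral>\<^sup>+u. ennreal (norm (?near u)) \<partial>lborel)"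
    unfolding near_def by (intro nn_integral_cong) (auto simp: indicator_def)
  have near: "integrable lborel ?near"
    using assms(1) unfolding near_eq by (intro integrableI_bounded) auto
  have far: "integrable lborel ?far"
    using set_integrable_far[OF assms(2)] by (simp add: set_integrable_def)
  have split: "half_kernel g z = (\<lambda>u. ?near u + ?far u)"
    by (auto simp: indicator_def)
  show "integrable lborel (half_kernel g z)"
    by (subst split) (rule Bochner_Integration.integrable_add[OF near far])
  have "(\<integral>u. half_kernel g z u \<partial>lborel) = (\<integral>u. ?near u \<partial>lborel) + far \<rho> z"
    unfolding far_def set_lebesgue_integral_def
    by (subst split) (rule Bochner_Integration.integral_add[OF near far])
  moreover have "\<bar>\<integral>u. ?near u \<partial>lborel\<bar> \<le> enn2real (near \<rho> z)"
    using integral_norm_bound[of lborel ?near] unfolding near_eq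
    by (subst integral_eq_nn_integral[symmetric]) auto
  ultimately show "\<bar>(\<integral>u. half_kernel g z u \<partial>lborel) - far \<rho> z\<bar> \<le> enn2real (near \<rho> z)"
    by simp
qed

lemma half_trunc_tendsto:
  assumes "near \<rho> z < \<infinity>" "0 < \<rho>"
  shows "(half_trunc g z \<longlongrightarrow> (\<integral>u. half_kernel g z u \<partial>lborel)) pv_filter"
  by (intro half_trunc_tendsto_integral integrable_half_kernel(1)[OF assms])

lemma AE_near_finite:
  assumes "0 < r"
  shows "AE z in lborel. z \<in> pball z0 r \<longrightarrow> near (r\<^sup>2) z < \<infinity>"
proof -
  have "AE z in lborel. near (r\<^sup>2) z * indicator (pball z0 r) z \<noteq> \<infinity>"
    using nn_integral_near_pball[OF assms, of z0]
    by (intro nn_integral_noteq_infinite) (auto simp: top_unique)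
  then show ?thesis
    by eventually_elim (auto simp: indicator_def less_top)
qed

lemma AE_half_deriv_exists: "AE z in lborel. half_deriv_exists g z"
proof -
  have "AE z in lborel. \<forall>n::nat. z \<in> pball 0 (real (Suc n)) \<longrightarrow> near ((real (Suc n))\<^sup>2) z < \<infinity>"
    by (subst AE_all_countable) (intro allI AE_near_finite, simp)
  then show ?thesis
  proof eventually_elim
    case (elim z)
    obtain n :: nat where "pdist 0 z < real n"
      using reals_Archimedean2 by blast
    then have "z \<in> pball 0 (real (Suc n))"
      by (simp add: pball_def)
    with elim have "near ((real (Suc n))\<^sup>2) z < \<infinity>"
      by blast
    then have "(half_trunc g z \<longlongrightarrow> (\<integral>u. half_kernel g z u \<partial>lborel)) pv_filter"
      by (rule half_trunc_tendsto) simp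
    then show ?case
      by (auto simp: half_deriv_exists_def)
  qed
qed

text \<open>Translating in time by \<open>u\<close> moves both endpoints of the increment, so far increments at
  two nearby points differ only by the parabolic distance of these points.\<close>

lemma far_oscillation:
  assumes "0 < r" "z \<in> pball z0 r"
  shows "\<bar>far (r\<^sup>2) z - far (r\<^sup>2) z0\<bar> \<le> 8"
proof -
  let ?A = "{u. r\<^sup>2 \<le> \<bar>u\<bar>}"
  have r2: "0 < r\<^sup>2"
    using assms by simp
  have tail: "has_bochner_integral lborel (\<lambda>u. indicator ?A u / \<bar>u\<bar> powr (3/2)) (4 / r)"
    using has_bochner_integral_tail_kernel[OF r2] assms by simp
  have kernel: "\<bar>half_kernel g z u - half_kernel g z0 u\<bar> \<le> 2 * r / \<bar>u\<bar> powr (3/2)" for u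
  proof -
    have shift: "pdist (fst z + u, snd z) (fst z0 + u, snd z0) = pdist z z0"
      by (simp add: pdist_def)
    have "pdist z z0 < r"
      using assms by (simp add: pball_def pdist_commute)
    then have "\<bar>(g (fst z + u, snd z) - g z) - (g (fst z0 + u, snd z0) - g z0)\<bar> \<le> 2 * r"
      using lip_half_oneD[OF lip, of z z0]
        lip_half_oneD[OF lip, of "(fst z + u, snd z)" "(fst z0 + u, snd z0)"]
      unfolding shift by linarith
    then show ?thesis
      by (simp add: half_kernel_def divide_right_mono flip: diff_divide_distrib)
  qed
  have "\<bar>far (r\<^sup>2) z - far (r\<^sup>2) z0\<bar> = \<bar>LINT u:?A|lborel. half_kernel g z u - half_kernel g z0 u\<bar>"
    unfolding far_def using set_integrable_far[OF r2] by simp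
  also have "\<dots> \<le> (\<integral>u. 2 * r * (indicator ?A u / \<bar>u\<bar> powr (3/2)) \<partial>lborel)"
    unfolding set_lebesgue_integral_def
  proof (rule integral_abs_bound_integral)
    show "integrable lborel (\<lambda>u. indicator ?A u *\<^sub>R (half_kernel g z u - half_kernel g z0 u))"
      using set_integral_diff(1)[OF set_integrable_far[OF r2] set_integrable_far[OF r2]]
      by (simp add: set_integrable_def)
    show "integrable lborel (\<lambda>u. 2 * r * (indicator ?A u / \<bar>u\<bar> powr (3/2)))"
      using tail by (intro integrable_mult_right) (simp only: has_bochner_integral_iff)
    show "\<bar>indicator ?A u *\<^sub>R (half_kernel g z u - half_kernel g z0 u)\<bar>
        \<le> 2 * r * (indicator ?A u / \<bar>u\<bar> powr (3/2))" for u
      using kernel[of u] by (simp add: indicator_def)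
  qed
  also have "\<dots> = 2 * r * (4 / r)"
    using tail by (simp only: has_bochner_integral_iff integral_mult_right_zero)
  finally show ?thesis
    using assms by simp
qed

lemma abs_half_deriv_deviation_le:
  assumes "0 < r" "z \<in> pball z0 r" and fin: "near (r\<^sup>2) z < \<infinity>"
  shows "ennreal \<bar>half_deriv g z - half_deriv_factor * far (r\<^sup>2) z0\<bar> \<le> near (r\<^sup>2) z + 8"
proof -
  define J where "J = (\<integral>u. half_kernel g z u \<partial>lborel)"
  have r2: "0 < r\<^sup>2"
    using assms by simp
  have "half_deriv g z = half_deriv_factor * J"
    unfolding J_def by (rule half_deriv_eqI[OF half_trunc_tendsto[OF fin r2]])
  then have "\<bar>half_deriv g z - half_deriv_factor * far (r\<^sup>2) z0\<bar> =
      \<bar>half_deriv_factor\<bar> * \<bar>J - far (r\<^sup>2) z0\<bar>"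
    by (simp add: abs_mult flip: right_diff_distrib)
  also have "\<dots> \<le> 1 * \<bar>J - far (r\<^sup>2) z0\<bar>"
    by (intro mult_right_mono abs_half_deriv_factor_le) auto
  also have "\<dots> \<le> \<bar>J - far (r\<^sup>2) z\<bar> + \<bar>far (r\<^sup>2) z - far (r\<^sup>2) z0\<bar>"
    by simp
  also have "\<dots> \<le> enn2real (near (r\<^sup>2) z) + 8"
    unfolding J_def by (intro add_mono integrable_half_kernel(2)[OF fin r2] far_oscillation assms)
  finally have "ennreal \<bar>half_deriv g z - half_deriv_factor * far (r\<^sup>2) z0\<bar> \<le>
      ennreal (enn2real (near (r\<^sup>2) z) + 8)"
    by (rule ennreal_leI)
  also have "\<dots> = near (r\<^sup>2) z + 8"
    using fin by (subst ennreal_plus) (auto simp: ennreal_enn2real_if)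
  finally show ?thesis .
qed

lemma nn_integral_half_deriv_deviation_le:
  assumes "0 < r"
  shows "(\<integral>\<^sup>+z\<in>pball z0 r. ennreal \<bar>half_deriv g z - half_deriv_factor * far (r\<^sup>2) z0\<bar> \<partial>lborel)
    \<le> ennreal ((96 * 2 ^ DIM('a) + 8) * measure lborel (pball z0 r))"
proof -
  let ?A = "pball z0 r" and ?B = "ball (snd z0) r"
  have "(\<integral>\<^sup>+z\<in>?A. ennreal \<bar>half_deriv g z - half_deriv_factor * far (r\<^sup>2) z0\<bar> \<partial>lborel)
      \<le> (\<integral>\<^sup>+z. near (r\<^sup>2) z * indicator ?A z + 8 * indicator ?A z \<partial>lborel)"
  proof (rule nn_integral_mono_AE)
    show "AE z in lborel.
        ennreal \<bar>half_deriv g z - half_deriv_factor * far (r\<^sup>2) z0\<bar> * indicator ?A z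
        \<le> near (r\<^sup>2) z * indicator ?A z + 8 * indicator ?A z"
      using AE_near_finite[OF assms, of z0]
      by eventually_elim (use abs_half_deriv_deviation_le[OF assms] in \<open>auto simp: indicator_def\<close>)
  qed
  also have "\<dots> = (\<integral>\<^sup>+z\<in>?A. near (r\<^sup>2) z \<partial>lborel) + 8 * emeasure lborel ?A"
    by (subst nn_integral_add) (auto simp: nn_integral_cmult_indicator)
  also have "\<dots> \<le> ennreal (48 * r\<^sup>2 * measure lborel ?B) + ennreal (8 * measure lborel ?A)"
    using emeasure_pball_finite[of z0 r] nn_integral_near_pball[OF assms, of z0]
    by (intro add_mono) (auto simp: emeasure_eq_ennreal_measure ennreal_mult)
  also have "\<dots> = ennreal (48 * (r\<^sup>2 * measure lborel ?B) + 8 * measure lborel ?A)"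
    by (simp flip: ennreal_plus)
  also have "\<dots> \<le> ennreal ((96 * 2 ^ DIM('a) + 8) * measure lborel ?A)"
    using measure_pball_ge[OF assms, of z0] by (intro ennreal_leI) (simp add: algebra_simps)
  finally show ?thesis .
qed

lemma pbmo_norm_half_deriv_le: "pbmo_norm (half_deriv g) \<le> ennreal (half_deriv_bmo_const DIM('a))"
proof -
  let ?C = "96 * 2 ^ DIM('a) + 8 :: real"
  have [measurable]: "half_deriv g \<in> borel_measurable borel"
    by (rule borel_measurable_half_deriv[OF continuous])
  have osc: "set_integrable lborel (pball z r) (half_deriv g) \<and>
      mean_oscillation (pball z r) (half_deriv g) \<le> 2 * ?C"
    if "0 < r" for z r
  proof -
    define c where "c = half_deriv_factor * far (r\<^sup>2) z"
    note ball = pball_borel[of z r] emeasure_pball_finite[of z r]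
    note pos = measure_pball_pos[OF that, of z]
    have "set_integrable lborel (pball z r) (\<lambda>w. half_deriv g w - c)"
      and dev: "pavg (pball z r) (\<lambda>w. \<bar>half_deriv g w - c\<bar>) \<le> ?C"
      using nn_integral_half_deriv_deviation_le[OF that, of z]
      by (intro set_integrable_and_pavg_abs_le[OF ball _ pos]; simp add: c_def)+
    then have int: "set_integrable lborel (pball z r) (half_deriv g)"
      using set_integral_add(1)[OF _ set_integrable_const[OF ball], of "\<lambda>w. half_deriv g w - c" c]
      by simp
    moreover have "mean_oscillation (pball z r) (half_deriv g) \<le> 2 * ?C"
      by (rule order_trans[OF mean_oscillation_le_deviation[OF ball int pos, of c]])
          (use dev in simp)
    ultimately show ?thesis
      by simp
  qed
  have "set_integrable lborel (pball z r) (half_deriv g)" for z r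
    using osc[of r z] pball_empty[of r z] by (cases "0 < r") auto
  then show ?thesis
    using osc half_deriv_bmo_const_pos
    by (subst pbmo_norm_le_iff) (auto simp: half_deriv_bmo_const_def)
qed

lemma regular: "regular_fun 1 (half_deriv_bmo_const DIM('a)) g"
  unfolding regular_fun_def using lip AE_half_deriv_exists pbmo_norm_half_deriv_le by blast

end

section \<open>Regularised distance to a family of scaled points\<close>

definition quad_dist :: "real \<times> 'a::real_normed_vector \<Rightarrow> real \<times> 'a \<Rightarrow> real" where
  "quad_dist p w = (norm (snd p - snd w))\<^sup>2 + \<bar>fst p - fst w\<bar>"

definition reg_dist :: "real \<Rightarrow> (real \<times> real \<times> 'a::real_normed_vector) set \<Rightarrow> real \<times> 'a \<Rightarrow> real" where
  "reg_dist c A p = sqrt (Inf (insert (c\<^sup>2) {d\<^sup>2 + quad_dist p w | d w. (d, w) \<in> A}))"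

lemma quad_dist_nonneg: "0 \<le> quad_dist p w"
  by (simp add: quad_dist_def)

lemma sqrt_quad_dist_eq_norm:
  "sqrt (d\<^sup>2 + quad_dist p w) = norm (d, norm (snd p - snd w), sqrt \<bar>fst p - fst w\<bar>)"
  by (simp add: quad_dist_def norm_Pair)

lemma sqrt_quad_dist_le: "0 \<le> d \<Longrightarrow> sqrt (d\<^sup>2 + quad_dist p w) \<le> d + pdist p w"
  unfolding sqrt_quad_dist_eq_norm pdist_def
  using norm_Pair_le[of d "(norm (snd p - snd w), sqrt \<bar>fst p - fst w\<bar>)"]
    norm_Pair_le[of "norm (snd p - snd w)" "sqrt \<bar>fst p - fst w\<bar>"] by simp

lemma scale_le_sqrt_quad_dist: "d \<le> sqrt (d\<^sup>2 + quad_dist p w)"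
  using quad_dist_nonneg[of p w] by (intro real_le_rsqrt) simp

lemma pdist_le_sqrt_quad_dist: "pdist p w \<le> 2 * sqrt (d\<^sup>2 + quad_dist p w)"
proof -
  have "norm (snd p - snd w) \<le> sqrt (d\<^sup>2 + quad_dist p w)"
      "sqrt \<bar>fst p - fst w\<bar> \<le> sqrt (d\<^sup>2 + quad_dist p w)"
    unfolding quad_dist_def by (auto intro: real_le_rsqrt)
  then show ?thesis
    unfolding pdist_def by linarith
qed

lemma sqrt_quad_dist_triangle:
  "sqrt (d\<^sup>2 + quad_dist p w) \<le> sqrt (d\<^sup>2 + quad_dist p' w) + pdist p p'"
proof -
  define a b where "a = norm (snd p - snd p')" and "b = sqrt \<bar>fst p - fst p'\<bar>"
  define n s where "n = norm (snd p' - snd w)" and "s = sqrt \<bar>fst p' - fst w\<bar>"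
  have mono: "norm (d, x, y) \<le> norm (d, x', y')" if "0 \<le> x" "x \<le> x'" "0 \<le> y" "y \<le> y'"
      for x x' y y' :: real
    using that by (simp add: norm_Pair add_mono power_mono)
  have "norm (snd p - snd w) \<le> n + a"
    using norm_triangle_ineq[of "snd p - snd p'" "snd p' - snd w"] by (simp add: a_def n_def)
  moreover have "sqrt \<bar>fst p - fst w\<bar> \<le> s + b"
    using sqrt_abs_triangle[of "fst p" "fst w" "fst p'"] by (simp add: b_def s_def)
  ultimately have "sqrt (d\<^sup>2 + quad_dist p w) \<le> norm (d, n + a, s + b)"
    unfolding sqrt_quad_dist_eq_norm by (intro mono) auto
  also have "(d, n + a, s + b) = (d, n, s) + (0, a, b)"
    by simp
  also have "norm \<dots> \<le> norm (d, n, s) + norm (0 :: real, a, b)"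
    by (rule norm_triangle_ineq)
  also have "norm (0 :: real, a, b) \<le> a + b"
    using norm_Pair_le[of a b] by (simp add: norm_Pair a_def b_def)
  finally show ?thesis
    by (simp add: sqrt_quad_dist_eq_norm pdist_def a_def b_def n_def s_def)
qed

context
  fixes c :: real and A :: "(real \<times> real \<times> 'a::real_normed_vector) set"
  assumes c_nonneg: "0 \<le> c"
begin

lemma reg_dist_nonneg: "0 \<le> reg_dist c A p"
  unfolding reg_dist_def
  by (intro real_sqrt_ge_zero cInf_greatest) (auto intro: add_nonneg_nonneg quad_dist_nonneg)

lemma square_reg_dist:
  "(reg_dist c A p)\<^sup>2 = Inf (insert (c\<^sup>2) {d\<^sup>2 + quad_dist p w | d w. (d, w) \<in> A})"
  unfolding reg_dist_def
  by (intro real_sqrt_pow2 cInf_greatest) (auto intro: add_nonneg_nonneg quad_dist_nonneg)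

lemma square_reg_dist_less_iff:
  "(reg_dist c A p)\<^sup>2 < v \<longleftrightarrow> c\<^sup>2 < v \<or> (\<exists>d w. (d, w) \<in> A \<and> d\<^sup>2 + quad_dist p w < v)"
proof -
  have "bdd_below (insert (c\<^sup>2) {d\<^sup>2 + quad_dist p w | d w. (d, w) \<in> A})"
    by (rule bdd_belowI[of _ 0]) (auto intro: add_nonneg_nonneg quad_dist_nonneg)
  then show ?thesis
    unfolding square_reg_dist by (subst cInf_less_iff) auto
qed

lemma reg_dist_less_iff:
  "reg_dist c A p < e \<longleftrightarrow> c < e \<or> (\<exists>d w. (d, w) \<in> A \<and> sqrt (d\<^sup>2 + quad_dist p w) < e)"
proof -
  have nonneg: "0 \<le> d\<^sup>2 + quad_dist p w" for d w
    by (simp add: quad_dist_nonneg)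
  show ?thesis
  proof (cases "0 < e")
    case True
    have square: "x < e \<longleftrightarrow> x\<^sup>2 < e\<^sup>2" if "0 \<le> x" for x
      using that True
      by (metis abs_of_nonneg less_imp_le power2_less_imp_less power_strict_mono zero_less_numeral)
    have "reg_dist c A p < e \<longleftrightarrow> c\<^sup>2 < e\<^sup>2 \<or> (\<exists>d w. (d, w) \<in> A \<and> d\<^sup>2 + quad_dist p w < e\<^sup>2)"
      unfolding square[OF reg_dist_nonneg] by (rule square_reg_dist_less_iff)
    also have "\<dots> \<longleftrightarrow> c < e \<or> (\<exists>d w. (d, w) \<in> A \<and> sqrt (d\<^sup>2 + quad_dist p w) < e)"
    proof -
      have "sqrt (d\<^sup>2 + quad_dist p w) < e \<longleftrightarrow> d\<^sup>2 + quad_dist p w < e\<^sup>2" for d w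
        using square[of "sqrt (d\<^sup>2 + quad_dist p w)"] nonneg by simp
      then show ?thesis
        using square[OF c_nonneg] by simp
    qed
    finally show ?thesis .
  next
    case False
    moreover have "0 \<le> sqrt (d\<^sup>2 + quad_dist p w)" for d w
      using nonneg by simp
    ultimately show ?thesis
      using reg_dist_nonneg[of p] c_nonneg by (force simp: not_less intro: order_trans)
  qed
qed

lemma reg_dist_le_cap: "reg_dist c A p \<le> c"
  by (rule dense_ge) (simp add: reg_dist_less_iff less_imp_le)

lemma reg_dist_le:
  assumes "(d, w) \<in> A" "0 \<le> d"
  shows "reg_dist c A p \<le> d + pdist p w"
proof (rule dense_ge)
  fix e assume "d + pdist p w < e"
  then have "sqrt (d\<^sup>2 + quad_dist p w) < e"
    using sqrt_quad_dist_le[OF assms(2), of p w] by simp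
  then show "reg_dist c A p \<le> e"
    using assms(1) reg_dist_less_iff by (blast intro: less_imp_le)
qed

lemma reg_dist_nearE:
  assumes "reg_dist c A p < e"
  obtains "c < e" | d w where "(d, w) \<in> A" "d < e" "pdist p w < 2 * e"
proof -
  consider "c < e" | d w where "(d, w) \<in> A" "sqrt (d\<^sup>2 + quad_dist p w) < e"
    using assms reg_dist_less_iff by blast
  then show ?thesis
  proof cases
    case (2 d w)
    then show ?thesis
      using scale_le_sqrt_quad_dist[of d p w] pdist_le_sqrt_quad_dist[of p w d]
      by (intro that(2)[of d w]) auto
  qed (rule that(1))
qed

lemma reg_dist_lip_le: "reg_dist c A p \<le> reg_dist c A p' + pdist p p'"
proof (rule field_le_epsilon)
  fix \<epsilon> :: real assume "0 < \<epsilon>"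
  let ?e = "reg_dist c A p' + \<epsilon>"
  have "reg_dist c A p' < ?e"
    using \<open>0 < \<epsilon>\<close> by simp
  then consider "c < ?e" | d w where "(d, w) \<in> A" "sqrt (d\<^sup>2 + quad_dist p' w) < ?e"
    using reg_dist_less_iff by blast
  then show "reg_dist c A p \<le> reg_dist c A p' + pdist p p' + \<epsilon>"
  proof cases
    case 1
    then show ?thesis
      using reg_dist_le_cap[of p] pdist_nonneg[of p p'] by linarith
  next
    case (2 d w)
    then have "sqrt (d\<^sup>2 + quad_dist p w) < reg_dist c A p' + pdist p p' + \<epsilon>"
      using sqrt_quad_dist_triangle[of d p w p'] by linarith
    then show ?thesis
      using 2(1) reg_dist_less_iff by (blast intro: less_imp_le)
  qed
qed

lemma square_reg_dist_le: "(reg_dist c A (s, x))\<^sup>2 \<le> (reg_dist c A (t, x))\<^sup>2 + \<bar>s - t\<bar>"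
proof (rule field_le_epsilon)
  fix \<epsilon> :: real assume "0 < \<epsilon>"
  let ?v = "(reg_dist c A (t, x))\<^sup>2 + \<epsilon>"
  have "(reg_dist c A (t, x))\<^sup>2 < ?v"
    using \<open>0 < \<epsilon>\<close> by simp
  then consider "c\<^sup>2 < ?v" | d w where "(d, w) \<in> A" "d\<^sup>2 + quad_dist (t, x) w < ?v"
    using square_reg_dist_less_iff by blast
  then have "(reg_dist c A (s, x))\<^sup>2 < ?v + \<bar>s - t\<bar>"
  proof cases
    case 1
    then have "c\<^sup>2 < ?v + \<bar>s - t\<bar>"
      by linarith
    then show ?thesis
      by (simp add: square_reg_dist_less_iff)
  next
    case (2 d w)
    have "quad_dist (s, x) w \<le> quad_dist (t, x) w + \<bar>s - t\<bar>"
      by (simp add: quad_dist_def)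
    with 2 have "d\<^sup>2 + quad_dist (s, x) w < ?v + \<bar>s - t\<bar>"
      by linarith
    then show ?thesis
      using 2(1) square_reg_dist_less_iff by blast
  qed
  then show "(reg_dist c A (s, x))\<^sup>2 \<le> (reg_dist c A (t, x))\<^sup>2 + \<bar>s - t\<bar> + \<epsilon>"
    by simp
qed

end

lemma time_regular_reg_dist:
  fixes A :: "(real \<times> real \<times> 'a::euclidean_space) set"
  assumes "0 \<le> c"
  shows "time_regular (reg_dist c A) c"
proof
  show "lip_half_one 1 (reg_dist c A)"
    unfolding lip_half_one_def
    using reg_dist_lip_le[OF assms, of A] pdist_commute by (smt (verit) mult_1)
  show "\<bar>(reg_dist c A (s, x))\<^sup>2 - (reg_dist c A (t, x))\<^sup>2\<bar> \<le> \<bar>s - t\<bar>" for s x t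
    using square_reg_dist_le[OF assms, of A s x t] square_reg_dist_le[OF assms, of A t x s]
    by linarith
qed (use assms in \<open>auto simp: reg_dist_nonneg reg_dist_le_cap\<close>)

section \<open>Coordinates adapted to a plane\<close>

locale plane_chart =
  fixes P :: "'n::finite stpt set" and q :: "real^'n" and L :: "real^'m::finite \<Rightarrow> real^'n"
    and \<nu> :: "real^'n"
  assumes coords: "plane_coords P q L \<nu>" and card: "CARD('n) = CARD('m) + 1"
begin

definition proj :: "'n stpt \<Rightarrow> 'm stpt" where
  "proj z = (fst z, adjoint L (snd z - q))"

definition height :: "'n stpt \<Rightarrow> real" where
  "height z = (snd z - q) \<bullet> \<nu>"

definition lift :: "'m stpt \<Rightarrow> real \<Rightarrow> 'n stpt" where
  "lift p y = chart q L \<nu> (fst p) (snd p) y"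

lemma linear_L: "linear L" and norm_L: "norm (L x) = norm x" and norm_\<nu>: "norm \<nu> = 1"
    and L_\<nu>: "L x \<bullet> \<nu> = 0"
  using coords by (auto simp: plane_coords_def)

lemma adjoint_L_L: "adjoint L (L x) = x"
proof -
  have "L x \<bullet> L y = x \<bullet> y" for x y
    by (simp add: dot_norm norm_L flip: linear_add[OF linear_L])
  then have "x \<bullet> adjoint L (L y) = x \<bullet> y" for x y
    by (simp add: adjoint_works[OF linear_L])
  then show ?thesis
    using vector_eq_ldot by blast
qed

lemma adjoint_L_\<nu>: "adjoint L \<nu> = 0"
  using adjoint_works[OF linear_L, of "adjoint L \<nu>" \<nu>] by (simp add: L_\<nu>)

lemma adjoint_L_decomposition: "adjoint L (L x + y *\<^sub>R \<nu>) = x"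
  using adjoint_linear[OF linear_L]
  by (simp add: linear_add linear_scale adjoint_L_L adjoint_L_\<nu>)

lemma inner_\<nu>_decomposition: "(L x + y *\<^sub>R \<nu>) \<bullet> \<nu> = y"
  using norm_\<nu> by (simp add: inner_add_left L_\<nu> dot_square_norm)

lemma decomposition_ex: "\<exists>x y. v = L x + y *\<^sub>R \<nu>"
proof -
  define T where "T p = L (fst p) + snd p *\<^sub>R \<nu>" for p :: "(real^'m) \<times> real"
  have lin: "linear T"
    unfolding T_def
    by (intro linear_compose_add linear_compose[OF linear_fst linear_L, unfolded o_def]
        linear_compose[OF linear_snd linear_scaleR_left, unfolded o_def])
  have "inj T"
    by (rule inj_on_inverseI[where g = "\<lambda>v. (adjoint L v, v \<bullet> \<nu>)"])
      (simp add: T_def adjoint_L_decomposition inner_\<nu>_decomposition)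
  then have "dim (range T) = DIM(real^'n)"
    using dim_image_eq[OF lin, of UNIV] by (simp add: card inj_on_def)
  then have "span (range T) = UNIV"
    by (simp only: dim_eq_full)
  then have "range T = UNIV"
    using linear_subspace_image[OF lin subspace_UNIV] by (metis span_eq_iff)
  then obtain p where "v = T p"
    by blast
  then show ?thesis
    by (auto simp: T_def)
qed

lemma decomposition: "v = L (adjoint L v) + (v \<bullet> \<nu>) *\<^sub>R \<nu>"
  using decomposition_ex[of v] by (auto simp: adjoint_L_decomposition inner_\<nu>_decomposition)

lemma norm_decomposition: "norm v = norm (adjoint L v, v \<bullet> \<nu>)"
proof -
  have "(norm v)\<^sup>2 = (norm (adjoint L v))\<^sup>2 + (v \<bullet> \<nu>)\<^sup>2"
    by (subst decomposition)
      (simp add: norm_add_Pythagorean orthogonal_def L_\<nu> norm_L norm_\<nu>)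
  then show ?thesis
    by (simp add: norm_Pair real_sqrt_unique)
qed

lemma proj_diff: "snd (proj z) - snd (proj w) = adjoint L (snd z - snd w)"
  by (simp add: proj_def flip: linear_diff[OF adjoint_linear[OF linear_L]])

lemma height_diff: "height z - height w = (snd z - snd w) \<bullet> \<nu>"
  by (simp add: height_def flip: inner_diff_left)

lemma pdist_proj_le: "pdist (proj z) (proj w) \<le> pdist z w"
  using norm_fst_le[of "adjoint L (snd z - snd w)" "(snd z - snd w) \<bullet> \<nu>"]
  unfolding pdist_def proj_diff norm_decomposition[of "snd z - snd w"] by (simp add: proj_def)

lemma height_lip: "\<bar>height z - height w\<bar> \<le> pdist z w"
  using norm_snd_le[of "(snd z - snd w) \<bullet> \<nu>" "adjoint L (snd z - snd w)"]
  unfolding pdist_def height_diff norm_decomposition[of "snd z - snd w"]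
  by (simp add: add_increasing2)

lemma pdist_le_proj_height: "pdist z w \<le> pdist (proj z) (proj w) + \<bar>height z - height w\<bar>"
  using norm_Pair_le[of "adjoint L (snd z - snd w)" "(snd z - snd w) \<bullet> \<nu>"]
  unfolding pdist_def proj_diff height_diff norm_decomposition[of "snd z - snd w"]
  by (simp add: proj_def)

lemma proj_chart: "proj (chart q L \<nu> t x y) = (t, x)"
  using adjoint_L_decomposition[of x y] by (simp add: proj_def chart_def add.assoc)

lemma height_chart: "height (chart q L \<nu> t x y) = y"
  using inner_\<nu>_decomposition[of x y] by (simp add: height_def chart_def add.assoc)

lemma chart_proj_height: "chart q L \<nu> (fst (proj z)) (snd (proj z)) (height z) = z"
  using decomposition[of "snd z - q"]
  by (cases z) (simp add: chart_def proj_def height_def algebra_simps)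

lemma proj_lift [simp]: "proj (lift p y) = p" and height_lift [simp]: "height (lift p y) = y"
  by (simp_all add: lift_def proj_chart height_chart)

lemma pdist_lift_le: "pdist z (lift (proj z) y) \<le> \<bar>height z - y\<bar>"
  using pdist_le_proj_height[of z "lift (proj z) y"] by simp

lemma mem_graph_over_iff: "z \<in> graph_over q L \<nu> f \<longleftrightarrow> height z = f (proj z)"
proof
  show "z \<in> graph_over q L \<nu> f" if "height z = f (proj z)"
    unfolding graph_over_def mem_Collect_eq
    by (rule exI[of _ "fst (proj z)"], rule exI[of _ "snd (proj z)"])
      (simp add: chart_proj_height flip: that)
qed (auto simp: graph_over_def proj_chart height_chart)

lemma mem_graph_side_iff: "z \<in> graph_side q L \<nu> s f \<longleftrightarrow> s * height z > s * f (proj z)"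
proof
  show "z \<in> graph_side q L \<nu> s f" if "s * height z > s * f (proj z)"
    unfolding graph_side_def mem_Collect_eq
    by (rule exI[of _ "fst (proj z)"], rule exI[of _ "snd (proj z)"], rule exI[of _ "height z"])
      (simp add: chart_proj_height that)
qed (auto simp: graph_side_def proj_chart height_chart)

end

section \<open>Diameters of dyadic cubes\<close>

lemma sets_pH: "sets (pH :: 'n::finite stpt measure) = sets borel"
  using sets.sets_measure_of_eq[of "borel :: 'n stpt measure"] by (simp add: pH_def)

lemma ADR_radius_le:
  fixes E :: "'n::finite stpt set"
  assumes adr: "ADR C0 E" and z: "z \<in> E" and r: "0 < r" "ennreal r < pdiam E"
    and s: "0 < s" "ennreal s < pdiam E" and sub: "pball z r \<inter> E \<subseteq> pball z s"
  shows "r \<le> (max 1 C0)\<^sup>2 * s"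
proof -
  let ?C = "max 1 C0" and ?N = "CARD('n) + 1"
  have C0: "0 < C0" and E: "closed E"
    using adr by (auto simp: ADR_def)
  have "ennreal (r ^ ?N / C0) \<le> emeasure pH (pball z r \<inter> E)"
    using adr z r by (simp add: ADR_def)
  also have "\<dots> \<le> emeasure pH (pball z s \<inter> E)"
    using sub E by (intro emeasure_mono) (auto simp: sets_pH)
  also have "\<dots> \<le> ennreal (C0 * s ^ ?N)"
    using adr z s by (simp add: ADR_def)
  finally have "r ^ ?N / C0 \<le> C0 * s ^ ?N"
    using C0 s by (simp add: ennreal_le_iff)
  then have "r ^ ?N \<le> C0\<^sup>2 * s ^ ?N"
    using C0 by (simp add: pos_divide_le_eq power2_eq_square mult_ac)
  also have "\<dots> \<le> (?C\<^sup>2) ^ ?N * s ^ ?N"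
  proof (rule mult_right_mono)
    have "C0\<^sup>2 \<le> ?C\<^sup>2"
      using C0 by (intro power_mono) auto
    also have "\<dots> \<le> (?C\<^sup>2) ^ ?N"
      by (rule self_le_power) auto
    finally show "C0\<^sup>2 \<le> (?C\<^sup>2) ^ ?N" .
  qed (use s in auto)
  also have "\<dots> = (?C\<^sup>2 * s) ^ ?N"
    by (simp only: power_mult_distrib)
  finally show ?thesis
    using s by (intro power_le_imp_le_base[of r "CARD('n)"]) auto
qed

lemma ADR_ball_radius_le_rdiam:
  fixes E :: "'n::finite stpt set"
  assumes adr: "ADR C0 E" and z: "z \<in> E" and r: "0 < r" and sub: "E \<inter> pball z r \<subseteq> Q"
    and Q: "pdiam Q < \<infinity>" "0 < rdiam Q" and "\<not> E \<subseteq> Q"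
  shows "r \<le> 4 * (max 1 C0)\<^sup>2 * rdiam Q"
proof -
  let ?C = "max 1 C0"
  obtain w where w: "w \<in> E" "w \<notin> Q"
    using \<open>\<not> E \<subseteq> Q\<close> by blast
  then have "r \<le> pdist z w"
    using sub by (force simp: pball_def)
  then have "ennreal (r / 2) < ennreal (pdist z w)"
    using r by (intro ennreal_lessI) auto
  then have half: "ennreal (r / 2) < pdiam E"
    using pdist_le_pdiam[OF z w(1)] by (rule less_le_trans)
  have zQ: "z \<in> Q"
    using z sub r by (auto simp: pball_def)
  have "r / 2 \<le> ?C\<^sup>2 * (2 * rdiam Q)"
  proof (cases "ennreal (2 * rdiam Q) < pdiam E")
    case True
    have "pball z (r / 2) \<inter> E \<subseteq> Q"
      using sub r by (auto simp: pball_def)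
    then have "pball z (r / 2) \<inter> E \<subseteq> pball z (2 * rdiam Q)"
      using subset_pball_rdiam[OF Q zQ] by (rule order_trans)
    then show ?thesis
      using r Q(2) half True by (intro ADR_radius_le[OF adr z]) auto
  next
    case False
    then have "ennreal (r / 2) < ennreal (2 * rdiam Q)"
      using half by simp
    then have "r / 2 \<le> 1 * (2 * rdiam Q)"
      using r by (simp add: ennreal_less_iff)
    also have "\<dots> \<le> ?C\<^sup>2 * (2 * rdiam Q)"
      using Q(2) by (intro mult_right_mono) auto
    finally show ?thesis .
  qed
  then show ?thesis
    by simp
qed

definition parent_ratio :: "real \<Rightarrow> real \<Rightarrow> real \<Rightarrow> real" where
  "parent_ratio C0 a0 cs = max 1 (8 * cs * (max 1 C0)\<^sup>2 / a0)"

lemma parent_ratio_ge_1: "1 \<le> parent_ratio C0 a0 cs"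
  by (simp add: parent_ratio_def)

lemma top_cube_is_top: "coherent D S \<Longrightarrow> is_top S (top_cube S)"
  unfolding coherent_def top_cube_def by (elim conjE) (rule theI')

lemma top_cube_mem: "coherent D S \<Longrightarrow> top_cube S \<in> S"
  by (drule top_cube_is_top) (simp add: is_top_def)

lemma subset_top_cube: "coherent D S \<Longrightarrow> Q \<in> S \<Longrightarrow> Q \<subseteq> top_cube S"
  by (drule top_cube_is_top) (simp add: is_top_def)

lemma coherent_upward:
  assumes "coherent D S" "Q \<in> S" "Q' \<in> cubes D" "Q \<subseteq> Q'" "Q' \<subseteq> top_cube S"
  shows "Q' \<in> S"
proof -
  have "\<forall>Q\<in>S. \<forall>Q'\<in>cubes D. Q \<subseteq> Q' \<and> Q' \<subseteq> top_cube S \<longrightarrow> Q' \<in> S"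
    using assms(1) unfolding coherent_def by (elim conjE)
  then show ?thesis
    using assms(2-5) by blast
qed

context
  fixes E :: "'n::finite stpt set" and a0 \<gamma> cs :: real and D :: "int \<Rightarrow> 'n cube set"
  assumes D: "dyadic_system E a0 \<gamma> cs D"
begin

lemma dyadic_subset: "Q \<in> D k \<Longrightarrow> Q \<subseteq> E"
proof -
  have "\<forall>k. countable (D k) \<and> (\<forall>Q\<in>D k. Q \<in> sets borel \<and> Q \<subseteq> E)"
    using D unfolding dyadic_system_def by (elim conjE)
  then show "Q \<in> D k \<Longrightarrow> Q \<subseteq> E"
    by blast
qed

lemma dyadic_nested: "k \<le> m \<Longrightarrow> Q \<in> D m \<Longrightarrow> Q' \<in> D k \<Longrightarrow> Q \<subseteq> Q' \<or> Q \<inter> Q' = {}"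
proof -
  have "\<forall>k m. k \<le> m \<longrightarrow> (\<forall>Q\<in>D m. \<forall>Q'\<in>D k. Q \<subseteq> Q' \<or> Q \<inter> Q' = {})"
    using D unfolding dyadic_system_def by (elim conjE)
  then show "k \<le> m \<Longrightarrow> Q \<in> D m \<Longrightarrow> Q' \<in> D k \<Longrightarrow> Q \<subseteq> Q' \<or> Q \<inter> Q' = {}"
    by blast
qed

lemma dyadic_ancestor: "m < k \<Longrightarrow> Q \<in> D k \<Longrightarrow> \<exists>Q'\<in>D m. Q \<subseteq> Q'"
proof -
  have "\<forall>k m. m < k \<longrightarrow> (\<forall>Q\<in>D k. \<exists>!Q'. Q' \<in> D m \<and> Q \<subseteq> Q')"
    using D unfolding dyadic_system_def by (elim conjE)
  then show "m < k \<Longrightarrow> Q \<in> D k \<Longrightarrow> \<exists>Q'\<in>D m. Q \<subseteq> Q'"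
    by (meson ex1_implies_ex)
qed

lemma dyadic_pdiam_le: "Q \<in> D k \<Longrightarrow> pdiam Q \<le> ennreal (cs * 2 powr (- real_of_int k))"
proof -
  have "\<forall>k. \<forall>Q\<in>D k. pdiam Q \<le> ennreal (cs * 2 powr (- real_of_int k))"
    using D unfolding dyadic_system_def by (elim conjE)
  then show "Q \<in> D k \<Longrightarrow> pdiam Q \<le> ennreal (cs * 2 powr (- real_of_int k))"
    by blast
qed

lemma dyadic_ball: "Q \<in> D k \<Longrightarrow> \<exists>z\<in>E. E \<inter> pball z (a0 * 2 powr (- real_of_int k)) \<subseteq> Q"
proof -
  have "\<forall>k. \<forall>Q\<in>D k. \<exists>z\<in>E. E \<inter> pball z (a0 * 2 powr (- real_of_int k)) \<subseteq> Q"
    using D unfolding dyadic_system_def by (elim conjE)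
  then show "Q \<in> D k \<Longrightarrow> \<exists>z\<in>E. E \<inter> pball z (a0 * 2 powr (- real_of_int k)) \<subseteq> Q"
    by blast
qed

lemma dyadic_pdiam_finite:
  assumes "Q \<in> D k"
  shows "pdiam Q < \<infinity>"
  using dyadic_pdiam_le[OF assms] by (rule le_less_trans) simp

lemma dyadic_const_pos:
  assumes "Q \<in> D k" "0 < rdiam Q"
  shows "0 < cs"
proof (rule ccontr)
  assume "\<not> 0 < cs"
  then have "cs * 2 powr (- real_of_int k) \<le> 0"
    by (simp add: mult_nonpos_nonneg)
  then have "pdiam Q = 0"
    using dyadic_pdiam_le[OF assms(1)] by (simp add: ennreal_neg)
  then show False
    using assms(2) by (simp add: rdiam_def)
qed

lemma dyadic_parent_rdiam_le:
  assumes adr: "ADR C0 E" and a0: "0 < a0"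
    and Q: "Q \<in> D k" and Q': "Q' \<in> D (k - 1)" and sub: "Q \<subseteq> Q'" and pos: "0 < rdiam Q"
  shows "rdiam Q' \<le> parent_ratio C0 a0 cs * rdiam Q"
proof (cases "E \<subseteq> Q")
  case True
  then have "Q' = Q"
    using sub dyadic_subset[OF Q'] by blast
  then show ?thesis
    using mult_right_mono[OF parent_ratio_ge_1[of C0 a0 cs], of "rdiam Q"] pos by simp
next
  case False
  let ?C = "max 1 C0"
  define r where "r = a0 * 2 powr (- real_of_int k)"
  have "0 < r"
    using a0 by (simp add: r_def)
  obtain z where z: "z \<in> E" "E \<inter> pball z r \<subseteq> Q"
    using dyadic_ball[OF Q] unfolding r_def by blast
  have r_le: "r \<le> 4 * ?C\<^sup>2 * rdiam Q"
    by (rule ADR_ball_radius_le_rdiam[OF adr z(1) \<open>0 < r\<close> z(2) dyadic_pdiam_finite[OF Q] pos False])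
  note cs = dyadic_const_pos[OF Q pos]
  have "rdiam Q' \<le> cs * 2 powr (- real_of_int (k - 1))"
    unfolding rdiam_def using cs dyadic_pdiam_le[OF Q'] by (intro enn2real_leI) auto
  also have "2 powr (- real_of_int (k - 1)) = 2 * (r / a0)"
    using a0 powr_add[of 2 "- real_of_int k" 1] by (simp add: r_def)
  also have "cs * (2 * (r / a0)) = 2 * cs / a0 * r"
    by simp
  also have "\<dots> \<le> 2 * cs / a0 * (4 * ?C\<^sup>2 * rdiam Q)"
    using cs a0 r_le by (intro mult_left_mono) auto
  also have "\<dots> = 8 * cs * ?C\<^sup>2 / a0 * rdiam Q"
    by simp
  also have "\<dots> \<le> parent_ratio C0 a0 cs * rdiam Q"
    unfolding parent_ratio_def using pos by (intro mult_right_mono) auto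
  finally show ?thesis .
qed

lemma coherent_parent_ex:
  assumes S: "coherent D S" and Q: "Q \<in> S" "Q \<in> D k" "Q \<noteq> {}" and top: "top_cube S \<in> D m" "m < k"
  shows "\<exists>R\<in>S. R \<in> D (k - 1) \<and> Q \<subseteq> R"
proof -
  obtain R where R: "R \<in> D (k - 1)" "Q \<subseteq> R"
    using dyadic_ancestor[OF _ Q(2), of "k - 1"] by auto
  have "m \<le> k - 1"
    using top(2) by simp
  from dyadic_nested[OF this R(1) top(1)] have "R \<subseteq> top_cube S"
    using R(2) subset_top_cube[OF S Q(1)] Q(3) by blast
  moreover have "R \<in> cubes D"
    using R(1) by (auto simp: cubes_def)
  ultimately have "R \<in> S"
    using coherent_upward[OF S Q(1)] R(2) by blast
  then show ?thesis
    using R by blast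
qed

lemma coherent_top_unique:
  assumes S: "coherent D S" and Q: "Q \<in> S" "Q \<in> D k" and top: "top_cube S \<in> D m" "k \<le> m"
    and "Q \<noteq> {}"
  shows "Q = top_cube S"
proof -
  have sub: "Q \<subseteq> top_cube S"
    by (rule subset_top_cube[OF S Q(1)])
  then have "top_cube S \<subseteq> Q"
    using dyadic_nested[OF top(2,1) Q(2)] \<open>Q \<noteq> {}\<close> by blast
  with sub show ?thesis ..
qed

lemma coherent_ancestor_generation:
  assumes adr: "ADR C0 E" and a0: "0 < a0"
    and S: "coherent D S" and pos: "\<And>Q. Q \<in> S \<Longrightarrow> 0 < rdiam Q"
    and l: "l \<le> rdiam (top_cube S)" and top: "top_cube S \<in> D m"
  shows "Q \<in> S \<Longrightarrow> Q \<in> D k \<Longrightarrow> nat (k - m) = n \<Longrightarrow>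
    \<exists>Q'\<in>S. Q \<subseteq> Q' \<and> l \<le> rdiam Q' \<and> rdiam Q' \<le> max (rdiam Q) (parent_ratio C0 a0 cs * l)"
proof (induction n arbitrary: k Q)
  case 0
  have "Q \<noteq> {}"
    using pos[OF 0(1)] by (auto simp: rdiam_def pdiam_def bot_ennreal)
  then have "Q = top_cube S"
    using 0 by (intro coherent_top_unique[OF S _ _ top]) auto
  then show ?case
    using 0 l by auto
next
  case (Suc n)
  show ?case
  proof (cases "l \<le> rdiam Q")
    case True
    then show ?thesis
      using Suc.prems(1) by (intro bexI[of _ Q]) auto
  next
    case False
    have "Q \<noteq> {}"
      using pos[OF Suc.prems(1)] by (auto simp: rdiam_def pdiam_def bot_ennreal)
    moreover have "m < k"
      using Suc.prems(3) by linarith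
    ultimately obtain R where R: "R \<in> S" "R \<in> D (k - 1)" "Q \<subseteq> R"
      using coherent_parent_ex[OF S Suc.prems(1,2) _ top] by blast
    have "nat (k - 1 - m) = n"
      using Suc.prems(3) by linarith
    from Suc.IH[OF R(1,2) this] obtain Q' where Q': "Q' \<in> S" "R \<subseteq> Q'" "l \<le> rdiam Q'"
      "rdiam Q' \<le> max (rdiam R) (parent_ratio C0 a0 cs * l)"
      by blast
    have "rdiam R \<le> parent_ratio C0 a0 cs * rdiam Q"
      by (rule dyadic_parent_rdiam_le[OF adr a0 Suc.prems(2) R(2,3) pos[OF Suc.prems(1)]])
    also have "\<dots> \<le> parent_ratio C0 a0 cs * l"
      using False parent_ratio_ge_1[of C0 a0 cs] by (intro mult_left_mono) auto
    finally show ?thesis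
      using Q' R(3) by (intro bexI[of _ Q']) auto
  qed
qed

lemma coherent_ancestor:
  assumes "ADR C0 E" "0 < a0" and S: "coherent D S" and "\<And>Q. Q \<in> S \<Longrightarrow> 0 < rdiam Q"
    and Q: "Q \<in> S" and "l \<le> rdiam (top_cube S)"
  shows "\<exists>Q'\<in>S. Q \<subseteq> Q' \<and> l \<le> rdiam Q' \<and> rdiam Q' \<le> max (rdiam Q) (parent_ratio C0 a0 cs * l)"
proof -
  have "S \<subseteq> cubes D"
    using S by (simp add: coherent_def)
  then have "top_cube S \<in> (\<Union>k. D k)" "Q \<in> (\<Union>k. D k)"
    using top_cube_mem[OF S] Q unfolding cubes_def by blast+
  then obtain m k where "top_cube S \<in> D m" "Q \<in> D k"
    by blast
  then show ?thesis
    using coherent_ancestor_generation[OF assms(1-4,6)] Q by blast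
qed

end

lemma is_center_mem:
  assumes "is_center E Cc Q z" "0 < Cc" "0 < rdiam Q"
  shows "z \<in> Q"
proof -
  obtain r where r: "rdiam Q / Cc \<le> r" "E \<inter> pball z r \<subseteq> Q" and z: "z \<in> E"
    using assms(1) by (auto simp: is_center_def)
  have "0 < rdiam Q / Cc"
    using assms by simp
  then have "0 < r"
    using r(1) by linarith
  then show ?thesis
    using r(2) z by (auto simp: pball_def)
qed

section \<open>Whitney cubes\<close>

lemma connected_pcube: "connected (pcube z l)"
proof -
  have "pcube z l = {fst z - l\<^sup>2 / 2..fst z + l\<^sup>2 / 2} \<times>
      cbox (\<chi> i. snd z $ i - l / 2) (\<chi> i. snd z $ i + l / 2)"
    unfolding pcube_def abs_diff_le_iff by (auto simp: mem_box_cart)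
  then show ?thesis
    by (simp add: convex_connected convex_Times)
qed

lemma pdiam_pcube_pos:
  assumes "0 < l"
  shows "0 < pdiam (pcube z l)"
proof -
  let ?w = "(fst z + l\<^sup>2 / 2, snd z)"
  have "0 < ennreal (pdist z ?w)"
    using assms by (simp add: pdist_def)
  also have "\<dots> \<le> pdiam (pcube z l)"
    using assms by (intro pdist_le_pdiam) (auto simp: pcube_def)
  finally show ?thesis .
qed

lemma whitney_cubeE:
  fixes E :: "'n::finite stpt set"
  assumes W: "whitney E W" "I \<in> W" and ne: "E \<noteq> {}"
  obtains l where "0 < l" "pdist_set I E = ennreal l"
    "\<And>z z'. z \<in> I \<Longrightarrow> z' \<in> I \<Longrightarrow> pdist z z' \<le> l / 4" "connected I" "I \<noteq> {}"
proof -
  obtain z r where I: "dyadic_params z r" "I = pcube z r"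
    and le: "4 * pdiam I \<le> pdist_set (pcube z (4 * r)) E"
        "pdist_set (pcube z (4 * r)) E \<le> pdist_set I E"
    using W unfolding whitney_def by meson
  have r: "0 < r"
    using I(1) by (auto simp: dyadic_params_def)
  then have I_ne: "I \<noteq> {}"
    using I(2) by (auto simp: pcube_def intro!: exI[of _ "fst z"] exI[of _ "snd z"])
  define l where "l = enn2real (pdist_set I E)"
  have l: "pdist_set I E = ennreal l" "0 \<le> l"
    using pdist_set_finite[OF I_ne ne] by (simp_all add: l_def)
  have diam: "4 * pdiam I \<le> ennreal l"
    using order_trans[OF le] by (simp add: l)
  have "pdist x y \<le> l / 4" if "x \<in> I" "y \<in> I" for x y
  proof -
    have "4 * ennreal (pdist x y) \<le> 4 * pdiam I"
      by (intro mult_left_mono pdist_le_pdiam that) auto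
    also note diam
    finally have "ennreal (4 * pdist x y) \<le> ennreal l"
      by (simp add: ennreal_mult)
    then show ?thesis
      using l(2) by (simp add: ennreal_le_iff)
  qed
  moreover have "0 < l"
  proof -
    have "0 < 4 * pdiam I"
      using pdiam_pcube_pos[OF r] by (simp add: I(2) ennreal_zero_less_mult_iff)
    then show ?thesis
      using diam less_le_trans by fastforce
  qed
  ultimately show ?thesis
    using l(1) I_ne connected_pcube[of z r] by (intro that[of l]) (auto simp: I(2))
qed

lemma whitney_near_far:
  assumes "I \<in> whitney_near E W a b Q" "z \<in> I" "e \<in> E"
  shows "a * rdiam Q \<le> pdist z e"
proof -
  have "ennreal (a * rdiam Q) \<le> pdist_set I E"
    using assms(1) by (simp add: whitney_near_def)
  also have "\<dots> \<le> ennreal (pdist z e)"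
    by (rule pdist_set_le[OF assms(2,3)])
  finally show ?thesis
    by (simp add: ennreal_le_iff)
qed

lemma whitney_near_close:
  fixes E :: "'n::finite stpt set"
  assumes W: "whitney E W" and I: "I \<in> whitney_near E W a b Q" "z \<in> I"
    and Q: "Q \<subseteq> E" "0 < rdiam Q" and b: "0 < b"
  shows "\<exists>w\<in>Q. pdist z w \<le> 3 * b * rdiam Q"
proof -
  have IW: "I \<in> W" "pdist_set I E \<le> pdist_set I Q" "pdist_set I Q \<le> ennreal (b * rdiam Q)"
    using I(1) by (auto simp: whitney_near_def)
  have bQ: "0 < b * rdiam Q"
    using b Q by simp
  have "pdist_set I Q < ennreal (2 * (b * rdiam Q))"
    using bQ by (intro le_less_trans[OF IW(3)] ennreal_lessI) auto
  then obtain z' w where w: "z' \<in> I" "w \<in> Q" "pdist z' w < 2 * (b * rdiam Q)"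
    by (rule pdist_set_lessE)
  have "E \<noteq> {}"
    using w Q by auto
  then obtain l where l: "pdist_set I E = ennreal l" "pdist z z' \<le> l / 4"
    using whitney_cubeE[OF W IW(1)] I(2) w(1) by metis
  have "l \<le> b * rdiam Q"
    using order_trans[OF IW(2,3)] l(1) bQ by (simp add: ennreal_le_iff)
  then have "pdist z w \<le> 3 * (b * rdiam Q)"
    using pdist_triangle[of z w z'] l(2) w(3) bQ by linarith
  then show ?thesis
    using w(2) by (auto simp: mult.assoc)
qed

section \<open>Thresholds\<close>

definition corona_threshold :: "nat \<Rightarrow> real \<Rightarrow> real \<Rightarrow> real \<Rightarrow> real" where
  "corona_threshold d C0 a0 cs = (1 / (100 * parent_ratio C0 a0 cs * half_deriv_bmo_const d)) ^ 16"

definition ball_threshold :: "real \<Rightarrow> real" where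
  "ball_threshold M0 = (1 / (2 * (\<bar>M0\<bar> + 1))) ^ 16"

lemma corona_threshold_pos: "0 < corona_threshold d C0 a0 cs"
  using parent_ratio_ge_1[of C0 a0 cs] half_deriv_bmo_const_pos[of d]
  by (simp add: corona_threshold_def)

lemma ball_threshold_pos: "0 < ball_threshold M0"
  by (simp add: ball_threshold_def add_nonneg_pos)

lemma below_corona_threshold:
  assumes "0 < \<eta>" "\<eta> < corona_threshold d C0 a0 cs"
  shows "\<eta> powr (1/16) \<le> 1 / 100" "parent_ratio C0 a0 cs * \<eta> powr (1/16) \<le> 1 / 100"
    "\<eta> powr (1/16) * half_deriv_bmo_const d \<le> 1"
proof -
  define \<theta> R B where "\<theta> = \<eta> powr (1/16)" and "R = parent_ratio C0 a0 cs"
      and "B = half_deriv_bmo_const d"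
  have \<theta>: "0 < \<theta>"
    using assms(1) by (simp add: \<theta>_def)
  have R: "1 \<le> R" and B: "1 \<le> B"
    using parent_ratio_ge_1 by (simp_all add: R_def B_def half_deriv_bmo_const_def add_increasing)
  have "\<theta> < 1 / (100 * R * B)"
    using root_16_less[OF assms(1) _ assms(2)[unfolded corona_threshold_def]] R B
    by (simp add: \<theta>_def R_def B_def)
  then have small: "\<theta> * R * B \<le> 1 / 100"
    using R B by (simp add: field_simps)
  have "\<theta> * R * 1 \<le> \<theta> * R * B" "\<theta> * 1 * B \<le> \<theta> * R * B" "\<theta> * 1 * 1 \<le> \<theta> * R * B"
    using \<theta> R B by (intro mult_mono; simp)+
  with small show "\<eta> powr (1/16) \<le> 1 / 100" "parent_ratio C0 a0 cs * \<eta> powr (1/16) \<le> 1 / 100"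
    "\<eta> powr (1/16) * half_deriv_bmo_const d \<le> 1"
    unfolding \<theta>_def[symmetric] R_def[symmetric] B_def[symmetric] by (simp_all add: mult.commute)
qed

lemma below_ball_threshold:
  assumes "0 < \<eta>" "\<eta> < ball_threshold M0"
  shows "M0 * (\<eta> powr (1/16))\<^sup>2 \<le> 1 / 2"
proof -
  define \<theta> where "\<theta> = \<eta> powr (1/16)"
  have "0 < \<theta>"
    using assms(1) by (simp add: \<theta>_def)
  have "\<theta> < 1 / (2 * (\<bar>M0\<bar> + 1))"
    unfolding \<theta>_def using assms by (intro root_16_less) (auto simp: ball_threshold_def)
  then have less: "2 * (\<bar>M0\<bar> * \<theta>) + 2 * \<theta> < 1"
    by (simp add: pos_less_divide_eq add_nonneg_pos algebra_simps)
  then have "\<theta> \<le> 1"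
    using \<open>0 < \<theta>\<close> mult_nonneg_nonneg[of "\<bar>M0\<bar>" \<theta>] by linarith
  have "M0 * \<theta>\<^sup>2 \<le> \<bar>M0\<bar> * \<theta> * \<theta>"
    using \<open>0 < \<theta>\<close> by (simp add: power2_eq_square mult_right_mono)
  also have "\<dots> \<le> \<bar>M0\<bar> * \<theta> * 1"
    using \<open>0 < \<theta>\<close> \<open>\<theta> \<le> 1\<close> by (intro mult_left_mono) auto
  finally show ?thesis
    using less \<open>0 < \<theta>\<close> unfolding \<theta>_def by linarith
qed

section \<open>The set and the shifted graphs\<close>

text \<open>The exponents of \<open>\<eta>\<close> are multiples of \<open>1/16\<close>, so all powers of \<open>\<eta>\<close> are
  integral powers of \<open>\<theta> = \<eta>^(1/16)\<close>.\<close>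

locale corona_regime = plane_chart P q L \<nu>
  for P :: "'n::finite stpt set" and q and L :: "real^'m::finite \<Rightarrow> real^'n" and \<nu> +
  fixes E :: "'n stpt set" and S :: "'n cube set" and ctr :: "'n cube \<Rightarrow> 'n stpt" and QS :: "'n cube"
    and \<eta> C :: real and \<psi> :: "'m stpt \<Rightarrow> real"
  assumes \<eta>_pos: "0 < \<eta>" and \<theta>_le: "\<eta> powr (1/16) \<le> 1 / 100"
    and C: "0 \<le> C" "C * \<eta> powr (1/16) \<le> 1 / 100"
    and top: "QS \<in> S" "\<And>Q. Q \<in> S \<Longrightarrow> Q \<subseteq> QS"
    and cube: "\<And>Q. Q \<in> S \<Longrightarrow> Q \<subseteq> E" "\<And>Q. Q \<in> S \<Longrightarrow> pdiam Q < \<infinity>" "\<And>Q. Q \<in> S \<Longrightarrow> 0 < rdiam Q"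
      "\<And>Q. Q \<in> S \<Longrightarrow> ctr Q \<in> Q"
    and lip: "lip_half_one \<eta> \<psi>"
    and near_graph: "\<And>Q e. Q \<in> S \<Longrightarrow> e \<in> dilate_cube E (1 / \<eta>) Q \<Longrightarrow>
        pdist_pt e (graph_over q L \<nu> \<psi>) < ennreal (\<eta> * rdiam Q)"
    and near_E: "\<And>Q p. Q \<in> S \<Longrightarrow> p \<in> pball (ctr Q) (1 / \<eta> * rdiam Q) \<inter> graph_over q L \<nu> \<psi> \<Longrightarrow>
        pdist_pt p E < ennreal (\<eta> * rdiam Q)"
    and ancestor: "\<And>Q l. Q \<in> S \<Longrightarrow> l \<le> rdiam QS \<Longrightarrow>
        \<exists>Q'\<in>S. Q \<subseteq> Q' \<and> l \<le> rdiam Q' \<and> rdiam Q' \<le> max (rdiam Q) (C * l)"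
begin

definition \<theta> :: real where "\<theta> = \<eta> powr (1/16)"
definition \<kappa> :: real where "\<kappa> = \<theta> ^ 15"
definition K :: real where "K = 1 / \<eta>"

abbreviation dS :: real where "dS \<equiv> rdiam QS"
abbreviation zS :: "'n stpt" where "zS \<equiv> ctr QS"

definition scale :: "'m stpt \<Rightarrow> real" where
  "scale = reg_dist dS {(rdiam Q, proj w) | Q w. Q \<in> S \<and> w \<in> Q}"

definition elevation :: "'n stpt \<Rightarrow> real" where
  "elevation z = height z - \<psi> (proj z)"

definition shifted :: "real \<Rightarrow> 'm stpt \<Rightarrow> real" where
  "shifted s p = \<psi> p + s * \<kappa> * scale p"

lemma \<theta>_pos: "0 < \<theta>"
  using \<eta>_pos by (simp add: \<theta>_def)

lemma \<eta>_powr: "\<eta> powr (real k / 16) = \<theta> ^ k"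
  using \<eta>_pos by (simp add: \<theta>_def powr_powr flip: powr_realpow)

lemma inverse_\<eta>_powr: "(1 / \<eta>) powr (real k / 16) = 1 / \<theta> ^ k"
  using \<eta>_pos by (simp add: powr_divide \<eta>_powr)

lemma \<eta>_eq: "\<eta> = \<theta> ^ 16"
  using \<eta>_powr[of 16] \<eta>_pos by simp

lemma powr_eqs:
  "\<eta> powr (1/4) = \<theta> ^ 4" "\<eta> powr (1/2) = \<theta> ^ 8" "\<eta> powr (15/16) = \<kappa>"
  "(1 / \<eta>) powr (1/4) = 1 / \<theta> ^ 4" "(1 / \<eta>) powr (3/4) = 1 / \<theta> ^ 12"
      "(1 / \<eta>) powr (7/8) = 1 / \<theta> ^ 14"
  using \<eta>_powr[of 4] \<eta>_powr[of 8] \<eta>_powr[of 15]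
    inverse_\<eta>_powr[of 4] inverse_\<eta>_powr[of 12] inverse_\<eta>_powr[of 14]
  by (simp_all add: \<kappa>_def)

lemma power_\<theta>_le:
  assumes "i < j"
  shows "\<theta> ^ j \<le> \<theta> ^ i / 100"
proof -
  have small: "\<theta> \<le> 1 / 100"
    using \<theta>_le by (simp only: \<theta>_def)
  then have "\<theta> ^ (j - i) \<le> \<theta> ^ 1"
    using assms \<theta>_pos by (intro power_decreasing) auto
  then have "\<theta> ^ (j - i) \<le> 1 / 100"
    using small by simp
  then have "\<theta> ^ i * \<theta> ^ (j - i) \<le> \<theta> ^ i * (1 / 100)"
    using \<theta>_pos by (intro mult_left_mono) auto
  then show ?thesis
    using assms by (simp flip: power_add)
qed

lemma inverse_power_\<theta>_le:
  assumes "i < j"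
  shows "1 / \<theta> ^ i \<le> 1 / \<theta> ^ j / 100"
proof -
  have "\<theta> ^ j * (1 / \<theta> ^ i / \<theta> ^ j) \<le> \<theta> ^ i / 100 * (1 / \<theta> ^ i / \<theta> ^ j)"
    using power_\<theta>_le[OF assms] \<theta>_pos by (intro mult_right_mono) auto
  then show ?thesis
    using \<theta>_pos by simp
qed

lemma \<kappa>_pos: "0 < \<kappa>"
  using \<theta>_pos by (simp add: \<kappa>_def)

lemma \<kappa>_le: "\<kappa> \<le> 1 / 100"
  using power_\<theta>_le[of 0 15] by (simp add: \<kappa>_def)

lemma \<eta>_le_\<kappa>: "\<eta> \<le> \<kappa> / 100"
  using power_\<theta>_le[of 15 16] by (simp add: \<kappa>_def flip: \<eta>_eq)

lemma \<eta>_le: "\<eta> \<le> 1 / 100"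
  using \<eta>_le_\<kappa> \<kappa>_le by linarith

lemma C_\<eta>_le: "C * \<eta> \<le> 1 / 100"
proof -
  have "\<eta> \<le> \<theta>"
    using power_\<theta>_le[of 1 16] \<theta>_pos by (simp flip: \<eta>_eq)
  then have "C * \<eta> \<le> C * \<theta>"
    using C(1) by (rule mult_left_mono)
  then show ?thesis
    using C(2) by (simp add: \<theta>_def)
qed

lemma \<eta>_mult_le: "0 \<le> x \<Longrightarrow> \<eta> * x \<le> x / 100"
  using mult_right_mono[OF \<eta>_le, of x] by simp

lemma K_eq: "K = 1 / \<theta> ^ 16"
  by (simp add: K_def flip: \<eta>_eq)

lemma K_ge: "100 \<le> K"
  using inverse_power_\<theta>_le[of 0 16] by (simp add: K_eq)

lemma dS_pos: "0 < dS"
  by (rule cube(3)[OF top(1)])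

lemma dS_le_K_dS: "100 * dS \<le> K * dS"
  using K_ge dS_pos by (intro mult_right_mono) auto

lemma zS_mem: "zS \<in> QS"
  by (rule cube(4)[OF top(1)])

lemma zS_E: "zS \<in> E"
  using zS_mem cube(1)[OF top(1)] by blast

lemma pdist_cube_le: "Q \<in> S \<Longrightarrow> z \<in> Q \<Longrightarrow> w \<in> Q \<Longrightarrow> pdist z w \<le> rdiam Q"
  by (rule pdist_le_rdiam[OF cube(2)])

lemma pdist_zS_le: "Q \<in> S \<Longrightarrow> w \<in> Q \<Longrightarrow> pdist zS w \<le> dS"
  using top(2) by (intro pdist_cube_le[OF top(1) zS_mem]) blast

lemma scale_nonneg: "0 \<le> scale p"
  unfolding scale_def using dS_pos by (intro reg_dist_nonneg) auto

lemma \<kappa>_scale_nonneg: "0 \<le> \<kappa> * scale p"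
  using \<kappa>_pos scale_nonneg by simp

lemma scale_le_dS: "scale p \<le> dS"
  unfolding scale_def using dS_pos by (intro reg_dist_le_cap) auto

lemma scale_lip: "\<bar>scale (proj z) - scale (proj w)\<bar> \<le> pdist z w"
proof -
  have "scale p \<le> scale p' + pdist p p'" for p p'
    unfolding scale_def using dS_pos by (intro reg_dist_lip_le) auto
  from this[of "proj z" "proj w"] this[of "proj w" "proj z"] show ?thesis
    using pdist_proj_le[of z w] pdist_commute[of "proj z" "proj w"] by linarith
qed

lemma scale_le:
  assumes "Q \<in> S" "w \<in> Q"
  shows "scale (proj z) \<le> rdiam Q + pdist z w"
proof -
  have "(rdiam Q, proj w) \<in> {(rdiam Q, proj w) | Q w. Q \<in> S \<and> w \<in> Q}"
    using assms by blast
  then have "scale (proj z) \<le> rdiam Q + pdist (proj z) (proj w)"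
    unfolding scale_def using dS_pos cube(3)[OF assms(1)] by (intro reg_dist_le) auto
  then show ?thesis
    using pdist_proj_le[of z w] by linarith
qed

lemma scale_nearE:
  assumes "scale p < \<epsilon>"
  obtains "dS < \<epsilon>" | Q w where "Q \<in> S" "w \<in> Q" "rdiam Q < \<epsilon>" "pdist p (proj w) < 2 * \<epsilon>"
  using less_imp_le[OF dS_pos] assms unfolding scale_def
  by (cases rule: reg_dist_nearE) (auto intro: that)

lemma elevation_lip: "\<bar>elevation z - elevation w\<bar> \<le> 2 * pdist z w"
proof -
  have "\<bar>\<psi> (proj z) - \<psi> (proj w)\<bar> \<le> \<eta> * pdist (proj z) (proj w)"
    by (rule lip_half_oneD[OF lip])
  also have "\<dots> \<le> 1 * pdist z w"
    using \<eta>_le \<eta>_pos by (intro mult_mono pdist_proj_le) auto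
  finally show ?thesis
    unfolding elevation_def using height_lip[of z w] by linarith
qed

lemma pdist_le_elevation: "pdist z w \<le> 2 * pdist (proj z) (proj w) + \<bar>elevation z\<bar> + \<bar>elevation w\<bar>"
proof -
  have "\<bar>\<psi> (proj z) - \<psi> (proj w)\<bar> \<le> \<eta> * pdist (proj z) (proj w)"
    by (rule lip_half_oneD[OF lip])
  then show ?thesis
    using pdist_le_proj_height[of z w] \<eta>_mult_le[of "pdist (proj z) (proj w)"]
        pdist_nonneg[of "proj z" "proj w"]
    unfolding elevation_def by linarith
qed

lemma mem_graph_iff: "z \<in> graph_over q L \<nu> \<psi> \<longleftrightarrow> elevation z = 0"
  by (simp add: mem_graph_over_iff elevation_def)

lemma mem_shifted_graph_iff:
  "z \<in> graph_over q L \<nu> (shifted s) \<longleftrightarrow> elevation z = s * (\<kappa> * scale (proj z))"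
  by (auto simp: mem_graph_over_iff elevation_def shifted_def)

lemma mem_shifted_side_iff:
  "s \<in> {1, -1} \<Longrightarrow> z \<in> graph_side q L \<nu> s (shifted s) \<longleftrightarrow> \<kappa> * scale (proj z) < s * elevation z"
  by (auto simp: mem_graph_side_iff elevation_def shifted_def)

lemma pdist_shifted_graph_le:
  assumes "s \<in> {1, -1}"
  obtains p where "p \<in> graph_over q L \<nu> (shifted s)"
      "pdist z p \<le> \<bar>elevation z\<bar> + \<kappa> * scale (proj z)"
proof
  let ?p = "lift (proj z) (shifted s (proj z))"
  show "?p \<in> graph_over q L \<nu> (shifted s)"
    by (simp add: mem_graph_over_iff)
  have "pdist z ?p \<le> \<bar>elevation z - s * (\<kappa> * scale (proj z))\<bar>"
    using pdist_lift_le[of z "shifted s (proj z)"]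
    by (simp add: elevation_def shifted_def algebra_simps)
  also have "\<dots> \<le> \<bar>elevation z\<bar> + \<kappa> * scale (proj z)"
    using assms \<kappa>_scale_nonneg[of "proj z"] by auto
  finally show "pdist z ?p \<le> \<bar>elevation z\<bar> + \<kappa> * scale (proj z)" .
qed

lemma half_K_less:
  assumes "Q \<in> S" "d \<le> K / 2 * rdiam Q"
  shows "d < (K - 1) * rdiam Q"
proof -
  have "K / 2 * rdiam Q < (K - 1) * rdiam Q"
    using K_ge cube(3)[OF assms(1)] by (intro mult_strict_right_mono) auto
  with assms(2) show ?thesis
    by linarith
qed

lemma elevation_E_le_rdiam:
  assumes Q: "Q \<in> S" "w \<in> Q" and e: "e \<in> E" "pdist e w \<le> K / 2 * rdiam Q"
  shows "\<bar>elevation e\<bar> \<le> 2 * \<eta> * rdiam Q"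
proof -
  have less: "pdist e w < (1 / \<eta> - 1) * rdiam Q"
    using half_K_less[OF Q(1) e(2)] by (simp add: K_def)
  have "pdist_pt e Q \<le> ennreal (pdist e w)"
    by (rule pdist_pt_le[OF Q(2) order_refl])
  also have "\<dots> < ennreal ((1 / \<eta> - 1) * rdiam Q)"
    using le_less_trans[OF pdist_nonneg less] less by (rule ennreal_lessI)
  finally have "e \<in> dilate_cube E (1 / \<eta>) Q"
    using e(1) by (simp add: dilate_cube_def)
  from pdist_pt_lessE[OF near_graph[OF Q(1) this]]
  obtain p where "p \<in> graph_over q L \<nu> \<psi>" "pdist e p < \<eta> * rdiam Q" .
  then show ?thesis
    using elevation_lip[of e p] by (simp add: mem_graph_iff)
qed

lemma elevation_cube_le:
  assumes "Q \<in> S" "w \<in> Q"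
  shows "\<bar>elevation w\<bar> \<le> 2 * \<eta> * rdiam Q"
  using assms(2) cube(1,3)[OF assms(1)] K_ge by (intro elevation_E_le_rdiam[OF assms]) auto

lemma graph_near_E:
  assumes Q: "Q \<in> S" "w \<in> Q" and p: "elevation p = 0" "pdist p w \<le> K / 2 * rdiam Q"
  obtains e where "e \<in> E" "pdist p e < \<eta> * rdiam Q"
proof -
  have "pdist (ctr Q) p \<le> rdiam Q + pdist p w"
    using pdist_triangle[of "ctr Q" p w] pdist_cube_le[OF Q(1) cube(4)[OF Q(1)] Q(2)]
        pdist_commute[of w p]
    by linarith
  also have "\<dots> < 1 / \<eta> * rdiam Q"
    using half_K_less[OF Q(1) p(2)] by (simp add: K_def algebra_simps)
  finally have "pdist_pt p E < ennreal (\<eta> * rdiam Q)"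
    using p(1) by (intro near_E[OF Q(1)]) (simp add: pball_def mem_graph_iff)
  then show ?thesis
    by (rule pdist_pt_lessE) (rule that)
qed

lemma observing_ancestor:
  assumes "Q \<in> S" "0 \<le> \<rho>" "\<rho> \<le> K / 2 * dS"
  obtains Q' where "Q' \<in> S" "Q \<subseteq> Q'" "\<rho> \<le> K / 2 * rdiam Q'" "rdiam Q' \<le> max (rdiam Q) (\<rho> / 50)"
proof -
  have \<eta>K: "\<eta> * K = 1"
    using \<eta>_pos by (simp add: K_def)
  have "2 * \<eta> * \<rho> \<le> 2 * \<eta> * (K / 2 * dS)"
    using assms(3) \<eta>_pos by (intro mult_left_mono) auto
  also have "\<dots> = dS"
    using \<eta>K by simp
  finally obtain Q' where Q': "Q' \<in> S" "Q \<subseteq> Q'" "2 * \<eta> * \<rho> \<le> rdiam Q'"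
    "rdiam Q' \<le> max (rdiam Q) (C * (2 * \<eta> * \<rho>))"
    using ancestor[OF assms(1)] by blast
  have "\<rho> = K / 2 * (2 * \<eta> * \<rho>)"
    using \<eta>K by (simp add: mult_ac)
  also have "\<dots> \<le> K / 2 * rdiam Q'"
    using Q'(3) K_ge by (intro mult_left_mono) auto
  finally have "\<rho> \<le> K / 2 * rdiam Q'" .
  moreover have "C * (2 * \<eta> * \<rho>) \<le> \<rho> / 50"
    using mult_right_mono[OF C_\<eta>_le assms(2)] by (simp add: mult_ac)
  then have "rdiam Q' \<le> max (rdiam Q) (\<rho> / 50)"
    using Q'(4) by (meson max.mono order_refl order_trans)
  ultimately show ?thesis
    using Q'(1,2) by (intro that[of Q'])
qed

text \<open>If \<open>e\<close> is far from the cube \<open>Q\<close> realising \<open>scale (proj e)\<close>, then both \<open>e\<close> and \<open>Q\<close> are seen by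
  an ancestor of \<open>Q\<close>, hence lie along the almost horizontal graph; so their distance is horizontal,
  that is, of order \<open>scale (proj e)\<close>.\<close>

lemma elevation_E_le_scale:
  assumes e: "e \<in> E" "pdist e zS \<le> K / 8 * dS"
  shows "\<bar>elevation e\<bar> \<le> 2 * \<eta> * scale (proj e)"
proof (rule le_mult_of_forall_greater)
  show "0 < 2 * \<eta>"
    using \<eta>_pos by simp
  fix \<epsilon> assume "scale (proj e) < \<epsilon>"
  then show "\<bar>elevation e\<bar> \<le> 2 * \<eta> * \<epsilon>"
  proof (cases rule: scale_nearE)
    case 1
    have "\<bar>elevation e\<bar> \<le> 2 * \<eta> * dS"
      using e(2) dS_le_K_dS dS_pos by (intro elevation_E_le_rdiam[OF top(1) zS_mem e(1)]) linarith
    also have "\<dots> \<le> 2 * \<eta> * \<epsilon>"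
      using 1 \<eta>_pos by (intro mult_left_mono) auto
    finally show ?thesis .
  next
    case (2 Q w)
    let ?\<rho> = "pdist e w"
    have "?\<rho> \<le> K / 2 * dS"
      using pdist_triangle[of e w zS] e(2) pdist_zS_le[OF 2(1,2)] dS_le_K_dS dS_pos by linarith
    then obtain Q' where Q': "Q' \<in> S" "Q \<subseteq> Q'" "?\<rho> \<le> K / 2 * rdiam Q'"
        "rdiam Q' \<le> max (rdiam Q) (?\<rho> / 50)"
      using observing_ancestor[OF 2(1)] pdist_nonneg by metis
    have wQ': "w \<in> Q'" and pos: "0 < rdiam Q'"
      using Q'(2) 2(2) cube(3)[OF Q'(1)] by auto
    have elev_e: "\<bar>elevation e\<bar> \<le> 2 * \<eta> * rdiam Q'"
      by (rule elevation_E_le_rdiam[OF Q'(1) wQ' e(1) Q'(3)])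
    have "rdiam Q' \<le> \<epsilon>"
    proof (rule ccontr)
      assume "\<not> rdiam Q' \<le> \<epsilon>"
      then have "50 * rdiam Q' \<le> ?\<rho>" and "pdist (proj e) (proj w) < 2 * rdiam Q'"
        using Q'(4) 2(3,4) by linarith+
      then show False
        using pdist_le_elevation[of e w] elev_e elevation_cube_le[OF Q'(1) wQ']
            \<eta>_mult_le[of "rdiam Q'"] pos
        by linarith
    qed
    then have "2 * \<eta> * rdiam Q' \<le> 2 * \<eta> * \<epsilon>"
      using \<eta>_pos by (intro mult_left_mono) auto
    with elev_e show ?thesis
      by linarith
  qed
qed

lemma elevation_E_le:
  assumes "e \<in> E" "pdist e zS \<le> K / 8 * dS"
  shows "\<bar>elevation e\<bar> \<le> \<kappa> * scale (proj e)"
proof -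
  have "2 * \<eta> * scale (proj e) \<le> \<kappa> * scale (proj e)"
    using \<eta>_le_\<kappa> \<kappa>_pos scale_nonneg by (intro mult_right_mono) auto
  then show ?thesis
    using elevation_E_le_scale[OF assms] by linarith
qed

definition whitney_point :: "'n cube \<Rightarrow> 'n stpt \<Rightarrow> bool" where
  "whitney_point Q z \<longleftrightarrow> Q \<in> S \<and> (\<exists>w\<in>Q. pdist z w \<le> 3 / \<theta> ^ 4 * rdiam Q) \<and>
     (\<forall>e\<in>E. \<theta> ^ 4 * rdiam Q \<le> pdist z e)"

context
  fixes Q z
  assumes whitney_point: "whitney_point Q z"
begin

lemma Q_mem: "Q \<in> S"
  using whitney_point by (simp add: whitney_point_def)

lemma close_pointE:
  obtains w where "w \<in> Q" "pdist z w \<le> 3 / \<theta> ^ 4 * rdiam Q"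
  using whitney_point by (auto simp: whitney_point_def)

lemma
  shows rdiam_pos: "0 < rdiam Q"
    and \<theta>4_rdiam_pos: "0 < \<theta> ^ 4 * rdiam Q"
    and \<theta>4_rdiam_le: "\<theta> ^ 4 * rdiam Q \<le> rdiam Q / 100"
    and rdiam_le_inverse_\<theta>4: "100 * rdiam Q \<le> 1 / \<theta> ^ 4 * rdiam Q"
    and inverse_\<theta>4_rdiam_le: "100 * (1 / \<theta> ^ 4 * rdiam Q) \<le> K * rdiam Q"
    and \<eta>_rdiam_le: "\<eta> * rdiam Q \<le> \<theta> ^ 4 * rdiam Q / 100"
proof -
  show pos: "0 < rdiam Q"
    by (rule cube(3)[OF Q_mem])
  then show "0 < \<theta> ^ 4 * rdiam Q"
    using \<theta>_pos by simp
  show "\<theta> ^ 4 * rdiam Q \<le> rdiam Q / 100"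
    using mult_right_mono[OF power_\<theta>_le[of 0 4], of "rdiam Q"] pos by simp
  show "100 * rdiam Q \<le> 1 / \<theta> ^ 4 * rdiam Q"
    using mult_right_mono[OF inverse_power_\<theta>_le[of 0 4], of "rdiam Q"] pos by simp
  show "100 * (1 / \<theta> ^ 4 * rdiam Q) \<le> K * rdiam Q"
    using mult_right_mono[OF inverse_power_\<theta>_le[of 4 16], of "rdiam Q"] pos by (simp add: K_eq)
  show "\<eta> * rdiam Q \<le> \<theta> ^ 4 * rdiam Q / 100"
    using mult_right_mono[OF power_\<theta>_le[of 4 16], of "rdiam Q"] pos by (simp flip: \<eta>_eq)
qed

lemma \<kappa>_scale_le: "\<kappa> * scale (proj z) \<le> \<theta> ^ 4 * rdiam Q / 10"
proof -
  obtain w where w: "w \<in> Q" "pdist z w \<le> 3 / \<theta> ^ 4 * rdiam Q"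
    by (rule close_pointE)
  then have "scale (proj z) \<le> 4 * (1 / \<theta> ^ 4 * rdiam Q)"
    using scale_le[OF Q_mem w(1), of z] rdiam_le_inverse_\<theta>4 rdiam_pos by simp
  then have "\<kappa> * scale (proj z) \<le> \<kappa> * (4 * (1 / \<theta> ^ 4 * rdiam Q))"
    using \<kappa>_pos by (intro mult_left_mono) auto
  also have "\<dots> = 4 * \<theta> ^ 11 * rdiam Q"
    using \<theta>_pos by (simp add: \<kappa>_def field_simps flip: power_add)
  also have "\<dots> \<le> \<theta> ^ 4 / 10 * rdiam Q"
    using power_\<theta>_le[of 4 11] zero_less_power[OF \<theta>_pos, of 4] rdiam_pos
    by (intro mult_right_mono) linarith+
  finally show ?thesis
    by simp
qed

lemma E_below:
  assumes "\<bar>elevation z\<bar> \<le> rdiam Q"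
  obtains e where "e \<in> E" "pdist z e < \<bar>elevation z\<bar> + \<eta> * rdiam Q"
proof -
  let ?p = "lift (proj z) (\<psi> (proj z))"
  obtain w where w: "w \<in> Q" "pdist z w \<le> 3 / \<theta> ^ 4 * rdiam Q"
    by (rule close_pointE)
  have zp: "pdist z ?p \<le> \<bar>elevation z\<bar>"
    using pdist_lift_le[of z "\<psi> (proj z)"] by (simp add: elevation_def)
  have "3 / \<theta> ^ 4 * rdiam Q = 3 * (1 / \<theta> ^ 4 * rdiam Q)"
    by simp
  then have "pdist ?p w \<le> K / 2 * rdiam Q"
    using pdist_triangle[of ?p w z] zp assms w(2) pdist_commute[of ?p z]
      rdiam_le_inverse_\<theta>4 inverse_\<theta>4_rdiam_le rdiam_pos by linarith
  moreover have "elevation ?p = 0"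
    by (simp add: elevation_def)
  ultimately obtain e where "e \<in> E" "pdist ?p e < \<eta> * rdiam Q"
    using graph_near_E[OF Q_mem w(1)] by blast
  then show ?thesis
    using zp pdist_triangle[of z e ?p] by (intro that[of e]) auto
qed

lemma elevation_large: "\<theta> ^ 4 * rdiam Q / 2 < \<bar>elevation z\<bar>"
proof (rule ccontr)
  assume small: "\<not> ?thesis"
  then have "\<bar>elevation z\<bar> \<le> rdiam Q"
    using \<theta>4_rdiam_le rdiam_pos by linarith
  then obtain e where e: "e \<in> E" "pdist z e < \<bar>elevation z\<bar> + \<eta> * rdiam Q"
    by (rule E_below)
  have "\<theta> ^ 4 * rdiam Q \<le> pdist z e"
    using whitney_point e(1) by (simp add: whitney_point_def)
  then show False
    using e(2) small \<eta>_rdiam_le \<theta>4_rdiam_pos by linarith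
qed

lemma \<kappa>_scale_less_elevation: "\<kappa> * scale (proj z) < \<bar>elevation z\<bar>"
  using elevation_large \<kappa>_scale_le \<theta>4_rdiam_pos by linarith

lemma pdist_E_le: "pdist_pt z E \<le> ennreal (3 / \<theta> ^ 4 * rdiam Q)"
proof -
  obtain w where "w \<in> Q" "pdist z w \<le> 3 / \<theta> ^ 4 * rdiam Q"
    by (rule close_pointE)
  then show ?thesis
    using cube(1)[OF Q_mem] by (intro pdist_pt_le) auto
qed

lemma pdist_E_ge: "ennreal (\<theta> ^ 4 * rdiam Q) \<le> pdist_pt z E"
  using whitney_point by (intro pdist_pt_geI) (simp add: whitney_point_def)

lemma shifted_graph_dist_le:
  assumes "s \<in> {1, -1}"
  shows "pdist_pt z (graph_over q L \<nu> (shifted s)) \<le> ennreal (11 / \<theta> ^ 4 * rdiam Q)"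
proof -
  obtain w where w: "w \<in> Q" "pdist z w \<le> 3 / \<theta> ^ 4 * rdiam Q"
    by (rule close_pointE)
  obtain p where p: "p \<in> graph_over q L \<nu> (shifted s)"
      "pdist z p \<le> \<bar>elevation z\<bar> + \<kappa> * scale (proj z)"
    using assms by (rule pdist_shifted_graph_le)
  have "3 / \<theta> ^ 4 * rdiam Q = 3 * (1 / \<theta> ^ 4 * rdiam Q)"
      "11 / \<theta> ^ 4 * rdiam Q = 11 * (1 / \<theta> ^ 4 * rdiam Q)"
    by simp_all
  then have "pdist z p \<le> 11 / \<theta> ^ 4 * rdiam Q"
    using p(2) w(2) elevation_lip[of z w] elevation_cube_le[OF Q_mem w(1)] \<eta>_mult_le[of "rdiam Q"]
      \<kappa>_scale_le \<theta>4_rdiam_le rdiam_le_inverse_\<theta>4 rdiam_pos by linarith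
  with p(1) show ?thesis
    by (rule pdist_pt_le)
qed

lemma shifted_graph_dist_ge:
  assumes "s \<in> {1, -1}"
  shows "ennreal (\<theta> ^ 4 / 8 * rdiam Q) \<le> pdist_pt z (graph_over q L \<nu> (shifted s))"
proof (rule pdist_pt_geI)
  fix p assume "p \<in> graph_over q L \<nu> (shifted s)"
  then have "\<bar>elevation p\<bar> = \<kappa> * scale (proj p)"
    using assms \<kappa>_pos scale_nonneg[of "proj p"] by (auto simp: mem_shifted_graph_iff abs_mult)
  also have "\<dots> \<le> \<kappa> * (scale (proj z) + pdist z p)"
    using scale_lip[of z p] \<kappa>_pos by (intro mult_left_mono) auto
  also have "\<dots> \<le> \<kappa> * scale (proj z) + pdist z p"
    using mult_right_mono[of \<kappa> 1 "pdist z p"] \<kappa>_le by (simp add: distrib_left)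
  finally have "\<bar>elevation z\<bar> \<le> \<kappa> * scale (proj z) + 3 * pdist z p"
    using elevation_lip[of z p] by linarith
  then show "\<theta> ^ 4 / 8 * rdiam Q \<le> pdist z p"
    using elevation_large \<kappa>_scale_le \<theta>4_rdiam_pos by linarith
qed

lemma whitney_point_in_ball: "z \<in> pball zS ((1 / \<eta>) powr (3/4) * dS)"
proof -
  obtain w where w: "w \<in> Q" "pdist z w \<le> 3 / \<theta> ^ 4 * rdiam Q"
    by (rule close_pointE)
  have "rdiam Q \<le> dS"
    by (intro rdiam_mono top Q_mem cube(2))
  then have "3 / \<theta> ^ 4 * rdiam Q \<le> 3 / \<theta> ^ 4 * dS"
    using \<theta>_pos by (intro mult_left_mono) auto
  then have "pdist zS z \<le> (1 + 3 * (1 / \<theta> ^ 4)) * dS"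
    using pdist_triangle[of zS z w] pdist_zS_le[OF Q_mem w(1)] pdist_commute[of w z] w(2)
    by (simp add: distrib_right)
  also have "\<dots> < 1 / \<theta> ^ 12 * dS"
    using inverse_power_\<theta>_le[of 0 12] inverse_power_\<theta>_le[of 4 12] dS_pos
    by (intro mult_strict_right_mono) auto
  finally show ?thesis
    by (simp add: pball_def powr_eqs)
qed

lemma comparable_distances:
  assumes "s \<in> {1, -1}"
  shows "pdist_pt z E \<le> ennreal (100 / \<eta> powr (1/2)) * pdist_pt z (graph_over q L \<nu> (shifted s))"
    and "pdist_pt z (graph_over q L \<nu> (shifted s)) \<le> ennreal (100 / \<eta> powr (1/2)) * pdist_pt z E"
proof -
  have "3 / \<theta> ^ 4 * rdiam Q \<le> 100 / \<theta> ^ 8 * (\<theta> ^ 4 / 8 * rdiam Q)"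
    "11 / \<theta> ^ 4 * rdiam Q \<le> 100 / \<theta> ^ 8 * (\<theta> ^ 4 * rdiam Q)"
    using \<theta>_pos rdiam_pos by (simp_all add: field_simps flip: power_add)
  then show "pdist_pt z E \<le>
      ennreal (100 / \<eta> powr (1/2)) * pdist_pt z (graph_over q L \<nu> (shifted s))"
    and "pdist_pt z (graph_over q L \<nu> (shifted s)) \<le> ennreal (100 / \<eta> powr (1/2)) * pdist_pt z E"
    unfolding powr_eqs using \<theta>_pos rdiam_pos
    by (intro ennreal_le_multI[OF pdist_E_le shifted_graph_dist_ge[OF assms]]
        ennreal_le_multI[OF shifted_graph_dist_le[OF assms] pdist_E_ge]; simp)+
qed

end

lemma regular_shifted:
  assumes \<psi>: "regular_fun \<eta> b2 \<psi>" "0 \<le> b2" and small: "\<theta> * half_deriv_bmo_const CARD('m) \<le> 1"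
    and s: "s \<in> {1, -1}"
  shows "regular_fun (2 * \<eta> powr (15/16)) (1 + b2) (shifted s)"
proof -
  let ?B = "half_deriv_bmo_const CARD('m)"
  have "time_regular scale dS"
    unfolding scale_def using dS_pos by (intro time_regular_reg_dist) simp
  then have "regular_fun 1 ?B scale"
    using time_regular.regular[of scale dS] by simp
  then have regular: "regular_fun (\<eta> + \<bar>s * \<kappa>\<bar> * 1) (b2 + \<bar>s * \<kappa>\<bar> * ?B) (\<lambda>p. \<psi> p + s * \<kappa> * scale p)"
    by (rule regular_fun_add_scaled[OF \<psi> _ less_imp_le[OF half_deriv_bmo_const_pos]])
  have abs_eq: "\<bar>s * \<kappa>\<bar> = \<kappa>"
    using s \<kappa>_pos by auto
  have "\<kappa> * ?B \<le> \<theta> * ?B"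
    using power_\<theta>_le[of 1 15] \<theta>_pos half_deriv_bmo_const_pos[of "CARD('m)"]
    by (intro mult_right_mono) (auto simp: \<kappa>_def)
  then have bmo_le: "b2 + \<kappa> * ?B \<le> 1 + b2"
    using small by linarith
  have lip_le: "\<eta> + \<kappa> \<le> 2 * \<eta> powr (15/16)"
    using \<eta>_le_\<kappa> \<kappa>_pos by (simp add: powr_eqs)
  show ?thesis
    using regular_fun_mono[OF regular[unfolded abs_eq mult_1_right] lip_le bmo_le]
    by (simp add: shifted_def[abs_def])
qed

lemma continuous_on_elevation: "continuous_on UNIV elevation"
  by (rule lip_half_one_continuous[of 2]) (simp only: lip_half_one_def elevation_lip simp_thms)

lemma continuous_on_scale_proj: "continuous_on UNIV (\<lambda>z. scale (proj z))"
  by (rule lip_half_one_continuous[of 1]) (simp only: lip_half_one_def mult_1 scale_lip simp_thms)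

context
  fixes z s
  assumes z_ball: "z \<in> pball zS ((1 / \<eta>) / 32 * dS)" and s: "s \<in> {1, -1}"
    and side: "z \<in> graph_side q L \<nu> s (shifted s)"
begin

lemma pdist_zS_less: "pdist z zS < K / 32 * dS"
  using z_ball unfolding pball_def K_def pdist_commute[of z] by simp

lemma above_shifted_graph: "\<kappa> * scale (proj z) < s * elevation z"
  using side s by (simp add: mem_shifted_side_iff)

lemma side_off_E: "z \<notin> E"
proof
  assume "z \<in> E"
  then have "\<bar>elevation z\<bar> \<le> \<kappa> * scale (proj z)"
    using pdist_zS_less dS_le_K_dS dS_pos by (intro elevation_E_le) linarith+
  then show False
    using above_shifted_graph s by auto
qed

lemma closest_E_in_ball:
  assumes "e \<in> E"
  obtains e' where "e' \<in> E" "pdist z e' \<le> pdist z e" "pdist e' zS \<le> K / 8 * dS"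
proof (cases "pdist z e < K / 32 * dS")
  case True
  then have "pdist e zS \<le> K / 8 * dS"
    using pdist_zS_less pdist_triangle[of e zS z] pdist_commute[of e z] dS_le_K_dS dS_pos
    by linarith
  then show ?thesis
    using assms by (intro that[of e]) auto
next
  case False
  then show ?thesis
    using pdist_zS_less zS_E dS_le_K_dS dS_pos by (intro that[of zS]) auto
qed

lemma shifted_graph_dist_le_E_dist: "pdist_pt z (graph_over q L \<nu> (shifted s)) \<le> pdist_pt z E"
proof (rule pdist_pt_greatest)
  fix e assume "e \<in> E"
  then obtain e' where e': "e' \<in> E" "pdist z e' \<le> pdist z e" "pdist e' zS \<le> K / 8 * dS"
    by (rule closest_E_in_ball)
  let ?F = "\<lambda>v. s * elevation v - \<kappa> * scale (proj v)"
  have "continuous_on UNIV ?F"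
    by (intro continuous_intros continuous_on_elevation continuous_on_scale_proj)
  moreover have "0 \<le> ?F z"
    using above_shifted_graph by simp
  moreover have "\<bar>s * elevation e'\<bar> \<le> \<kappa> * scale (proj e')"
    using elevation_E_le[OF e'(1,3)] s by auto
  then have "?F e' \<le> 0"
    by linarith
  ultimately obtain p where p: "?F p = 0" "pdist z p \<le> pdist z e'"
    by (rule zero_on_segmentE)
  have "elevation p = s * (\<kappa> * scale (proj p))"
    using p(1) s by auto
  then have "p \<in> graph_over q L \<nu> (shifted s)"
    by (simp add: mem_shifted_graph_iff)
  then show "pdist_pt z (graph_over q L \<nu> (shifted s)) \<le> ennreal (pdist z e)"
    using order_trans[OF p(2) e'(2)] by (rule pdist_pt_le)
qed

context
  fixes l e
  assumes l_pos: "0 < l" and far: "\<And>e. e \<in> E \<Longrightarrow> l \<le> pdist z e"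
    and e: "e \<in> E" "pdist z e \<le> 3 * l"
begin

lemma abs_elevation_side_le: "\<bar>elevation z\<bar> \<le> 2 * \<eta> * scale (proj z) + 7 * l"
proof -
  have "l < K / 32 * dS"
    using far[OF zS_E] pdist_zS_less by linarith
  then have "pdist e zS \<le> K / 8 * dS"
    using pdist_triangle[of e zS z] pdist_commute[of e z] e(2) pdist_zS_less by linarith
  then have "\<bar>elevation e\<bar> \<le> 2 * \<eta> * scale (proj e)"
    by (rule elevation_E_le_scale[OF e(1)])
  also have "\<dots> \<le> 2 * \<eta> * (scale (proj z) + 3 * l)"
    using scale_lip[of z e] e(2) \<eta>_pos by (intro mult_left_mono) auto
  also have "\<dots> = 2 * \<eta> * scale (proj z) + 6 * (\<eta> * l)"
    by (simp add: algebra_simps)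
  finally show ?thesis
    using elevation_lip[of z e] e(2) \<eta>_mult_le[of l] l_pos by linarith
qed

lemma scale_side_less: "\<kappa> * scale (proj z) < 8 * l"
proof -
  have "\<kappa> * scale (proj z) < \<bar>elevation z\<bar>"
    using above_shifted_graph s by auto
  moreover have "\<eta> * scale (proj z) \<le> \<kappa> * scale (proj z) / 100"
    using mult_right_mono[OF \<eta>_le_\<kappa> scale_nonneg] by simp
  ultimately show ?thesis
    using abs_elevation_side_le l_pos by linarith
qed

lemma observing_cube_side:
  obtains Q w where "Q \<in> S" "w \<in> Q" "rdiam Q \<le> 8 * l / \<kappa>" "pdist z w \<le> K * rdiam Q"
proof -
  define \<epsilon> where "\<epsilon> = 8 * l / \<kappa>"
  have \<epsilon>: "0 < \<epsilon>" "\<kappa> * \<epsilon> = 8 * l" "800 * l \<le> \<epsilon>"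
    using l_pos \<kappa>_pos mult_right_mono[OF \<kappa>_le, of \<epsilon>] by (auto simp: \<epsilon>_def field_simps)
  have scale: "scale (proj z) < \<epsilon>"
    using scale_side_less \<kappa>_pos by (simp add: \<epsilon>_def field_simps)
  have elev_z: "\<bar>elevation z\<bar> \<le> \<epsilon>"
    using abs_elevation_side_le \<eta>_mult_le[OF scale_nonneg, of "proj z"] scale \<epsilon>(1,3) by linarith
  show ?thesis
    using scale
  proof (cases rule: scale_nearE)
    case 1
    have "pdist z zS \<le> K * dS"
      using pdist_zS_less dS_le_K_dS dS_pos by linarith
    with 1 show ?thesis
      by (intro that[OF top(1) zS_mem]) (auto simp: \<epsilon>_def)
  next
    case (2 Q w)
    let ?\<rho> = "pdist z w"
    have "?\<rho> \<le> K / 2 * dS"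
      using pdist_triangle[of z w zS] pdist_zS_less pdist_zS_le[OF 2(1,2)] dS_le_K_dS dS_pos
      by linarith
    then obtain Q' where Q': "Q' \<in> S" "Q \<subseteq> Q'" "?\<rho> \<le> K / 2 * rdiam Q'"
        "rdiam Q' \<le> max (rdiam Q) (?\<rho> / 50)"
      using observing_ancestor[OF 2(1)] pdist_nonneg by metis
    have "?\<rho> \<le> 6 * \<epsilon>"
      using pdist_le_elevation[of z w] 2(3,4) elev_z elevation_cube_le[OF 2(1,2)]
        \<eta>_mult_le[of "rdiam Q"] cube(3)[OF 2(1)] by linarith
    then have "rdiam Q' \<le> \<epsilon>"
      using Q'(4) 2(3) \<epsilon>(1) by linarith
    moreover have "?\<rho> \<le> K * rdiam Q'"
      using Q'(3) pdist_nonneg[of z w] by linarith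
    ultimately show ?thesis
      using Q'(1,2) 2(2) by (intro that[of Q' w]) (auto simp: \<epsilon>_def)
  qed
qed

lemma cube_containing_side:
  obtains Q w where "Q \<in> S" "w \<in> Q" "\<eta> ^ 4 * rdiam Q \<le> l" "pdist z w \<le> 1 / \<eta> * rdiam Q"
proof -
  obtain Q w where Q: "Q \<in> S" "w \<in> Q" "rdiam Q \<le> 8 * l / \<kappa>" "pdist z w \<le> K * rdiam Q"
    by (rule observing_cube_side)
  have "\<eta> ^ 4 \<le> \<eta> ^ 1"
    using \<eta>_pos \<eta>_le by (intro power_decreasing) auto
  then have "\<eta> ^ 4 * rdiam Q \<le> \<kappa> / 100 * (8 * l / \<kappa>)"
    using \<eta>_le_\<kappa> \<kappa>_pos Q(3) cube(3)[OF Q(1)] by (intro mult_mono) auto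
  also have "\<dots> \<le> l"
    using \<kappa>_pos l_pos by simp
  finally show ?thesis
    using Q by (intro that[of Q w]) (auto simp: K_def)
qed

end

end

lemma shifted_graph_near_center:
  assumes "s \<in> {1, -1}"
  obtains p where "p \<in> graph_over q L \<nu> (shifted s)" "pdist zS p \<le> dS"
proof -
  obtain p where p: "p \<in> graph_over q L \<nu> (shifted s)"
      "pdist zS p \<le> \<bar>elevation zS\<bar> + \<kappa> * scale (proj zS)"
    using assms by (rule pdist_shifted_graph_le)
  have "\<bar>elevation zS\<bar> \<le> \<kappa> * scale (proj zS)"
    using dS_le_K_dS dS_pos by (intro elevation_E_le[OF zS_E]) simp
  moreover have "\<kappa> * scale (proj zS) \<le> 1 / 100 * dS"
    using \<kappa>_le \<kappa>_pos scale_le_dS scale_nonneg by (intro mult_mono) auto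
  ultimately show ?thesis
    using p dS_pos by (intro that[of p]) auto
qed

lemma comparable_balls:
  assumes s: "s \<in> {1, -1}"
  shows "\<exists>p\<in>graph_over q L \<nu> (shifted s).
    (\<eta> < ball_threshold M0 \<longrightarrow>
       pball zS (M0 * (1 / \<eta>) powr (3/4) * dS) \<subseteq> pball p ((1 / \<eta>) powr (7/8) * dS)) \<and>
    pball p ((1 / \<eta>) powr (7/8) * dS) \<subseteq> pball zS ((1 / \<eta>) / 32 * dS)"
proof -
  obtain p where p: "p \<in> graph_over q L \<nu> (shifted s)" "pdist zS p \<le> dS"
    using s by (rule shifted_graph_near_center)
  have "1 + 1 / \<theta> ^ 14 \<le> K / 32"
    using inverse_power_\<theta>_le[of 14 16] inverse_power_\<theta>_le[of 0 16] by (simp add: K_eq)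
  then have "(1 + 1 / \<theta> ^ 14) * dS \<le> K / 32 * dS"
    using dS_pos by (intro mult_right_mono) auto
  then have "pdist zS p + (1 / \<eta>) powr (7/8) * dS \<le> (1 / \<eta>) / 32 * dS"
    using p(2) by (simp add: powr_eqs K_def distrib_right)
  moreover have "pdist p zS + M0 * (1 / \<eta>) powr (3/4) * dS \<le> (1 / \<eta>) powr (7/8) * dS"
    if "\<eta> < ball_threshold M0"
  proof -
    have "M0 / \<theta> ^ 12 = M0 * \<theta>\<^sup>2 * (1 / \<theta> ^ 14)"
      using \<theta>_pos by (simp add: field_simps flip: power_add)
    also have "\<dots> \<le> 1 / 2 * (1 / \<theta> ^ 14)"
      using below_ball_threshold[OF \<eta>_pos that] \<theta>_pos by (intro mult_right_mono) (auto simp: \<theta>_def)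
    finally have "1 + M0 / \<theta> ^ 12 \<le> 1 / \<theta> ^ 14"
      using inverse_power_\<theta>_le[of 0 14] by simp
    then have "(1 + M0 / \<theta> ^ 12) * dS \<le> 1 / \<theta> ^ 14 * dS"
      using dS_pos by (intro mult_right_mono) auto
    then show ?thesis
      using p(2) by (simp add: powr_eqs pdist_commute[of p] distrib_right)
  qed
  ultimately show ?thesis
    by (intro bexI[OF _ p(1)] conjI impI pball_subset_pball)
qed

end

section \<open>Whitney cubes and the shifted graphs\<close>

locale corona_whitney = corona_regime P q L \<nu> E S ctr QS \<eta> C \<psi>
  for P :: "'n::finite stpt set" and q and L :: "real^'m::finite \<Rightarrow> real^'n" and \<nu> E S ctr QS \<eta> C \<psi> +
  fixes W :: "'n stpt set set"
  assumes whitney: "whitney E W"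
begin

definition whitney_side :: "real \<Rightarrow> 'n cube \<Rightarrow> 'n stpt set set" where
  "whitney_side s Q = {I \<in> W_Q E W \<eta> Q. I \<subseteq> graph_side q L \<nu> s (shifted s)}"

lemma E_nonempty: "E \<noteq> {}"
  using zS_E by auto

lemma whitney_point_W_Q:
  assumes "Q \<in> S" "I \<in> W_Q E W \<eta> Q" "z \<in> I"
  shows "whitney_point Q z"
proof -
  have I: "I \<in> whitney_near E W (\<theta> ^ 4) (1 / \<theta> ^ 4) Q"
    using assms(2) by (simp add: W_Q_def powr_eqs)
  have "\<exists>w\<in>Q. pdist z w \<le> 3 * (1 / \<theta> ^ 4) * rdiam Q"
    using \<theta>_pos
    by (intro whitney_near_close[OF whitney I assms(3) cube(1,3)]) (use assms(1) in auto)
  then show ?thesis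
    using whitney_near_far[OF I assms(3)] assms(1) by (simp add: whitney_point_def)
qed

lemma mem_W_Q_cases:
  assumes Q: "Q \<in> S" and I: "I \<in> W_Q E W \<eta> Q"
  shows "I \<in> whitney_side 1 Q \<or> I \<in> whitney_side (-1) Q"
proof -
  have "connected I"
    using whitney_cubeE[OF whitney _ E_nonempty] I
    by (metis (mono_tags) W_Q_def mem_Collect_eq whitney_near_def)
  have large: "\<kappa> * scale (proj z) < \<bar>elevation z\<bar>" if "z \<in> I" for z
    by (rule \<kappa>_scale_less_elevation[OF whitney_point_W_Q[OF Q I that]])
  have "elevation z \<noteq> 0" if "z \<in> I" for z
    using large[OF that] \<kappa>_scale_nonneg[of "proj z"] by auto
  then have "(\<forall>z\<in>I. 0 < elevation z) \<or> (\<forall>z\<in>I. elevation z < 0)"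
    using continuous_on_subset[OF continuous_on_elevation]
    by (intro connected_nonzero_sign[OF \<open>connected I\<close>]) auto
  then have "I \<subseteq> graph_side q L \<nu> 1 (shifted 1) \<or> I \<subseteq> graph_side q L \<nu> (-1) (shifted (-1))"
  proof
    assume "\<forall>z\<in>I. 0 < elevation z"
    then show ?thesis
      using large by (force simp: mem_shifted_side_iff)
  next
    assume "\<forall>z\<in>I. elevation z < 0"
    then show ?thesis
      using large by (force simp: mem_shifted_side_iff)
  qed
  then show ?thesis
    using I by (simp add: whitney_side_def)
qed

lemma W_Q_eq_sides: "Q \<in> S \<Longrightarrow> W_Q E W \<eta> Q = whitney_side 1 Q \<union> whitney_side (-1) Q"
  using mem_W_Q_cases by (auto simp: whitney_side_def)

lemma whitney_sides_disjoint: "whitney_side 1 Q \<inter> whitney_side (-1) Q = {}"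
proof (rule ccontr)
  assume "\<not> ?thesis"
  then obtain I where I: "I \<in> W" "I \<subseteq> graph_side q L \<nu> 1 (shifted 1)"
      "I \<subseteq> graph_side q L \<nu> (-1) (shifted (-1))"
    by (auto simp: whitney_side_def W_Q_def whitney_near_def)
  obtain z where "z \<in> I"
    using whitney_cubeE[OF whitney I(1) E_nonempty] by blast
  then have "z \<in> graph_side q L \<nu> 1 (shifted 1)" "z \<in> graph_side q L \<nu> (-1) (shifted (-1))"
    using I(2,3) by blast+
  then have "\<kappa> * scale (proj z) < elevation z" "\<kappa> * scale (proj z) < - elevation z"
    by (simp_all add: mem_shifted_side_iff)
  then show False
    using \<kappa>_scale_nonneg[of "proj z"] by linarith
qed

lemma whitney_side_subset:
  assumes "Q \<in> S"
  shows "\<Union>(whitney_side s Q) \<subseteq> pball zS ((1 / \<eta>) powr (3/4) * dS) \<inter> graph_side q L \<nu> s (shifted s)"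
  using whitney_point_in_ball[OF whitney_point_W_Q[OF assms]] by (auto simp: whitney_side_def)

lemma whitney_side_comparable:
  assumes "s \<in> {1, -1}" and z: "z \<in> (\<Union>Q\<in>S. \<Union>(whitney_side s Q))"
  shows "pdist_pt z E \<le> ennreal (100 / \<eta> powr (1/2)) * pdist_pt z (graph_over q L \<nu> (shifted s))"
    and "pdist_pt z (graph_over q L \<nu> (shifted s)) \<le> ennreal (100 / \<eta> powr (1/2)) * pdist_pt z E"
proof -
  obtain Q I where "Q \<in> S" "I \<in> W_Q E W \<eta> Q" "z \<in> I"
    using z by (auto simp: whitney_side_def)
  then have "whitney_point Q z"
    by (rule whitney_point_W_Q)
  from comparable_distances[OF this assms(1)]
  show "pdist_pt z E \<le> ennreal (100 / \<eta> powr (1/2)) * pdist_pt z (graph_over q L \<nu> (shifted s))"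
    and "pdist_pt z (graph_over q L \<nu> (shifted s)) \<le> ennreal (100 / \<eta> powr (1/2)) * pdist_pt z E" .
qed

lemma graph_side_subset_Ustar:
  assumes s: "s \<in> {1, -1}"
  shows "pball zS ((1 / \<eta>) / 32 * dS) \<inter> graph_side q L \<nu> s (shifted s) \<subseteq> (\<Union>Q\<in>S. Ustar_Q E W \<eta> Q)"
proof
  fix z assume "z \<in> pball zS ((1 / \<eta>) / 32 * dS) \<inter> graph_side q L \<nu> s (shifted s)"
  then have z: "z \<in> pball zS ((1 / \<eta>) / 32 * dS)" "z \<in> graph_side q L \<nu> s (shifted s)"
    by auto
  have "z \<in> \<Union>W"
    using side_off_E[OF z(1) s z(2)] whitney by (simp add: whitney_def)
  then obtain I where I: "I \<in> W" "z \<in> I"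
    by blast
  obtain l where l: "0 < l" "pdist_set I E = ennreal l" "\<And>z z'. z \<in> I \<Longrightarrow> z' \<in> I \<Longrightarrow> pdist z z' \<le> l / 4"
    using whitney_cubeE[OF whitney I(1) E_nonempty] by metis
  have far: "l \<le> pdist z e" if "e \<in> E" for e
    using pdist_set_le[OF I(2) that] l(2) by (simp add: ennreal_le_iff)
  have "pdist_set I E < ennreal (2 * l)"
    using l(1,2) by (simp add: ennreal_lessI)
  then obtain z' e where e: "z' \<in> I" "e \<in> E" "pdist z' e < 2 * l"
    by (rule pdist_set_lessE)
  then have "pdist z e \<le> 3 * l"
    using pdist_triangle[of z e z'] l(3)[OF I(2) e(1)] l(1) by linarith
  from cube_containing_side[OF z(1) s z(2) l(1) far e(2) this]
  obtain Q w where Q: "Q \<in> S" "w \<in> Q" "\<eta> ^ 4 * rdiam Q \<le> l" "pdist z w \<le> 1 / \<eta> * rdiam Q" .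
  have "pdist_set I Q \<le> ennreal (1 / \<eta> * rdiam Q)"
    using pdist_set_le[OF I(2) Q(2)] ennreal_leI[OF Q(4)] by (rule order_trans)
  then have "I \<in> Wstar_Q E W \<eta> Q"
    using I(1) ennreal_leI[OF Q(3)] pdist_set_antimono_right[OF cube(1)[OF Q(1)], of I]
    by (simp add: Wstar_Q_def whitney_near_def l(2))
  then show "z \<in> (\<Union>Q\<in>S. Ustar_Q E W \<eta> Q)"
    using Q(1) I(2) by (auto simp: Ustar_Q_def)
qed

end

section \<open>Subregimes of a bilateral corona decomposition\<close>

lemma bilateral_corona_coherent:
  fixes E :: "'n::finite stpt set"
  assumes "bilateral_corona TYPE('m::finite) E D ctr \<eta> b2 C\<eta> \<G> \<B> \<S> \<Gamma>" "T \<in> \<S>"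
  shows "regular_graph TYPE('m) \<eta> b2 (\<Gamma> T)"
    and "Q \<in> T \<Longrightarrow> (SUP z \<in> dilate_cube E (1 / \<eta>) Q. pdist_pt z (\<Gamma> T)) +
      (SUP z \<in> pball (ctr Q) (1 / \<eta> * rdiam Q) \<inter> \<Gamma> T. pdist_pt z E) < ennreal (\<eta> * rdiam Q)"
proof -
  have "\<forall>S\<in>\<S>. regular_graph TYPE('m) \<eta> b2 (\<Gamma> S) \<and>
      (\<forall>Q\<in>S. (SUP z \<in> dilate_cube E (1 / \<eta>) Q. pdist_pt z (\<Gamma> S)) +
        (SUP z \<in> pball (ctr Q) (1 / \<eta> * rdiam Q) \<inter> \<Gamma> S. pdist_pt z E) < ennreal (\<eta> * rdiam Q))"
    using assms(1) unfolding bilateral_corona_def by (elim conjE)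
  with assms(2) show "regular_graph TYPE('m) \<eta> b2 (\<Gamma> T)"
    and "Q \<in> T \<Longrightarrow> (SUP z \<in> dilate_cube E (1 / \<eta>) Q. pdist_pt z (\<Gamma> T)) +
      (SUP z \<in> pball (ctr Q) (1 / \<eta> * rdiam Q) \<inter> \<Gamma> T. pdist_pt z E) < ennreal (\<eta> * rdiam Q)"
    by blast+
qed

lemma bilateral_corona_near:
  fixes E :: "'n::finite stpt set"
  assumes corona: "bilateral_corona TYPE('m::finite) E D ctr \<eta> b2 C\<eta> \<G> \<B> \<S> \<Gamma>" "T \<in> \<S>" and Q: "Q \<in> T"
  shows "e \<in> dilate_cube E (1 / \<eta>) Q \<Longrightarrow> pdist_pt e (\<Gamma> T) < ennreal (\<eta> * rdiam Q)"
    and "p \<in> pball (ctr Q) (1 / \<eta> * rdiam Q) \<inter> \<Gamma> T \<Longrightarrow> pdist_pt p E < ennreal (\<eta> * rdiam Q)"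
    and "0 < \<eta> \<Longrightarrow> 0 < rdiam Q"
proof -
  note less = bilateral_corona_coherent(2)[OF corona Q]
  show "pdist_pt e (\<Gamma> T) < ennreal (\<eta> * rdiam Q)" if "e \<in> dilate_cube E (1 / \<eta>) Q"
    using SUP_upper[OF that, of "\<lambda>z. pdist_pt z (\<Gamma> T)"]
    by (intro le_less_trans[OF _ less]) (rule add_increasing2, auto)
  show "pdist_pt p E < ennreal (\<eta> * rdiam Q)" if "p \<in> pball (ctr Q) (1 / \<eta> * rdiam Q) \<inter> \<Gamma> T"
    using SUP_upper[OF that, of "\<lambda>z. pdist_pt z E"]
    by (intro le_less_trans[OF _ less]) (rule add_increasing, auto)
  have "0 < ennreal (\<eta> * rdiam Q)"
    by (rule le_less_trans[OF zero_le less])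
  then show "0 < rdiam Q" if "0 < \<eta>"
    using that by (simp add: zero_less_mult_iff)
qed

lemma corona_subregimeE:
  fixes E :: "'n::finite stpt set"
  assumes card: "CARD('n) = CARD('m::finite) + 1"
    and pur: "PUR C0 M E" and D: "dyadic_system E a0 \<gamma> cs D" and a0: "0 < a0"
    and ctr: "\<forall>Q\<in>cubes D. is_center E Cc Q (ctr Q)" and Cc: "0 < Cc" and W: "whitney E W"
    and \<eta>: "0 < \<eta>" "\<eta> < corona_threshold CARD('m) C0 a0 cs"
    and corona: "bilateral_corona TYPE('m) E D ctr \<eta> b2 C\<eta> \<G> \<B> \<S> \<Gamma>" "T \<in> \<S>"
    and S: "S \<subseteq> T" "coherent D S"
  obtains P q and L :: "real^'m \<Rightarrow> real^'n" and \<nu> \<psi>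
  where "t_indep_plane P" "plane_coords P q L \<nu>" "regular_fun \<eta> b2 \<psi>"
    "corona_whitney P q L \<nu> E S ctr (top_cube S) \<eta> (parent_ratio C0 a0 cs) \<psi> W"
proof -
  obtain P q and L :: "real^'m \<Rightarrow> real^'n" and \<nu> \<psi> where P: "t_indep_plane P" "plane_coords P q L \<nu>"
    and \<psi>: "regular_fun \<eta> b2 \<psi>" and \<Gamma>: "\<Gamma> T = graph_over q L \<nu> \<psi>"
    using bilateral_corona_coherent(1)[OF corona] unfolding regular_graph_def by blast
  have adr: "ADR C0 E"
    using pur by (simp add: PUR_def)
  have cubes: "S \<subseteq> cubes D"
    using S(2) by (simp add: coherent_def)
  have generation: "\<exists>k. Q \<in> D k" if "Q \<in> S" for Q
    using cubes that by (auto simp: cubes_def)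
  have pos: "0 < rdiam Q" if "Q \<in> S" for Q
    using bilateral_corona_near(3)[OF corona _ \<eta>(1)] S(1) that by blast
  have "corona_whitney P q L \<nu> E S ctr (top_cube S) \<eta> (parent_ratio C0 a0 cs) \<psi> W"
  proof
    show "0 \<le> parent_ratio C0 a0 cs"
      using parent_ratio_ge_1[of C0 a0 cs] by linarith
    show "lip_half_one \<eta> \<psi>"
      using \<psi> by (simp add: regular_fun_def)
    fix Q assume Q: "Q \<in> S"
    show "Q \<subseteq> E" "pdiam Q < \<infinity>"
      using generation[OF Q] dyadic_subset[OF D] dyadic_pdiam_finite[OF D] by blast+
    show "ctr Q \<in> Q"
      using ctr cubes Q by (intro is_center_mem[OF _ Cc pos]) auto
    show "pdist_pt e (graph_over q L \<nu> \<psi>) < ennreal (\<eta> * rdiam Q)"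
        if "e \<in> dilate_cube E (1 / \<eta>) Q" for e
      using bilateral_corona_near(1)[OF corona _ that] S(1) Q by (auto simp: \<Gamma>)
    show "pdist_pt p E < ennreal (\<eta> * rdiam Q)"
      if "p \<in> pball (ctr Q) (1 / \<eta> * rdiam Q) \<inter> graph_over q L \<nu> \<psi>" for p
      using bilateral_corona_near(2)[OF corona, of Q p] S(1) Q that by (auto simp: \<Gamma>)
  qed (fact P(2) card \<eta>(1) below_corona_threshold(1,2)[OF \<eta>] W top_cube_mem[OF S(2)]
      | erule subset_top_cube[OF S(2)] pos
      | rule coherent_ancestor[OF D adr a0 S(2) pos], assumption+)+
  with P \<psi> show ?thesis
    by (rule that)
qed

theorem proposition3p25:
  assumes "CARD('n::finite) \<ge> 2" and "CARD('n) = CARD('m::finite) + 1"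
  shows
   "\<exists>Cn>0. \<forall>C0>0. \<forall>a0>0. \<forall>\<gamma>>0. \<forall>cs. \<forall>Cc>0.
    \<exists>\<eta>0>0. \<exists>A :: real \<Rightarrow> real.
    \<forall>b2\<ge>0. \<forall>M0. square_function_const TYPE('m) 2 (1 + b2) M0 \<longrightarrow>
    (\<exists>\<eta>1>0.
     \<forall>(E :: 'n stpt set) M D ctr W \<eta> C\<eta> \<G> \<B> \<S> \<Gamma>.
      PUR C0 M E \<and> dyadic_system E a0 \<gamma> cs D \<and> (\<forall>Q\<in>cubes D. is_center E Cc Q (ctr Q)) \<and>
      whitney E W \<and> 0 < \<eta> \<and> \<eta> < \<eta>0 \<and>
      bilateral_corona TYPE('m) E D ctr \<eta> b2 C\<eta> \<G> \<B> \<S> \<Gamma> \<longrightarrow>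
      (\<forall>Sstar\<in>\<S>. \<forall>S. S \<subseteq> Sstar \<and> coherent D S \<longrightarrow>
       (let K = 1 / \<eta>; QS = top_cube S; zS = ctr QS; dS = rdiam QS in
        \<exists>P q (L :: real^'m \<Rightarrow> real^'n) \<nu>.
        \<exists>\<psi> :: real \<Rightarrow> 'm stpt \<Rightarrow> real.
        \<exists>Wpm :: real \<Rightarrow> 'n cube \<Rightarrow> 'n stpt set set.
          t_indep_plane P \<and> plane_coords P q L \<nu> \<and>
          (\<forall>s\<in>{1, -1}. regular_fun (Cn * \<eta> powr (15/16)) (1 + b2) (\<psi> s)) \<and>
          \<comment> \<open>(1)\<close>
          (\<forall>Q\<in>S. W_Q E W \<eta> Q = Wpm 1 Q \<union> Wpm (-1) Q \<and> Wpm 1 Q \<inter> Wpm (-1) Q = {} \<and>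
             (\<forall>s\<in>{1, -1}. \<Union>(Wpm s Q)
                \<subseteq> pball zS (K powr (3/4) * dS) \<inter> graph_side q L \<nu> s (\<psi> s))) \<and>
          (\<forall>s\<in>{1, -1}. (\<Union>Q\<in>S. \<Union>(Wpm s Q))
                \<subseteq> pball zS (K powr (3/4) * dS) \<inter> graph_side q L \<nu> s (\<psi> s)) \<and>
          \<comment> \<open>(2)\<close>
          (\<forall>s\<in>{1, -1}. \<forall>z \<in> (\<Union>Q\<in>S. \<Union>(Wpm s Q)).
             pdist_pt z E \<le> ennreal (A \<eta>) * pdist_pt z (graph_over q L \<nu> (\<psi> s)) \<and>
             pdist_pt z (graph_over q L \<nu> (\<psi> s)) \<le> ennreal (A \<eta>) * pdist_pt z E) \<and>
          \<comment> \<open>(3)\<close>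
          (\<forall>s\<in>{1, -1}. \<forall>z \<in> pball zS (K / 32 * dS) \<inter> graph_side q L \<nu> s (\<psi> s).
             pdist_pt z E \<ge> pdist_pt z (graph_over q L \<nu> (\<psi> s))) \<and>
          \<comment> \<open>(4)\<close>
          (\<forall>s\<in>{1, -1}. pball zS (K / 32 * dS) \<inter> graph_side q L \<nu> s (\<psi> s)
             \<subseteq> (\<Union>Q\<in>S. Ustar_Q E W \<eta> Q)) \<and>
          \<comment> \<open>(5): its first inclusion forces \<open>M0 \<le> K powr (1/8)\<close>, hence the threshold \<open>\<eta>1\<close>\<close>
          (\<forall>s\<in>{1, -1}. \<exists>z \<in> graph_over q L \<nu> (\<psi> s).
             (\<eta> < \<eta>1 \<longrightarrow>
                pball zS (M0 * K powr (3/4) * dS) \<subseteq> pball z (K powr (7/8) * dS)) \<and>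
             pball z (K powr (7/8) * dS) \<subseteq> pball zS (K / 32 * dS)))))"
proof (rule exI[of _ 2], intro conjI allI impI, goal_cases)
  case (2 C0 a0 \<gamma> cs Cc)
  show ?case
  proof (rule exI[of _ "corona_threshold CARD('m) C0 a0 cs"], rule conjI[OF corona_threshold_pos],
      rule exI[of _ "\<lambda>\<eta>. 100 / \<eta> powr (1/2)"], intro allI impI, goal_cases)
    case (1 b2 M0)
    show ?case
    proof (rule exI[of _ "ball_threshold M0"], rule conjI[OF ball_threshold_pos],
        intro allI impI ballI, elim conjE, goal_cases)
      case prems: (1 E M D ctr W \<eta> C\<eta> \<G> \<B> \<S> \<Gamma> T S)
      obtain P q and L :: "real^'m \<Rightarrow> real^'n" and \<nu> \<psi>
        where P: "t_indep_plane P" "plane_coords P q L \<nu>" and \<psi>: "regular_fun \<eta> b2 \<psi>"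
          and regime: "corona_whitney P q L \<nu> E S ctr (top_cube S) \<eta> (parent_ratio C0 a0 cs) \<psi> W"
        by (rule corona_subregimeE[OF assms(2) prems(2,5) 2(2) prems(6) 2(4) prems(7-10,1,3,4)])
      interpret corona_whitney P q L \<nu> E S ctr "top_cube S" \<eta> "parent_ratio C0 a0 cs" \<psi> W
        by (rule regime)
      note regular =
        regular_shifted[OF \<psi> 1(1) below_corona_threshold(3)[OF prems(8,9), folded \<theta>_def]]
      show ?case
        unfolding Let_def
        by (rule exI[of _ P], rule exI[of _ q], rule exI[of _ L], rule exI[of _ \<nu>],
            rule exI[of _ shifted], rule exI[of _ whitney_side], intro conjI ballI UN_least)
          (rule P regular W_Q_eq_sides whitney_sides_disjoint
            whitney_side_subset whitney_side_comparable graph_side_subset_Ustar comparable_balls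
            | erule IntE, rule shifted_graph_dist_le_E_dist | assumption)+
    qed
  qed
qed simp

end
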